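(* Let $G$ be a connected Lie group with Lie algebra $\mathfrak g$, let $J$ be an admissible complex structure on $G\times\mathbb A_{\mathfrak g}$, and let $\gamma_J\colon\mathbb A_{\mathfrak g}\to G^{\mathbb C}$ be a smooth map inducing $J$, that is, such that the generalized polar map $\Pi_{\gamma_J}\colon G\times\mathbb A_{\mathfrak g}\to G^{\mathbb C}$, $(x,a)\mapsto x\,\gamma_J(a)$, is a holomorphic immersion (relative to $J$) onto an open subset of $G^{\mathbb C}$. Then the left invariant complex structure $J$ is biinvariant if and only if $\gamma_J$ is quasi $G$-equivariant, that is, if and only if there is a smooth map $c\colon G\to G^{\mathbb C}$ such that $$\gamma_J(a)^{-1}\,x\,\gamma_J(\mathrm{Ad}_{x^{-1}}a)\,x^{-1}=c(x)\qquad\text{for all }x\in G,\ a\in\mathbb A_{\mathfrak g}.$$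
   Context: Notation. $\mathbb A_{\mathfrak g}$ denotes $\mathfrak g$ viewed merely as an affine (smooth) manifold. The group $G$ acts on $G\times\mathbb A_{\mathfrak g}$ (which is identified with $\mathrm TG$ by left translation) from the left by $y(x,a)=(yx,a)$ and from the right by $(x,a)z=(xz,\mathrm{Ad}_{z^{-1}}a)$. A complex structure on $G\times\mathbb A_{\mathfrak g}$ is left invariant (right invariant) if it is invariant under the left (right) $G$-action, and biinvariant if it is both. A complex structure $J$ on $G\times\mathbb A_{\mathfrak g}$ (i.e. an integrable almost complex structure) is called admissible when $J$ is left $G$-invariant and each left translation $G$-orbit $G\times\{a\}$ is a totally real submanifold (its tangent spaces $W$ satisfy $W\cap JW=0$). $G^{\mathbb C}$ is the (universal) complexification of $G$ and $\overline G\subseteq G^{\mathbb C}$ the image of $G$ under the canonical homomorphism $G\to G^{\mathbb C}$. Products such as $x\,g$ with $x\in G$, $g\in G^{\mathbb C}$ are formed via the canonical homomorphism. Standing assumption: $G\to\overline G$ is a covering projection and the Lie algebra of $G^{\mathbb C}$ is $\mathfrak g^{\mathbb C}=\mathfrak g\oplus i\mathfrak g$ (this holds automatically, with $G=\overline G$, when $G$ is compact). *)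

theory Defs
  imports "HOL-Analysis.Analysis" "HOL-Analysis.Finite_Function_Topology" "HOL-Algebra.Group"
begin

section \<open>Smooth functions on open subsets of a finite-dimensional subspace\<close>

text \<open>
  Manifolds are modelled on a finite-dimensional linear subspace \<open>E\<close> of a normed space rather
  than on a Euclidean type, so that one type of model space, such as
  \<open>nat \<Rightarrow>\<^sub>0 real\<close>, provides all dimensions at once. For \<open>U\<close> open in \<open>E\<close> the derivative within
  \<open>E\<close> is unique on \<open>E\<close>; it is only ever applied to vectors of \<open>E\<close>.
\<close>

primrec Ck_on :: "nat \<Rightarrow> 'e::real_normed_vector set \<Rightarrow> 'e set
    \<Rightarrow> ('e \<Rightarrow> 'f::real_normed_vector) \<Rightarrow> bool" where
  "Ck_on 0 E U f \<longleftrightarrow> continuous_on U f"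
| "Ck_on (Suc k) E U f \<longleftrightarrow>
     (\<exists>D. (\<forall>x\<in>U. (f has_derivative D x) (at x within E)) \<and> (\<forall>v\<in>E. Ck_on k E U (\<lambda>x. D x v)))"

definition smooth_on :: "'e::real_normed_vector set \<Rightarrow> 'e set
    \<Rightarrow> ('e \<Rightarrow> 'f::real_normed_vector) \<Rightarrow> bool" where
  "smooth_on E U f \<longleftrightarrow> (\<forall>k. Ck_on k E U f)"


section \<open>Smooth manifolds\<close>

type_synonym ('a, 'e) chart = "'a set \<times> ('a \<Rightarrow> 'e)"

record ('a, 'e) manifold =
  Model :: "'e set"
  Atlas :: "('a, 'e) chart set"

definition points :: "('a, 'e) manifold \<Rightarrow> 'a set" where
  "points M = (\<Union>c\<in>Atlas M. fst c)"

definition charts_at :: "('a, 'e) manifold \<Rightarrow> 'a \<Rightarrow> ('a, 'e) chart set" where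
  "charts_at M p = {c \<in> Atlas M. p \<in> fst c}"

definition chart_inv :: "('a, 'e) chart \<Rightarrow> 'e \<Rightarrow> 'a" where
  "chart_inv c = inv_into (fst c) (snd c)"

definition transition :: "('a, 'e) chart \<Rightarrow> ('a, 'f) chart \<Rightarrow> 'e \<Rightarrow> 'f" where
  "transition c d = snd d \<circ> chart_inv c"

text \<open>The topology carried by the atlas; see \<open>openin_manifold_topology\<close> below.\<close>

definition manifold_topology :: "('a, 'e::real_normed_vector) manifold \<Rightarrow> 'a topology" where
  "manifold_topology M = topology (\<lambda>S. S \<subseteq> points M \<and>
     (\<forall>c\<in>Atlas M. openin (top_of_set (Model M)) (snd c ` (S \<inter> fst c))))"

text \<open>Charts compatible with the atlas, i.e. members of the maximal atlas.\<close>

definition smooth_chart :: "('a, 'e::real_normed_vector) manifold \<Rightarrow> ('a, 'e) chart \<Rightarrow> bool" where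
  "smooth_chart M c \<longleftrightarrow>
     fst c \<subseteq> points M \<and> inj_on (snd c) (fst c) \<and>
     openin (top_of_set (Model M)) (snd c ` fst c) \<and>
     (\<forall>d\<in>Atlas M.
        openin (top_of_set (Model M)) (snd c ` (fst c \<inter> fst d)) \<and>
        openin (top_of_set (Model M)) (snd d ` (fst c \<inter> fst d)) \<and>
        smooth_on (Model M) (snd c ` (fst c \<inter> fst d)) (transition c d) \<and>
        smooth_on (Model M) (snd d ` (fst c \<inter> fst d)) (transition d c))"

definition smooth_manifold :: "('a, 'e::real_normed_vector) manifold \<Rightarrow> bool" where
  "smooth_manifold M \<longleftrightarrow>
     (\<exists>B. finite B \<and> Model M = span B) \<and>
     (\<forall>c\<in>Atlas M. smooth_chart M c) \<and>
     Hausdorff_space (manifold_topology M) \<and> second_countable (manifold_topology M)"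

lemma openin_manifold_topology:
  assumes "\<forall>c\<in>Atlas M. smooth_chart M c"
  shows "openin (manifold_topology M) S \<longleftrightarrow> S \<subseteq> points M \<and>
     (\<forall>c\<in>Atlas M. openin (top_of_set (Model M)) (snd c ` (S \<inter> fst c)))"
proof -
  let ?P = "\<lambda>S. S \<subseteq> points M \<and>
     (\<forall>c\<in>Atlas M. openin (top_of_set (Model M)) (snd c ` (S \<inter> fst c)))"
  have "istopology ?P"
    unfolding istopology_def
  proof (intro conjI allI impI)
    fix S T assume S: "?P S" and T: "?P T"
    show "S \<inter> T \<subseteq> points M" using S by blast
    show "\<forall>c\<in>Atlas M. openin (top_of_set (Model M)) (snd c ` (S \<inter> T \<inter> fst c))"
    proof
      fix c assume c: "c \<in> Atlas M"
      then have "inj_on (snd c) (fst c)" using assms by (simp add: smooth_chart_def)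
      then have "snd c ` (S \<inter> T \<inter> fst c) = snd c ` (S \<inter> fst c) \<inter> snd c ` (T \<inter> fst c)"
        by (auto simp: inj_on_def)
      then show "openin (top_of_set (Model M)) (snd c ` (S \<inter> T \<inter> fst c))"
        using S T c by (metis openin_Int)
    qed
  next
    fix K assume K: "\<forall>S\<in>K. ?P S"
    then show "\<Union>K \<subseteq> points M" by blast
    show "\<forall>c\<in>Atlas M. openin (top_of_set (Model M)) (snd c ` (\<Union>K \<inter> fst c))"
    proof
      fix c assume "c \<in> Atlas M"
      moreover have "snd c ` (\<Union>K \<inter> fst c) = (\<Union>S\<in>K. snd c ` (S \<inter> fst c))" by blast
      ultimately show "openin (top_of_set (Model M)) (snd c ` (\<Union>K \<inter> fst c))"
        using K by auto
    qed
  qed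
  then show ?thesis unfolding manifold_topology_def by (simp add: topology_inverse')
qed

definition smooth_map :: "('a, 'e::real_normed_vector) manifold
    \<Rightarrow> ('b, 'f::real_normed_vector) manifold \<Rightarrow> ('a \<Rightarrow> 'b) \<Rightarrow> bool" where
  "smooth_map M N f \<longleftrightarrow>
     continuous_map (manifold_topology M) (manifold_topology N) f \<and>
     (\<forall>c\<in>Atlas M. \<forall>d\<in>Atlas N.
        smooth_on (Model M) (snd c ` (fst c \<inter> f -` fst d)) (snd d \<circ> f \<circ> chart_inv c))"

definition prod_manifold :: "('a, 'e) manifold \<Rightarrow> ('b, 'f) manifold
    \<Rightarrow> ('a \<times> 'b, 'e \<times> 'f) manifold" where
  "prod_manifold M N =
     \<lparr>Model = Model M \<times> Model N,
      Atlas = {(fst c \<times> fst d, map_prod (snd c) (snd d)) | c d. c \<in> Atlas M \<and> d \<in> Atlas N}\<rparr>"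


section \<open>Tangent vectors\<close>

text \<open>
  A tangent vector at \<open>p\<close> is the family of its components in all charts of the atlas at \<open>p\<close>,
  subject to the usual transformation law, and put to \<open>0\<close> at the other charts. The vector space
  operations are pointwise and the zero vector is \<open>\<lambda>_. 0\<close>.
\<close>

type_synonym ('a, 'e) tvec = "('a, 'e) chart \<Rightarrow> 'e"

definition tangent_space :: "('a, 'e::real_normed_vector) manifold \<Rightarrow> 'a \<Rightarrow> ('a, 'e) tvec set" where
  "tangent_space M p = {v.
     (\<forall>c\<in>charts_at M p. v c \<in> Model M) \<and>
     (\<forall>c\<in>charts_at M p. \<forall>d\<in>charts_at M p.
        v d = frechet_derivative (transition c d) (at (snd c p) within Model M) (v c)) \<and>
     (\<forall>c. c \<notin> charts_at M p \<longrightarrow> v c = 0)}"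

text \<open>The tangent vector at \<open>p\<close> whose component in the chart \<open>c\<close> is \<open>e\<close>.\<close>

definition coord_vec :: "('a, 'e::real_normed_vector) manifold \<Rightarrow> 'a \<Rightarrow> ('a, 'e) chart
    \<Rightarrow> 'e \<Rightarrow> ('a, 'e) tvec" where
  "coord_vec M p c e = (\<lambda>d. if d \<in> charts_at M p
     then frechet_derivative (transition c d) (at (snd c p) within Model M) e else 0)"

text \<open>
  Derivative at \<open>p\<close> of a vector-valued function in the direction \<open>v\<close>; by the chain rule the
  choice of the chart is immaterial when \<open>v\<close> is a tangent vector at \<open>p\<close>.
\<close>

definition tderiv :: "('a, 'e::real_normed_vector) manifold \<Rightarrow> ('a \<Rightarrow> 'f::real_normed_vector)
    \<Rightarrow> 'a \<Rightarrow> ('a, 'e) tvec \<Rightarrow> 'f" where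
  "tderiv M f p v = (let c = (SOME c. c \<in> charts_at M p)
     in frechet_derivative (f \<circ> chart_inv c) (at (snd c p) within Model M) (v c))"

definition tangent_map :: "('a, 'e::real_normed_vector) manifold
    \<Rightarrow> ('b, 'f::real_normed_vector) manifold \<Rightarrow> ('a \<Rightarrow> 'b) \<Rightarrow> 'a
    \<Rightarrow> ('a, 'e) tvec \<Rightarrow> ('b, 'f) tvec" where
  "tangent_map M N f p v =
     (\<lambda>d. if d \<in> charts_at N (f p) then tderiv M (snd d \<circ> f) p v else 0)"

text \<open>The tangent space at a point, viewed merely as an affine manifold.\<close>

definition tangent_space_manifold :: "('a, 'e::real_normed_vector) manifold \<Rightarrow> 'a
    \<Rightarrow> (('a, 'e) tvec, 'e) manifold" where
  "tangent_space_manifold M p =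
     \<lparr>Model = Model M, Atlas = {(tangent_space M p, \<lambda>v. v c) | c. c \<in> charts_at M p}\<rparr>"


section \<open>Complex structures\<close>

type_synonym ('a, 'e) tensor = "'a \<Rightarrow> ('a, 'e) tvec \<Rightarrow> ('a, 'e) tvec"

definition almost_complex_structure :: "('a, 'e::real_normed_vector) manifold
    \<Rightarrow> ('a, 'e) tensor \<Rightarrow> bool" where
  "almost_complex_structure M J \<longleftrightarrow>
     (\<forall>p\<in>points M. \<forall>v\<in>tangent_space M p.
        J p v \<in> tangent_space M p \<and>
        J p (J p v) = (\<lambda>c. - v c) \<and>
        (\<forall>r. J p (\<lambda>c. r *\<^sub>R v c) = (\<lambda>c. r *\<^sub>R J p v c)) \<and>
        (\<forall>w\<in>tangent_space M p. J p (\<lambda>c. v c + w c) = (\<lambda>c. J p v c + J p w c))) \<and>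
     (\<forall>c\<in>Atlas M. \<forall>e\<in>Model M. smooth_on (Model M) (snd c ` fst c)
        (\<lambda>x. J (chart_inv c x) (coord_vec M (chart_inv c x) c e) c))"

text \<open>
  Integrability: around every point there is a smooth chart \<open>z\<close> in which \<open>J\<close> becomes a constant
  linear complex structure \<open>I\<close> of the model space \<open>E\<close>. As \<open>(E, I)\<close> is a complex vector space
  isomorphic to \<open>\<complex>\<^sup>m\<close>, such \<open>z\<close> are exactly the local holomorphic coordinates.
\<close>

definition integrable_structure :: "('a, 'e::real_normed_vector) manifold
    \<Rightarrow> ('a, 'e) tensor \<Rightarrow> bool" where
  "integrable_structure M J \<longleftrightarrow>
     (\<forall>p\<in>points M. \<exists>z I. smooth_chart M z \<and> p \<in> fst z \<and>
        linear I \<and> (\<forall>e\<in>Model M. I e \<in> Model M \<and> I (I e) = - e) \<and>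
        (\<forall>q\<in>fst z. \<forall>v\<in>tangent_space M q.
           tderiv M (snd z) q (J q v) = I (tderiv M (snd z) q v)))"

definition complex_structure :: "('a, 'e::real_normed_vector) manifold
    \<Rightarrow> ('a, 'e) tensor \<Rightarrow> bool" where
  "complex_structure M J \<longleftrightarrow> almost_complex_structure M J \<and> integrable_structure M J"

definition holomorphic_map :: "('a, 'e::real_normed_vector) manifold \<Rightarrow> ('a, 'e) tensor
    \<Rightarrow> ('b, 'f::real_normed_vector) manifold \<Rightarrow> ('b, 'f) tensor \<Rightarrow> ('a \<Rightarrow> 'b) \<Rightarrow> bool" where
  "holomorphic_map M J N K f \<longleftrightarrow> smooth_map M N f \<and>
     (\<forall>p\<in>points M. \<forall>v\<in>tangent_space M p.
        tangent_map M N f p (J p v) = K (f p) (tangent_map M N f p v))"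

definition prod_structure :: "('a, 'e::real_normed_vector) manifold \<Rightarrow> ('a, 'e) tensor
    \<Rightarrow> ('b, 'f::real_normed_vector) manifold \<Rightarrow> ('b, 'f) tensor
    \<Rightarrow> ('a \<times> 'b, 'e \<times> 'f) tensor" where
  "prod_structure M J N K = (\<lambda>p v. THE w.
     w \<in> tangent_space (prod_manifold M N) p \<and>
     tangent_map (prod_manifold M N) M fst p w
       = J (fst p) (tangent_map (prod_manifold M N) M fst p v) \<and>
     tangent_map (prod_manifold M N) N snd p w
       = K (snd p) (tangent_map (prod_manifold M N) N snd p v))"


section \<open>Lie groups\<close>

record ('a, 'e) lie_structure = "'a monoid" +
  manif :: "('a, 'e) manifold"

record ('a, 'e) complex_lie_structure = "('a, 'e) lie_structure" +
  cstr :: "('a, 'e) tensor"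

definition lie_group :: "('a, 'e::real_normed_vector, 'm) lie_structure_scheme \<Rightarrow> bool" where
  "lie_group G \<longleftrightarrow> group G \<and> smooth_manifold (manif G) \<and> points (manif G) = carrier G \<and>
     smooth_map (prod_manifold (manif G) (manif G)) (manif G) (\<lambda>(x, y). x \<otimes>\<^bsub>G\<^esub> y) \<and>
     smooth_map (manif G) (manif G) (\<lambda>x. inv\<^bsub>G\<^esub> x)"

definition complex_lie_group ::
    "('a, 'e::real_normed_vector, 'm) complex_lie_structure_scheme \<Rightarrow> bool" where
  "complex_lie_group G \<longleftrightarrow> lie_group G \<and> complex_structure (manif G) (cstr G) \<and>
     holomorphic_map (prod_manifold (manif G) (manif G))
       (prod_structure (manif G) (cstr G) (manif G) (cstr G)) (manif G) (cstr G)
       (\<lambda>(x, y). x \<otimes>\<^bsub>G\<^esub> y) \<and>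
     holomorphic_map (manif G) (cstr G) (manif G) (cstr G) (\<lambda>x. inv\<^bsub>G\<^esub> x)"

definition lie_algebra :: "('a, 'e::real_normed_vector, 'm) lie_structure_scheme
    \<Rightarrow> ('a, 'e) tvec set" where
  "lie_algebra G = tangent_space (manif G) \<one>\<^bsub>G\<^esub>"

definition Ad :: "('a, 'e::real_normed_vector, 'm) lie_structure_scheme \<Rightarrow> 'a
    \<Rightarrow> ('a, 'e) tvec \<Rightarrow> ('a, 'e) tvec" where
  "Ad G x = tangent_map (manif G) (manif G) (\<lambda>y. x \<otimes>\<^bsub>G\<^esub> y \<otimes>\<^bsub>G\<^esub> inv\<^bsub>G\<^esub> x) \<one>\<^bsub>G\<^esub>"

definition lie_hom :: "('a, 'e::real_normed_vector, 'm) lie_structure_scheme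
    \<Rightarrow> ('b, 'f::real_normed_vector, 'n) lie_structure_scheme \<Rightarrow> ('a \<Rightarrow> 'b) \<Rightarrow> bool" where
  "lie_hom G H f \<longleftrightarrow> f \<in> hom G H \<and> smooth_map (manif G) (manif H) f"

definition holomorphic_hom :: "('a, 'e::real_normed_vector, 'm) complex_lie_structure_scheme
    \<Rightarrow> ('b, 'f::real_normed_vector, 'n) complex_lie_structure_scheme \<Rightarrow> ('a \<Rightarrow> 'b) \<Rightarrow> bool" where
  "holomorphic_hom G H f \<longleftrightarrow> f \<in> hom G H \<and>
     holomorphic_map (manif G) (cstr G) (manif H) (cstr H) f"

text \<open>
  The universal property is quantified over all complex Lie groups \<open>H\<close>: a second countable Lie
  group has at most continuum many points and a finite-dimensional model space, so every complex
  Lie group is isomorphic to one whose points are real numbers and whose model space is a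
  finite-dimensional subspace of \<open>nat \<Rightarrow>\<^sub>0 real\<close>.
\<close>

definition universal_complexification :: "('a, 'e::real_normed_vector, 'm) lie_structure_scheme
    \<Rightarrow> ('b, 'f::real_normed_vector, 'n) complex_lie_structure_scheme \<Rightarrow> ('a \<Rightarrow> 'b) \<Rightarrow> bool" where
  "universal_complexification G GC \<iota> \<longleftrightarrow>
     complex_lie_group GC \<and> lie_hom G GC \<iota> \<and>
     (\<forall>(H :: (real, nat \<Rightarrow>\<^sub>0 real) complex_lie_structure) f.
        complex_lie_group H \<and> lie_hom G H f \<longrightarrow>
        (\<exists>F. holomorphic_hom GC H F \<and> (\<forall>x\<in>carrier G. F (\<iota> x) = f x) \<and>
           (\<forall>F'. holomorphic_hom GC H F' \<and> (\<forall>x\<in>carrier G. F' (\<iota> x) = f x) \<longrightarrow>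
              (\<forall>g\<in>carrier GC. F' g = F g))))"

definition covering_projection :: "'a topology \<Rightarrow> 'b topology \<Rightarrow> ('a \<Rightarrow> 'b) \<Rightarrow> bool" where
  "covering_projection X Y p \<longleftrightarrow>
     continuous_map X Y p \<and> p ` topspace X = topspace Y \<and>
     (\<forall>y\<in>topspace Y. \<exists>V \<U>. openin Y V \<and> y \<in> V \<and>
        \<Union>\<U> = {x \<in> topspace X. p x \<in> V} \<and> (\<forall>U\<in>\<U>. openin X U) \<and> pairwise disjnt \<U> \<and>
        (\<forall>U\<in>\<U>. homeomorphic_map (subtopology X U) (subtopology Y V) p))"

text \<open>
  The standing assumption on \<open>\<iota>\<close>, the canonical homomorphism from \<open>G\<close> to its complexification.
  The second part expresses that the Lie algebra of the complexification is \<open>\<gg> \<oplus> i\<gg>\<close>, where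
  uniqueness of the decomposition includes injectivity of the differential of \<open>\<iota>\<close>.
\<close>

definition standing_assumption :: "('a, 'e::real_normed_vector, 'm) lie_structure_scheme
    \<Rightarrow> ('b, 'f::real_normed_vector, 'n) complex_lie_structure_scheme \<Rightarrow> ('a \<Rightarrow> 'b) \<Rightarrow> bool" where
  "standing_assumption G GC \<iota> \<longleftrightarrow>
     covering_projection (manifold_topology (manif G))
       (subtopology (manifold_topology (manif GC)) (\<iota> ` carrier G)) \<iota> \<and>
     (\<forall>w\<in>lie_algebra GC. \<exists>!(u, v). u \<in> lie_algebra G \<and> v \<in> lie_algebra G \<and>
        w = (\<lambda>d. tangent_map (manif G) (manif GC) \<iota> \<one>\<^bsub>G\<^esub> u d
               + cstr GC \<one>\<^bsub>GC\<^esub> (tangent_map (manif G) (manif GC) \<iota> \<one>\<^bsub>G\<^esub> v) d))"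


section \<open>Complex structures on the product of a Lie group and its Lie algebra\<close>

abbreviation affine_lie_algebra :: "('a, 'e::real_normed_vector, 'm) lie_structure_scheme
    \<Rightarrow> (('a, 'e) tvec, 'e) manifold" where
  "affine_lie_algebra G \<equiv> tangent_space_manifold (manif G) \<one>\<^bsub>G\<^esub>"

definition GxA :: "('a, 'e::real_normed_vector, 'm) lie_structure_scheme
    \<Rightarrow> ('a \<times> ('a, 'e) tvec, 'e \<times> 'e) manifold" where
  "GxA G = prod_manifold (manif G) (affine_lie_algebra G)"

definition left_act :: "('a, 'e, 'm) lie_structure_scheme
    \<Rightarrow> 'a \<Rightarrow> 'a \<times> ('a, 'e) tvec \<Rightarrow> 'a \<times> ('a, 'e) tvec" where
  "left_act G y = (\<lambda>(x, a). (y \<otimes>\<^bsub>G\<^esub> x, a))"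

definition right_act :: "('a, 'e::real_normed_vector, 'm) lie_structure_scheme
    \<Rightarrow> 'a \<Rightarrow> 'a \<times> ('a, 'e) tvec \<Rightarrow> 'a \<times> ('a, 'e) tvec" where
  "right_act G z = (\<lambda>(x, a). (x \<otimes>\<^bsub>G\<^esub> z, Ad G (inv\<^bsub>G\<^esub> z) a))"

definition invariant_under :: "('a, 'e::real_normed_vector) manifold \<Rightarrow> ('a, 'e) tensor
    \<Rightarrow> ('a \<Rightarrow> 'a) \<Rightarrow> bool" where
  "invariant_under M J \<phi> \<longleftrightarrow> (\<forall>p\<in>points M. \<forall>v\<in>tangent_space M p.
     tangent_map M M \<phi> p (J p v) = J (\<phi> p) (tangent_map M M \<phi> p v))"

definition left_invariant :: "('a, 'e::real_normed_vector, 'm) lie_structure_scheme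
    \<Rightarrow> ('a \<times> ('a, 'e) tvec, 'e \<times> 'e) tensor \<Rightarrow> bool" where
  "left_invariant G J \<longleftrightarrow> (\<forall>y\<in>carrier G. invariant_under (GxA G) J (left_act G y))"

definition right_invariant :: "('a, 'e::real_normed_vector, 'm) lie_structure_scheme
    \<Rightarrow> ('a \<times> ('a, 'e) tvec, 'e \<times> 'e) tensor \<Rightarrow> bool" where
  "right_invariant G J \<longleftrightarrow> (\<forall>z\<in>carrier G. invariant_under (GxA G) J (right_act G z))"

definition biinvariant :: "('a, 'e::real_normed_vector, 'm) lie_structure_scheme
    \<Rightarrow> ('a \<times> ('a, 'e) tvec, 'e \<times> 'e) tensor \<Rightarrow> bool" where
  "biinvariant G J \<longleftrightarrow> left_invariant G J \<and> right_invariant G J"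

definition orbit_tangent_space :: "('a, 'e::real_normed_vector, 'm) lie_structure_scheme
    \<Rightarrow> 'a \<times> ('a, 'e) tvec \<Rightarrow> ('a \<times> ('a, 'e) tvec, 'e \<times> 'e) tvec set" where
  "orbit_tangent_space G = (\<lambda>(x, a).
     tangent_map (manif G) (GxA G) (\<lambda>y. (y, a)) x ` tangent_space (manif G) x)"

definition admissible :: "('a, 'e::real_normed_vector, 'm) lie_structure_scheme
    \<Rightarrow> ('a \<times> ('a, 'e) tvec, 'e \<times> 'e) tensor \<Rightarrow> bool" where
  "admissible G J \<longleftrightarrow> complex_structure (GxA G) J \<and> left_invariant G J \<and>
     (\<forall>p\<in>points (GxA G).
        orbit_tangent_space G p \<inter> J p ` orbit_tangent_space G p = {\<lambda>_. 0})"

definition polar_map :: "('b, 'n) monoid_scheme \<Rightarrow> ('a \<Rightarrow> 'b) \<Rightarrow> ('t \<Rightarrow> 'b) \<Rightarrow> 'a \<times> 't \<Rightarrow> 'b" where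
  "polar_map GC \<iota> \<gamma> = (\<lambda>(x, a). \<iota> x \<otimes>\<^bsub>GC\<^esub> \<gamma> a)"

definition immersion :: "('a, 'e::real_normed_vector) manifold
    \<Rightarrow> ('b, 'f::real_normed_vector) manifold \<Rightarrow> ('a \<Rightarrow> 'b) \<Rightarrow> bool" where
  "immersion M N f \<longleftrightarrow> smooth_map M N f \<and>
     (\<forall>p\<in>points M. inj_on (tangent_map M N f p) (tangent_space M p))"

definition induces :: "('a, 'e::real_normed_vector, 'm) lie_structure_scheme
    \<Rightarrow> ('b, 'f::real_normed_vector, 'n) complex_lie_structure_scheme \<Rightarrow> ('a \<Rightarrow> 'b)
    \<Rightarrow> (('a, 'e) tvec \<Rightarrow> 'b) \<Rightarrow> ('a \<times> ('a, 'e) tvec, 'e \<times> 'e) tensor \<Rightarrow> bool" where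
  "induces G GC \<iota> \<gamma> J \<longleftrightarrow>
     smooth_map (affine_lie_algebra G) (manif GC) \<gamma> \<and>
     holomorphic_map (GxA G) J (manif GC) (cstr GC) (polar_map GC \<iota> \<gamma>) \<and>
     immersion (GxA G) (manif GC) (polar_map GC \<iota> \<gamma>) \<and>
     openin (manifold_topology (manif GC)) (polar_map GC \<iota> \<gamma> ` points (GxA G))"

definition quasi_equivariant :: "('a, 'e::real_normed_vector, 'm) lie_structure_scheme
    \<Rightarrow> ('b, 'f::real_normed_vector, 'n) complex_lie_structure_scheme \<Rightarrow> ('a \<Rightarrow> 'b)
    \<Rightarrow> (('a, 'e) tvec \<Rightarrow> 'b) \<Rightarrow> bool" where
  "quasi_equivariant G GC \<iota> \<gamma> \<longleftrightarrow>
     (\<exists>c. smooth_map (manif G) (manif GC) c \<and>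
       (\<forall>x\<in>carrier G. \<forall>a\<in>lie_algebra G.
          inv\<^bsub>GC\<^esub> (\<gamma> a) \<otimes>\<^bsub>GC\<^esub> \<iota> x \<otimes>\<^bsub>GC\<^esub> \<gamma> (Ad G (inv\<^bsub>G\<^esub> x) a) \<otimes>\<^bsub>GC\<^esub> inv\<^bsub>GC\<^esub> (\<iota> x) = c x))"

end

theory Submission
  imports Defs
begin

text \<open>
  Write \<open>\<Pi>(x, a) = \<iota>(x) \<gamma>(a)\<close> for the polar map and \<open>R\<^sub>z\<close> for the right action of \<open>z\<close> on
  \<open>G \<times> \<gg>\<close>, and put \<open>q\<^sub>z(a) = \<gamma>(a)\<^sup>-\<^sup>1 \<iota>(z) \<gamma>(Ad(z\<^sup>-\<^sup>1) a) \<iota>(z)\<^sup>-\<^sup>1\<close>. As \<open>\<iota>\<close> is a homomorphism,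
  \<open>\<Pi>(R\<^sub>z(x, a)) = \<Pi>(x, a) q\<^sub>z(a) \<iota>(z)\<close>. The heart of the matter
  (\<open>invariant_under_right_act_iff\<close>) is that, for each \<open>z\<close> separately, \<open>R\<^sub>z\<close> preserves \<open>J\<close> if and
  only if \<open>q\<^sub>z\<close> is constant.

  If \<open>q\<^sub>z\<close> is constant, then \<open>\<Pi>\<close> intertwines \<open>R\<^sub>z\<close> with a right translation of the
  complexification. Translations are holomorphic, and \<open>\<Pi>\<close> is holomorphic with injective
  differential, so \<open>R\<^sub>z\<close> commutes with \<open>J\<close>.

  Conversely, let \<open>R\<^sub>z\<close> preserve \<open>J\<close>. Then \<open>F = \<Pi>\<^sup>-\<^sup>1 (\<Pi> \<circ> R\<^sub>z)\<close>, a pointwise product in a complex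
  Lie group, is holomorphic, and \<open>F(x, a) = q\<^sub>z(a) \<iota>(z)\<close> does not depend on \<open>x\<close>. Hence \<open>dF\<close>
  vanishes on the tangent space \<open>W\<close> of the left orbit and, being complex linear, on \<open>J W\<close>. As \<open>W\<close>
  is totally real of half the dimension, \<open>W + J W\<close> is the whole tangent space
  (\<open>totally_real_slice_spans\<close>). So \<open>dF = 0\<close>, and \<open>q\<^sub>z\<close> is constant because \<open>\<gg>\<close> is connected
  (\<open>zero_tangent_map_imp_constant\<close>).

  The map \<open>c\<close> is found by evaluating at \<open>a = 0\<close>, which \<open>Ad\<close> fixes:
  \<open>c(x) = \<gamma>(0)\<^sup>-\<^sup>1 \<iota>(x) \<gamma>(0) \<iota>(x)\<^sup>-\<^sup>1\<close>. It is smooth since it is put together from \<open>\<iota>\<close> and the group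
  operations.

  These arguments rest on a calculus of smooth maps: composites and pairs of smooth maps are smooth
  (by way of the local criterion \<open>smooth_mapI\<close>), and tangent maps obey the chain rule
  (\<open>tangent_map_compose\<close>). One point needs care. The models are finite-dimensional subspaces of
  normed spaces, and a derivative is a bounded linear map on the whole normed space, of which only
  the restriction to the subspace is determined. Differentiating a composite repeatedly
  requires the coordinates of the subspace to extend to bounded functionals on the whole space; this
  is where the Hahn-Banach theorem enters.
\<close>

section \<open>Bounded coordinate functionals of a finite-dimensional subspace\<close>

text \<open>
  A linear functional of norm at most 1 on a subspace is encoded by its graph \<open>g\<close>. The bound
  \<open>r \<le> norm x\<close> already makes \<open>g\<close> single-valued, for \<open>(0, r)\<close> and \<open>(0, -r)\<close> lie in \<open>g\<close> together. The value
  \<open>\<xi>\<close> at the new vector \<open>x0\<close> is squeezed between all \<open>r - norm (y - x0)\<close> and all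
  \<open>norm (y + x0) - r\<close>, which is possible by the triangle inequality.
\<close>

lemma hahn_banach_extension_step:
  fixes g :: "('e::real_normed_vector \<times> real) set"
  assumes g: "subspace g" and le: "\<And>x r. (x, r) \<in> g \<Longrightarrow> r \<le> norm x"
  shows "\<exists>g'. subspace g' \<and> g \<subseteq> g' \<and> (\<forall>(x, r)\<in>g'. r \<le> norm x) \<and> x0 \<in> fst ` g'"
proof -
  define S where "S = (\<lambda>(y, r). r - norm (y - x0)) ` g"
  have bound: "r - norm (y - x0) \<le> norm (y' + x0) - r'" if "(y, r) \<in> g" "(y', r') \<in> g" for y r y' r'
  proof -
    have "(y + y', r + r') \<in> g" using subspace_add[OF g that] by simp
    then have "r + r' \<le> norm (y + y')" by (rule le)
    also have "\<dots> = norm ((y - x0) + (y' + x0))" by (simp add: algebra_simps)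
    also have "\<dots> \<le> norm (y - x0) + norm (y' + x0)" by (rule norm_triangle_ineq)
    finally show ?thesis by simp
  qed
  have zero: "(0, 0) \<in> g" using subspace_0[OF g] by (simp add: zero_prod_def)
  define \<xi> where "\<xi> = Sup S"
  have bdd: "bdd_above S"
    unfolding bdd_above_def S_def using bound[OF _ zero] by (intro exI[of _ "norm (0 + x0) - 0"]) auto
  have lower: "r - norm (y - x0) \<le> \<xi>" if "(y, r) \<in> g" for y r
    unfolding \<xi>_def by (rule cSup_upper[OF _ bdd]) (use that in \<open>force simp: S_def\<close>)
  have upper: "\<xi> \<le> norm (y + x0) - r" if "(y, r) \<in> g" for y r
    unfolding \<xi>_def by (rule cSup_least) (use that zero bound in \<open>auto simp: S_def\<close>)
  define g' where "g' = {p + q | p q. p \<in> g \<and> q \<in> span {(x0, \<xi>)}}"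
  have "subspace g'" unfolding g'_def by (rule subspace_sums[OF g subspace_span])
  moreover have "g \<subseteq> g'"
  proof
    fix p assume "p \<in> g"
    moreover have "0 \<in> span {(x0, \<xi>)}" by (rule span_zero)
    moreover have "p = p + 0" by simp
    ultimately show "p \<in> g'" unfolding g'_def by blast
  qed
  moreover have "(x0, \<xi>) \<in> g'"
  proof -
    have "(x0, \<xi>) = 0 + (x0, \<xi>)" by simp
    moreover have "0 \<in> g" by (rule subspace_0[OF g])
    moreover have "(x0, \<xi>) \<in> span {(x0, \<xi>)}" by (simp add: span_base)
    ultimately show ?thesis unfolding g'_def by blast
  qed
  then have "x0 \<in> fst ` g'" by force
  moreover have "r \<le> norm x" if xr: "(x, r) \<in> g'" for x r
  proof -
    obtain y s t where y: "(y, s) \<in> g" and x: "x = y + t *\<^sub>R x0" and r: "r = s + t * \<xi>"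
      using xr unfolding g'_def span_singleton by fastforce
    have sc: "(c *\<^sub>R y, c * s) \<in> g" for c
      using subspace_scale[OF g y, of c] by simp
    \<comment> \<open>Dividing by the absolute value of \<open>t\<close> reduces the claim to one of the two bounds on \<open>\<xi>\<close>.\<close>
    consider "t = 0" | "t > 0" | "t < 0" by linarith
    then show ?thesis
    proof cases
      case 1 then show ?thesis using le[OF y] x r by simp
    next
      case 2
      have "\<xi> \<le> norm ((1/t) *\<^sub>R y + x0) - (1/t) * s" by (rule upper[OF sc])
      then have "t * \<xi> \<le> t * norm ((1/t) *\<^sub>R y + x0) - s" using 2 by (simp add: field_simps)
      also have "t * norm ((1/t) *\<^sub>R y + x0) = norm (t *\<^sub>R ((1/t) *\<^sub>R y + x0))" using 2 by simp
      also have "t *\<^sub>R ((1/t) *\<^sub>R y + x0) = x" using 2 x by (simp add: scaleR_add_right)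
      finally show ?thesis using r by simp
    next
      case 3
      define z where "z = (-1/t) *\<^sub>R y - x0"
      have "(-1/t) * s - norm z \<le> \<xi>" unfolding z_def by (rule lower[OF sc])
      then have "s + t * norm z \<le> - t * \<xi>" using 3 by (simp add: field_simps)
      moreover have "(- t) *\<^sub>R z = x" using 3 x by (simp add: z_def scaleR_diff_right)
      then have "norm x = - t * norm z" using 3 by (metis abs_of_neg norm_scaleR abs_minus_cancel)
      ultimately show ?thesis using r by simp
    qed
  qed
  ultimately show ?thesis by blast
qed

text \<open>
  The Hahn-Banach theorem for the line through \<open>x0\<close>: by Zorn's lemma there is a maximal graph
  containing \<open>(x0, norm x0)\<close>, and by the extension step it is defined everywhere.
\<close>

lemma norming_functional:
  fixes x0 :: "'e::real_normed_vector"
  shows "\<exists>\<psi>::'e \<Rightarrow> real. bounded_linear \<psi> \<and> \<psi> x0 = norm x0"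
proof -
  define P where "P g \<longleftrightarrow> subspace g \<and> (x0, norm x0) \<in> g \<and> (\<forall>(x, r)\<in>g. r \<le> norm x)"
    for g :: "('e \<times> real) set"
  have "r \<le> norm x" if xr: "(x, r) \<in> span {(x0, norm x0)}" for x r
  proof -
    obtain k where "(x, r) = k *\<^sub>R (x0, norm x0)" using xr unfolding span_singleton by blast
    then show ?thesis by (simp add: mult_right_mono)
  qed
  then have "P (span {(x0, norm x0)})"
    unfolding P_def by (auto simp: span_base)
  then have ne: "Collect P \<noteq> {}" by auto
  have "\<exists>g\<in>Collect P. \<forall>h\<in>Collect P. g \<subseteq> h \<longrightarrow> h = g"
  proof (rule subset_Zorn_nonempty[OF ne])
    fix \<C> assume \<C>: "\<C> \<noteq> {}" "subset.chain (Collect P) \<C>"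
    have sub: "subspace g" "(x0, norm x0) \<in> g" "\<forall>(x, r)\<in>g. r \<le> norm x" if "g \<in> \<C>" for g
    proof -
      have "P g" using \<C> that by (auto simp: subset.chain_def)
      then show "subspace g" "(x0, norm x0) \<in> g" "\<forall>(x, r)\<in>g. r \<le> norm x"
        unfolding P_def by blast+
    qed
    have "subspace (\<Union>\<C>)"
      unfolding subspace_def
    proof (intro conjI ballI allI)
      show "0 \<in> \<Union>\<C>" using \<C>(1) sub(1) subspace_0 by blast
      show "c *\<^sub>R x \<in> \<Union>\<C>" if "x \<in> \<Union>\<C>" for c x
        using that sub(1) subspace_scale by blast
      fix x y assume "x \<in> \<Union>\<C>" "y \<in> \<Union>\<C>"
      then obtain g h where gh: "g \<in> \<C>" "h \<in> \<C>" "x \<in> g" "y \<in> h" by blast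
      then have "g \<subseteq> h \<or> h \<subseteq> g" using \<C>(2) by (auto simp: subset.chain_def)
      then have "\<exists>k\<in>\<C>. x \<in> k \<and> y \<in> k" using gh by blast
      then show "x + y \<in> \<Union>\<C>" using sub(1) subspace_add by blast
    qed
    moreover have "(x0, norm x0) \<in> \<Union>\<C>" using \<C>(1) sub(2) by blast
    moreover have "\<forall>(x, r)\<in>\<Union>\<C>. r \<le> norm x" using sub(3) by blast
    ultimately show "\<Union>\<C> \<in> Collect P" by (simp add: P_def)
  qed
  then obtain g where g: "P g" and max: "\<And>h. P h \<Longrightarrow> g \<subseteq> h \<Longrightarrow> h = g" by blast
  have sg: "subspace g" and le: "\<And>x r. (x, r) \<in> g \<Longrightarrow> r \<le> norm x" using g by (auto simp: P_def)
  have total: "\<exists>r. (x, r) \<in> g" for x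
  proof -
    obtain g' where "subspace g'" "g \<subseteq> g'" "\<forall>(x, r)\<in>g'. r \<le> norm x" "x \<in> fst ` g'"
      using hahn_banach_extension_step[of g x] sg le by auto
    moreover from this have "g' = g" using g by (intro max) (auto simp: P_def)
    ultimately have "x \<in> fst ` g" by simp
    then show ?thesis by auto
  qed
  have neg: "(- x, - r) \<in> g" if "(x, r) \<in> g" for x r
    using subspace_neg[OF sg that] by simp
  have unique: "r = s" if "(x, r) \<in> g" "(x, s) \<in> g" for x r s
  proof -
    have "(0, r - s) \<in> g" "(0, s - r) \<in> g"
      using subspace_diff[OF sg that] subspace_diff[OF sg that(2,1)] by auto
    from this[THEN le] show ?thesis by simp
  qed
  define \<psi> where "\<psi> x = (SOME r. (x, r) \<in> g)" for x
  have \<psi>: "(x, \<psi> x) \<in> g" for x unfolding \<psi>_def by (rule someI_ex[OF total])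
  have "bounded_linear \<psi>"
  proof (rule bounded_linear_intro[of _ 1])
    show "\<psi> (x + y) = \<psi> x + \<psi> y" for x y
      using subspace_add[OF sg \<psi>[of x] \<psi>[of y]] unique \<psi>[of "x + y"] by simp
    show "\<psi> (c *\<^sub>R x) = c *\<^sub>R \<psi> x" for c x
      using subspace_scale[OF sg \<psi>[of x], of c] unique \<psi>[of "c *\<^sub>R x"] by simp
    show "norm (\<psi> x) \<le> norm x * 1" for x
      using le[OF \<psi>[of x]] le[OF neg[OF \<psi>[of x]]] by (simp add: abs_le_iff)
  qed
  moreover have "\<psi> x0 = norm x0" using g \<psi> unique by (auto simp: P_def)
  ultimately show ?thesis by blast
qed

text \<open>
  The functionals \<open>\<phi> c\<close> are bounded on the whole space, so that \<open>\<lambda>x. \<Sum>c\<in>C. \<phi> c x *\<^sub>R c\<close> is a bounded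
  projection onto the span. In the induction, the projection \<open>P\<close> for \<open>B\<close> turns a new vector \<open>b\<close>
  into \<open>b - P b\<close>, and a norming functional of that vector, composed with \<open>\<lambda>x. x - P x\<close>, is a new
  coordinate that vanishes on the old span.
\<close>

lemma finite_span_coordinates:
  fixes B :: "'e::real_normed_vector set"
  assumes "finite B"
  shows "\<exists>C (\<phi>::'e \<Rightarrow> 'e \<Rightarrow> real). finite C \<and> C \<subseteq> span B \<and> (\<forall>c\<in>C. bounded_linear (\<phi> c)) \<and>
    (\<forall>x\<in>span B. (\<Sum>c\<in>C. \<phi> c x *\<^sub>R c) = x)"
  using assms
proof (induction B)
  case empty
  show ?case by (rule exI[of _ "{}"]) auto
next
  case (insert b B)
  obtain C and \<phi> :: "'e \<Rightarrow> 'e \<Rightarrow> real" where C: "finite C" "C \<subseteq> span B"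
    and \<phi>: "\<And>c. c \<in> C \<Longrightarrow> bounded_linear (\<phi> c)"
    and rep: "\<And>x. x \<in> span B \<Longrightarrow> (\<Sum>c\<in>C. \<phi> c x *\<^sub>R c) = x"
    using insert.IH by blast
  define P where "P x = (\<Sum>c\<in>C. \<phi> c x *\<^sub>R c)" for x
  have P: "bounded_linear P"
    unfolding P_def
    by (intro bounded_linear_sum bounded_linear_compose[OF bounded_linear_scaleR_left] \<phi>)
  have Pspan: "P x \<in> span B" for x
    unfolding P_def using C(2) by (intro span_sum span_scale) auto
  define b' where "b' = b - P b"
  show ?case
  proof (cases "b' = 0")
    case True
    then have "b \<in> span B" using Pspan[of b] by (simp add: b'_def)
    then have "span (insert b B) = span B" by (rule span_redundant)
    then show ?thesis using C \<phi> rep by (intro exI[of _ C] exI[of _ \<phi>]) auto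
  next
    case False
    obtain \<psi> :: "'e \<Rightarrow> real" where \<psi>: "bounded_linear \<psi>" "\<psi> b' = norm b'"
      using norming_functional by blast
    define \<eta> where "\<eta> x = \<psi> (x - P x) / norm b'" for x
    have \<eta>: "bounded_linear \<eta>"
      unfolding \<eta>_def divide_inverse
      by (intro bounded_linear_compose[OF bounded_linear_mult_left]
            bounded_linear_compose[OF \<psi>(1)] bounded_linear_sub bounded_linear_ident P)
    interpret P: bounded_linear P by (rule P)
    interpret \<eta>: bounded_linear \<eta> by (rule \<eta>)
    have \<eta>0: "\<eta> x = 0" if "x \<in> span B" for x
    proof -
      have "P x = x" using rep[OF that] by (simp add: P_def)
      moreover have "\<psi> 0 = 0" using \<psi>(1) by (simp add: bounded_linear.linear linear_0)
      ultimately show ?thesis by (simp add: \<eta>_def)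
    qed
    have PP: "P y = y" if "y \<in> span B" for y using rep[OF that] by (simp add: P_def)
    have "P b' = 0" by (simp add: b'_def P.diff PP[OF Pspan])
    then have \<eta>1: "\<eta> b' = 1" using \<psi>(2) False by (simp add: \<eta>_def)
    have b'B: "b' \<notin> span B" using \<eta>0[of b'] \<eta>1 by auto
    then have b'C: "b' \<notin> C" using C(2) by auto
    define \<phi>' where "\<phi>' c x = (if c = b' then \<eta> x else \<phi> c x)" for c x
    have "(\<Sum>c\<in>insert b' C. \<phi>' c x *\<^sub>R c) = x" if x: "x \<in> span (insert b B)" for x
    proof -
      obtain k where k: "x - k *\<^sub>R b \<in> span B" using x by (auto simp: span_insert)
      define y where "y = (x - k *\<^sub>R b) + k *\<^sub>R P b"
      have y: "y \<in> span B" unfolding y_def by (intro span_add k span_scale Pspan)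
      have x: "x = y + k *\<^sub>R b'" by (simp add: y_def b'_def scaleR_diff_right)
      have "(\<Sum>c\<in>insert b' C. \<phi>' c x *\<^sub>R c) = \<eta> x *\<^sub>R b' + P x"
        using C(1) b'C by (auto simp: \<phi>'_def P_def intro!: sum.cong)
      also have "P x = y" using PP[OF y] \<open>P b' = 0\<close> by (simp add: x P.add P.scaleR)
      also have "\<eta> x = k" using \<eta>0[OF y] \<eta>1 by (simp add: x \<eta>.add \<eta>.scaleR)
      finally show ?thesis using x by simp
    qed
    moreover have "insert b' C \<subseteq> span (insert b B)"
    proof -
      have "span B \<subseteq> span (insert b B)" by (intro span_mono) auto
      moreover have "b \<in> span (insert b B)" by (simp add: span_base)
      ultimately show ?thesis using C(2) Pspan[of b] by (auto simp: b'_def intro: span_diff)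
    qed
    moreover have "\<forall>c\<in>insert b' C. bounded_linear (\<phi>' c)"
    proof
      fix c assume "c \<in> insert b' C"
      then show "bounded_linear (\<phi>' c)"
        using \<eta> \<phi> by (cases "c = b'") (simp_all add: \<phi>'_def[abs_def])
    qed
    ultimately show ?thesis using C(1) by (intro exI[of _ "insert b' C"] exI[of _ \<phi>']) simp
  qed
qed

section \<open>Derivatives within a subspace\<close>

text \<open>
  Restrict \<open>f\<close> to the line through \<open>x\<close> in direction \<open>v\<close>, which stays in \<open>E\<close>; there the
  derivative is unique.
\<close>

lemma has_derivative_unique_on_subspace:
  fixes f :: "'e::real_normed_vector \<Rightarrow> 'f::real_normed_vector"
  assumes "subspace E" "x \<in> E" "v \<in> E"
    and D: "(f has_derivative D) (at x within E)" "(f has_derivative D') (at x within E)"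
  shows "D v = D' v"
proof -
  define h where "h t = x + t *\<^sub>R v" for t :: real
  have h: "(h has_derivative (\<lambda>t. t *\<^sub>R v)) (at 0)"
    unfolding h_def by (auto intro!: derivative_eq_intros)
  have "range h \<subseteq> E"
    using assms(1-3) by (auto simp: h_def intro: subspace_add subspace_scale)
  then have "(f has_derivative D) (at (h 0) within range h)" "(f has_derivative D') (at (h 0) within range h)"
    using D by (auto simp: h_def intro: has_derivative_subset)
  from this[THEN has_derivative_in_compose[OF h]]
  have "((\<lambda>t. f (h t)) has_derivative (\<lambda>t. D (t *\<^sub>R v))) (at 0)"
    "((\<lambda>t. f (h t)) has_derivative (\<lambda>t. D' (t *\<^sub>R v))) (at 0)" .
  then have "(\<lambda>t. D (t *\<^sub>R v)) = (\<lambda>t. D' (t *\<^sub>R v))" by (rule has_derivative_unique)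
  from fun_cong[OF this, of 1] show ?thesis by simp
qed

lemma at_within_openin:
  assumes "openin (top_of_set E) U" "x \<in> U"
  shows "at x within U = at x within E"
proof -
  obtain T where "open T" "U = E \<inter> T" using assms(1) by (auto simp: openin_open)
  with assms(2) show ?thesis by (intro at_within_nhd[of x T]) auto
qed

lemma has_derivative_cong_openin:
  assumes "openin (top_of_set E) U" "x \<in> U" "\<And>y. y \<in> U \<Longrightarrow> f y = g y"
    and "(f has_derivative D) (at x within E)"
  shows "(g has_derivative D) (at x within E)"
  using assms(4) has_derivative_transform[OF assms(2), of g f D] assms(3)
  unfolding at_within_openin[OF assms(1,2)] by simp

section \<open>Calculus of smooth functions\<close>

lemma Ck_on_cong:
  assumes "openin (top_of_set E) U" "\<And>x. x \<in> U \<Longrightarrow> f x = g x" "Ck_on k E U f"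
  shows "Ck_on k E U g"
proof (cases k)
  case 0
  then show ?thesis using assms continuous_on_cong[of U U f g] by simp
next
  case (Suc n)
  have "(g has_derivative D) (at x within E)"
    if "x \<in> U" "(f has_derivative D) (at x within E)" for x D
    using has_derivative_cong_openin[OF assms(1) that(1) assms(2) that(2)] .
  with Suc show ?thesis using assms(3) by (simp, blast)
qed

lemma Ck_on_subset: "Ck_on k E U f \<Longrightarrow> V \<subseteq> U \<Longrightarrow> Ck_on k E V f"
proof (induction k arbitrary: f)
  case 0 then show ?case by (auto intro: continuous_on_subset)
next
  case (Suc k) then show ?case by (simp, blast)
qed

lemma Ck_on_lower: "U \<subseteq> E \<Longrightarrow> Ck_on (Suc k) E U f \<Longrightarrow> Ck_on k E U f"
proof (induction k arbitrary: f)
  case 0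
  then obtain D where "\<forall>x\<in>U. (f has_derivative D x) (at x within E)" by auto
  then have "\<forall>x\<in>U. continuous (at x within U) f"
    using has_derivative_continuous continuous_within_subset[OF _ 0(1)] by blast
  then show ?case by (simp add: continuous_on_eq_continuous_within)
next
  case (Suc k)
  from Suc.prems(2) obtain D where D: "\<forall>x\<in>U. (f has_derivative D x) (at x within E)"
    "\<forall>v\<in>E. Ck_on (Suc k) E U (\<lambda>x. D x v)" by (subst (asm) Ck_on.simps) blast
  then have "\<forall>v\<in>E. Ck_on k E U (\<lambda>x. D x v)" using Suc by blast
  with D show ?case by auto
qed

lemma Ck_on_const: "Ck_on k E U (\<lambda>x. c)"
proof (induction k arbitrary: c)
  case (Suc k) then show ?case by (auto intro!: exI[of _ "\<lambda>x v. 0"])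
qed simp

lemma Ck_on_bounded_linear:
  assumes "bounded_linear L"
  shows "Ck_on k E U L"
proof (cases k)
  case 0 then show ?thesis using assms by (simp add: linear_continuous_on)
next
  case (Suc n)
  then show ?thesis using assms
    by (auto intro!: exI[of _ "\<lambda>x. L"] Ck_on_const bounded_linear_imp_has_derivative)
qed

lemma Ck_on_linear_image:
  assumes "bounded_linear L" "Ck_on k E U f"
  shows "Ck_on k E U (\<lambda>x. L (f x))"
  using assms(2)
proof (induction k arbitrary: f)
  case 0
  then show ?case using assms(1) by (simp add: bounded_linear.continuous_on)
next
  case (Suc k)
  then obtain D where "\<forall>x\<in>U. (f has_derivative D x) (at x within E)"
    "\<forall>v\<in>E. Ck_on k E U (\<lambda>x. D x v)" by auto
  then show ?case using Suc.IH bounded_linear.has_derivative[OF assms(1), of f]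
    by (intro Ck_on.simps(2)[THEN iffD2] exI[of _ "\<lambda>x v. L (D x v)"]) auto
qed

lemma Ck_on_add:
  assumes "Ck_on k E U f" "Ck_on k E U g"
  shows "Ck_on k E U (\<lambda>x. f x + g x)"
  using assms
proof (induction k arbitrary: f g)
  case 0 then show ?case by (auto intro: continuous_on_add)
next
  case (Suc k)
  then obtain D D' where "\<forall>x\<in>U. (f has_derivative D x) (at x within E)"
    "\<forall>v\<in>E. Ck_on k E U (\<lambda>x. D x v)" "\<forall>x\<in>U. (g has_derivative D' x) (at x within E)"
    "\<forall>v\<in>E. Ck_on k E U (\<lambda>x. D' x v)" by auto
  then show ?case using Suc.IH
    by (auto intro!: exI[of _ "\<lambda>x v. D x v + D' x v"] has_derivative_add)
qed

lemma Ck_on_sum: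
  assumes "\<And>i. i \<in> I \<Longrightarrow> Ck_on k E U (f i)"
  shows "Ck_on k E U (\<lambda>x. \<Sum>i\<in>I. f i x)"
  using assms
proof (induction I rule: infinite_finite_induct)
  case (insert i I) then show ?case by (simp add: Ck_on_add)
qed (simp_all add: Ck_on_const)

lemma Ck_on_Pair:
  assumes "Ck_on k E U f" "Ck_on k E U g"
  shows "Ck_on k E U (\<lambda>x. (f x, g x))"
  using assms
proof (induction k arbitrary: f g)
  case 0 then show ?case by (auto intro: continuous_on_Pair)
next
  case (Suc k)
  then obtain D D' where "\<forall>x\<in>U. (f has_derivative D x) (at x within E)"
    "\<forall>v\<in>E. Ck_on k E U (\<lambda>x. D x v)" "\<forall>x\<in>U. (g has_derivative D' x) (at x within E)"
    "\<forall>v\<in>E. Ck_on k E U (\<lambda>x. D' x v)" by auto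
  then show ?case using Suc.IH
    by (auto intro!: exI[of _ "\<lambda>x v. (D x v, D' x v)"] has_derivative_Pair)
qed

lemma Ck_on_scaleR:
  fixes \<phi> :: "'e::real_normed_vector \<Rightarrow> real"
  assumes "U \<subseteq> E" "Ck_on k E U \<phi>" "Ck_on k E U f"
  shows "Ck_on k E U (\<lambda>x. \<phi> x *\<^sub>R f x)"
  using assms(2,3)
proof (induction k arbitrary: \<phi> f)
  case 0 then show ?case by (auto intro: continuous_on_scaleR)
next
  case (Suc k)
  then obtain D D' where D: "\<forall>x\<in>U. (\<phi> has_derivative D x) (at x within E)"
    "\<forall>v\<in>E. Ck_on k E U (\<lambda>x. D x v)" "\<forall>x\<in>U. (f has_derivative D' x) (at x within E)"
    "\<forall>v\<in>E. Ck_on k E U (\<lambda>x. D' x v)" by auto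
  have "Ck_on k E U \<phi>" "Ck_on k E U f" using Ck_on_lower[OF assms(1)] Suc.prems by blast+
  with D show ?case using Suc.IH
    by (auto intro!: exI[of _ "\<lambda>x v. \<phi> x *\<^sub>R D' x v + D x v *\<^sub>R f x"] has_derivative_scaleR Ck_on_add)
qed

text \<open>
  The bounded projection onto \<open>span B\<close> does not change \<open>f\<close>, hence does not change the derivative.
\<close>

lemma derivative_in_model:
  fixes E :: "'e::real_normed_vector set" and f :: "'e \<Rightarrow> 'f::real_normed_vector"
  assumes "subspace E" "openin (top_of_set E) U" "x \<in> U" "v \<in> E"
    and "finite B" "\<And>y. y \<in> U \<Longrightarrow> f y \<in> span B"
    and "(f has_derivative D) (at x within E)"
  shows "D v \<in> span B"
proof -
  obtain C and \<phi> :: "'f \<Rightarrow> 'f \<Rightarrow> real" where C: "finite C" "C \<subseteq> span B"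
    and \<phi>: "\<And>c. c \<in> C \<Longrightarrow> bounded_linear (\<phi> c)"
    and rep: "\<And>x. x \<in> span B \<Longrightarrow> (\<Sum>c\<in>C. \<phi> c x *\<^sub>R c) = x"
    using finite_span_coordinates[OF assms(5)] by metis
  define P where "P x = (\<Sum>c\<in>C. \<phi> c x *\<^sub>R c)" for x
  have P: "bounded_linear P"
    unfolding P_def
    by (intro bounded_linear_sum bounded_linear_compose[OF bounded_linear_scaleR_left] \<phi>)
  have xE: "x \<in> E" using assms(2,3) openin_imp_subset by blast
  have "((\<lambda>y. P (f y)) has_derivative (\<lambda>v. P (D v))) (at x within E)"
    by (rule bounded_linear.has_derivative[OF P assms(7)])
  then have "(f has_derivative (\<lambda>v. P (D v))) (at x within E)"
    by (rule has_derivative_cong_openin[OF assms(2,3), rotated]) (simp add: P_def rep assms(6))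
  then have "D v = P (D v)"
    using has_derivative_unique_on_subspace[OF assms(1) xE assms(4,7)] by blast
  moreover have "P (D v) \<in> span B"
    unfolding P_def using C by (intro span_sum span_scale) auto
  ultimately show ?thesis by simp
qed

lemma has_derivative_compose_openin:
  assumes "openin (top_of_set E) U" "x \<in> U" "f ` U \<subseteq> V" "V \<subseteq> E'"
    and "(f has_derivative D) (at x within E)" "(g has_derivative D') (at (f x) within E')"
  shows "((\<lambda>x. g (f x)) has_derivative (\<lambda>v. D' (D v))) (at x within E)"
proof -
  have "(f has_derivative D) (at x within U)"
    using assms(5) unfolding at_within_openin[OF assms(1,2)] .
  moreover have "(g has_derivative D') (at (f x) within f ` U)"
    using assms(3,4,6) by (blast intro: has_derivative_subset)
  ultimately show ?thesis
    using has_derivative_in_compose unfolding at_within_openin[OF assms(1,2), symmetric] by blast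
qed

text \<open>
  The derivative \<open>D' (f x) (D x v)\<close> depends on \<open>x\<close> in both places, whereas the definition of
  \<open>Ck_on\<close> controls \<open>D'\<close> only at fixed vectors. Expanding \<open>D x v\<close> in bounded coordinates of
  \<open>span B\<close> writes it as a sum of products of a scalar function with \<open>\<lambda>x. D' (f x) c\<close>, to which the
  induction hypothesis applies.
\<close>

lemma Ck_on_compose:
  fixes E :: "'e::real_normed_vector set" and g :: "'f::real_normed_vector \<Rightarrow> 'g::real_normed_vector"
  assumes E: "subspace E" and U: "openin (top_of_set E) U" and B: "finite B"
    and V: "V \<subseteq> span B" and fUV: "f ` U \<subseteq> V"
  shows "Ck_on k E U f \<Longrightarrow> Ck_on k (span B) V g \<Longrightarrow> Ck_on k E U (\<lambda>x. g (f x))"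
proof (induction k arbitrary: g)
  case 0
  then show ?case using fUV by (auto intro: continuous_on_compose2)
next
  case (Suc k)
  obtain C and \<phi> :: "'f \<Rightarrow> 'f \<Rightarrow> real" where C: "finite C" "C \<subseteq> span B"
    and \<phi>: "\<And>c. c \<in> C \<Longrightarrow> bounded_linear (\<phi> c)"
    and rep: "\<And>x. x \<in> span B \<Longrightarrow> (\<Sum>c\<in>C. \<phi> c x *\<^sub>R c) = x"
    using finite_span_coordinates[OF B] by metis
  have UE: "U \<subseteq> E" using U openin_imp_subset by blast
  from Suc.prems(1) obtain D where D: "\<And>x. x \<in> U \<Longrightarrow> (f has_derivative D x) (at x within E)"
    "\<And>v. v \<in> E \<Longrightarrow> Ck_on k E U (\<lambda>x. D x v)" by auto
  from Suc.prems(2) obtain D' where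
    D': "\<And>y. y \<in> V \<Longrightarrow> (g has_derivative D' y) (at y within span B)"
      "\<And>v. v \<in> span B \<Longrightarrow> Ck_on k (span B) V (\<lambda>y. D' y v)" by auto
  have fk: "Ck_on k E U f" using Ck_on_lower[OF UE] Suc.prems(1) .
  have "((\<lambda>x. g (f x)) has_derivative (\<lambda>v. D' (f x) (D x v))) (at x within E)" if x: "x \<in> U" for x
    by (rule has_derivative_compose_openin[OF U x fUV V]) (use D' D x fUV in auto)
  moreover have "Ck_on k E U (\<lambda>x. D' (f x) (D x v))" if v: "v \<in> E" for v
  proof -
    have "Ck_on k E U (\<lambda>x. \<Sum>c\<in>C. \<phi> c (D x v) *\<^sub>R D' (f x) c)"
      by (intro Ck_on_sum Ck_on_scaleR[OF UE] Ck_on_linear_image[OF \<phi>] D(2) v Suc.IH fk D'(2))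
         (use C in auto)
    moreover have "(\<Sum>c\<in>C. \<phi> c (D x v) *\<^sub>R D' (f x) c) = D' (f x) (D x v)" if x: "x \<in> U" for x
    proof -
      have "D x v \<in> span B"
        by (rule derivative_in_model[OF E U x v B _ D(1)[OF x]]) (use fUV V in auto)
      then have "D' (f x) (D x v) = D' (f x) (\<Sum>c\<in>C. \<phi> c (D x v) *\<^sub>R c)" by (simp add: rep)
      moreover have "linear (D' (f x))"
        using D'(1)[of "f x"] fUV x by (auto dest: has_derivative_bounded_linear bounded_linear.linear)
      ultimately show ?thesis by (simp add: linear_sum linear_scale)
    qed
    ultimately show ?thesis by (rule Ck_on_cong[OF U, rotated])
  qed
  ultimately show ?case
    by (intro Ck_on.simps(2)[THEN iffD2] exI[of _ "\<lambda>x v. D' (f x) (D x v)"]) auto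
qed

text \<open>
  The local derivatives fit together because on \<open>E\<close> they are unique; outside \<open>E\<close> they are chosen
  once and for all by \<open>SOME\<close>.
\<close>

lemma Ck_on_local:
  fixes f :: "'e::real_normed_vector \<Rightarrow> 'f::real_normed_vector"
  assumes E: "subspace E" "U \<subseteq> E"
    and "\<And>x. x \<in> U \<Longrightarrow> \<exists>V. x \<in> V \<and> openin (top_of_set E) V \<and> Ck_on k E V f"
  shows "Ck_on k E U f"
  using assms(3)
proof (induction k arbitrary: f)
  case 0
  have "continuous (at x within U) f" if x: "x \<in> U" for x
  proof -
    obtain V where V: "x \<in> V" "openin (top_of_set E) V" "continuous_on V f" using 0[OF x] by auto
    then have "continuous (at x within E) f"
      using V(1) unfolding continuous_on_eq_continuous_within at_within_openin[OF V(2,1), symmetric]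
      by blast
    then show ?thesis using E(2) by (rule continuous_within_subset)
  qed
  then show ?case by (simp add: continuous_on_eq_continuous_within)
next
  case (Suc k)
  define D where "D x = (SOME D. (f has_derivative D) (at x within E))" for x
  have D: "(f has_derivative D x) (at x within E)" if "x \<in> V" "Ck_on (Suc k) E V f" for x V
  proof -
    have "\<exists>D. (f has_derivative D) (at x within E)" using that by auto
    then show ?thesis unfolding D_def by (rule someI_ex)
  qed
  have "Ck_on k E U (\<lambda>x. D x v)" if v: "v \<in> E" for v
  proof (rule Suc.IH)
    fix x assume x: "x \<in> U"
    obtain V where V: "x \<in> V" "openin (top_of_set E) V" "Ck_on (Suc k) E V f"
      using Suc.prems[OF x] by (elim exE conjE)
    then obtain D' where D': "\<forall>x\<in>V. (f has_derivative D' x) (at x within E)"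
      "\<forall>v\<in>E. Ck_on k E V (\<lambda>x. D' x v)" by auto
    have VE: "V \<subseteq> E" using V(2) openin_imp_subset by blast
    have "D' x v = D x v" if "x \<in> V" for x
      by (rule has_derivative_unique_on_subspace[OF E(1) _ v]) (use D[OF that V(3)] D' that VE in auto)
    then have "Ck_on k E V (\<lambda>x. D x v)"
      by (rule Ck_on_cong[OF V(2)]) (use D'(2) v in auto)
    with V show "\<exists>V. x \<in> V \<and> openin (top_of_set E) V \<and> Ck_on k E V (\<lambda>x. D x v)" by blast
  qed
  moreover have "(f has_derivative D x) (at x within E)" if "x \<in> U" for x
    using Suc.prems[OF that] D by (elim exE conjE)
  ultimately show ?case
    by (intro Ck_on.simps(2)[THEN iffD2] exI[of _ D]) auto
qed

lemma smooth_on_compose: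
  fixes E :: "'e::real_normed_vector set" and g :: "'f::real_normed_vector \<Rightarrow> 'g::real_normed_vector"
  assumes "subspace E" "openin (top_of_set E) U" "finite B" "V \<subseteq> span B" "f ` U \<subseteq> V"
    and "smooth_on E U f" "smooth_on (span B) V g"
  shows "smooth_on E U (\<lambda>x. g (f x))"
  unfolding smooth_on_def
proof
  fix k
  show "Ck_on k E U (\<lambda>x. g (f x))"
    using Ck_on_compose[OF assms(1-5), of k g] assms(6,7) unfolding smooth_on_def by (elim allE)
qed

lemma smooth_on_cong:
  assumes "openin (top_of_set E) U" "\<And>x. x \<in> U \<Longrightarrow> f x = g x" "smooth_on E U f"
  shows "smooth_on E U g"
  unfolding smooth_on_def
proof
  fix k show "Ck_on k E U g"
    by (rule Ck_on_cong[OF assms(1,2)]) (use assms(3) in \<open>simp_all add: smooth_on_def\<close>)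
qed

lemma smooth_on_subset: "smooth_on E U f \<Longrightarrow> V \<subseteq> U \<Longrightarrow> smooth_on E V f"
  unfolding smooth_on_def using Ck_on_subset by metis

lemma smooth_on_local:
  assumes "subspace E" "U \<subseteq> E"
    and "\<And>x. x \<in> U \<Longrightarrow> \<exists>V. x \<in> V \<and> openin (top_of_set E) V \<and> smooth_on E V f"
  shows "smooth_on E U f"
  unfolding smooth_on_def
proof
  fix k show "Ck_on k E U f"
    by (rule Ck_on_local[OF assms(1,2)]) (use assms(3) in \<open>auto simp: smooth_on_def\<close>)
qed

lemma smooth_on_Pair: "smooth_on E U f \<Longrightarrow> smooth_on E U g \<Longrightarrow> smooth_on E U (\<lambda>x. (f x, g x))"
  by (simp add: smooth_on_def Ck_on_Pair)

lemma smooth_on_bounded_linear: "bounded_linear L \<Longrightarrow> smooth_on E U L"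
  by (simp add: smooth_on_def Ck_on_bounded_linear)

lemma smooth_on_const: "smooth_on E U (\<lambda>x. c)"
  by (simp add: smooth_on_def Ck_on_const)

lemma smooth_on_imp_continuous_on: "smooth_on E U f \<Longrightarrow> continuous_on U f"
  unfolding smooth_on_def using Ck_on.simps(1) by blast

lemma smooth_on_has_derivative:
  assumes "smooth_on E U f" "x \<in> U"
  obtains D where "(f has_derivative D) (at x within E)"
proof -
  have "Ck_on (Suc 0) E U f" using assms(1) unfolding smooth_on_def by blast
  then show ?thesis using that assms(2) by auto
qed

section \<open>Charts and the manifold topology\<close>

text \<open>
  A smooth manifold without the global conditions on its topology. The calculus below uses charts
  only, and this notion is evidently stable under products.
\<close>

definition smooth_atlas :: "('a, 'e::real_normed_vector) manifold \<Rightarrow> bool" where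
  "smooth_atlas M \<longleftrightarrow>
     (\<exists>B. finite B \<and> Model M = span B) \<and> (\<forall>c\<in>Atlas M. smooth_chart M c)"

lemma smooth_manifold_imp_smooth_atlas: "smooth_manifold M \<Longrightarrow> smooth_atlas M"
  by (simp add: smooth_manifold_def smooth_atlas_def)

lemma subspace_Model: "smooth_atlas M \<Longrightarrow> subspace (Model M)"
  by (auto simp: smooth_atlas_def)

lemma charts_atI: "c \<in> Atlas M \<Longrightarrow> p \<in> fst c \<Longrightarrow> c \<in> charts_at M p"
  by (simp add: charts_at_def)

lemma charts_atD: "c \<in> charts_at M p \<Longrightarrow> c \<in> Atlas M" "c \<in> charts_at M p \<Longrightarrow> p \<in> fst c"
  by (simp_all add: charts_at_def)

lemma charts_at_points: "c \<in> charts_at M p \<Longrightarrow> p \<in> points M"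
  by (auto simp: charts_at_def points_def)

lemma ex_chart_at:
  assumes "p \<in> points M"
  obtains c where "c \<in> charts_at M p"
  using assms that by (auto simp: charts_at_def points_def)

lemma chart_inj_on: "smooth_atlas M \<Longrightarrow> c \<in> Atlas M \<Longrightarrow> inj_on (snd c) (fst c)"
  by (simp add: smooth_atlas_def smooth_chart_def)

lemma chart_inv_chart: "smooth_atlas M \<Longrightarrow> c \<in> Atlas M \<Longrightarrow> p \<in> fst c \<Longrightarrow> chart_inv c (snd c p) = p"
  by (simp add: chart_inv_def chart_inj_on)

lemma chart_inv_mem: "x \<in> snd c ` fst c \<Longrightarrow> chart_inv c x \<in> fst c"
  by (simp add: chart_inv_def inv_into_into)

lemma chart_chart_inv: "x \<in> snd c ` fst c \<Longrightarrow> snd c (chart_inv c x) = x"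
  by (simp add: chart_inv_def f_inv_into_f)

lemma openin_chart_range:
  "smooth_atlas M \<Longrightarrow> c \<in> Atlas M \<Longrightarrow> openin (top_of_set (Model M)) (snd c ` fst c)"
  by (simp add: smooth_atlas_def smooth_chart_def)

lemma chart_in_Model: "smooth_atlas M \<Longrightarrow> c \<in> Atlas M \<Longrightarrow> p \<in> fst c \<Longrightarrow> snd c p \<in> Model M"
  by (rule subsetD[OF openin_imp_subset[OF openin_chart_range]]) auto

lemma openin_chart_overlap:
  "smooth_atlas M \<Longrightarrow> c \<in> Atlas M \<Longrightarrow> d \<in> Atlas M
    \<Longrightarrow> openin (top_of_set (Model M)) (snd c ` (fst c \<inter> fst d))"
  by (simp add: smooth_atlas_def smooth_chart_def)

lemma smooth_on_transition:
  "smooth_atlas M \<Longrightarrow> c \<in> Atlas M \<Longrightarrow> d \<in> Atlas M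
    \<Longrightarrow> smooth_on (Model M) (snd c ` (fst c \<inter> fst d)) (transition c d)"
  by (simp add: smooth_atlas_def smooth_chart_def)

lemma openin_atlas_topology:
  "smooth_atlas M \<Longrightarrow> openin (manifold_topology M) S \<longleftrightarrow> S \<subseteq> points M \<and>
     (\<forall>c\<in>Atlas M. openin (top_of_set (Model M)) (snd c ` (S \<inter> fst c)))"
  by (rule openin_manifold_topology) (simp add: smooth_atlas_def)

lemma topspace_manifold_topology:
  assumes "smooth_atlas M"
  shows "topspace (manifold_topology M) = points M"
proof
  show "topspace (manifold_topology M) \<subseteq> points M"
    using openin_topspace[of "manifold_topology M"] unfolding openin_atlas_topology[OF assms]
    by (rule conjunct1)
  have "points M \<inter> fst c = fst c" if "c \<in> Atlas M" for c
    using that by (auto simp: points_def)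
  then have "openin (manifold_topology M) (points M)"
    unfolding openin_atlas_topology[OF assms] using openin_chart_range[OF assms] by auto
  then show "points M \<subseteq> topspace (manifold_topology M)" by (rule openin_subset)
qed

text \<open>
  In another chart \<open>d\<close> the image is the preimage of \<open>V\<close> under the transition from \<open>d\<close> to \<open>c\<close>, which
  is continuous.
\<close>

lemma openin_chart_inv_image:
  assumes M: "smooth_atlas M" and c: "c \<in> Atlas M"
    and V: "openin (top_of_set (Model M)) V" "V \<subseteq> snd c ` fst c"
  shows "openin (manifold_topology M) (chart_inv c ` V)"
  unfolding openin_atlas_topology[OF M]
proof (intro conjI ballI)
  have sub: "chart_inv c ` V \<subseteq> fst c"
    by (intro image_subsetI chart_inv_mem subsetD[OF V(2)])
  then show "chart_inv c ` V \<subseteq> points M" using c by (auto simp: points_def)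
  fix d assume d: "d \<in> Atlas M"
  define W where "W = snd d ` (fst c \<inter> fst d)"
  have W: "openin (top_of_set (Model M)) W" "continuous_on W (transition d c)"
    using openin_chart_overlap[OF M d c] smooth_on_imp_continuous_on[OF smooth_on_transition[OF M d c]]
    by (simp_all add: W_def Int_commute)
  have tr: "transition d c (snd d p) = snd c p" if "p \<in> fst d" for p
    using chart_inv_chart[OF M d that] by (simp add: transition_def)
  have "snd d ` (chart_inv c ` V \<inter> fst d) = W \<inter> transition d c -` V"
  proof (intro equalityI subsetI)
    fix y assume "y \<in> snd d ` (chart_inv c ` V \<inter> fst d)"
    then obtain x where x: "x \<in> V" "chart_inv c x \<in> fst d" "y = snd d (chart_inv c x)" by auto
    have "snd c (chart_inv c x) = x" by (rule chart_chart_inv[OF subsetD[OF V(2) x(1)]])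
    moreover have "chart_inv c x \<in> fst c" using sub x(1) by auto
    ultimately show "y \<in> W \<inter> transition d c -` V"
      using tr[OF x(2)] x unfolding W_def by auto
  next
    fix y assume "y \<in> W \<inter> transition d c -` V"
    then obtain p where p: "p \<in> fst c" "p \<in> fst d" "y = snd d p" "snd c p \<in> V"
      using tr by (auto simp: W_def)
    then have "p = chart_inv c (snd c p)" using chart_inv_chart[OF M c] by simp
    with p show "y \<in> snd d ` (chart_inv c ` V \<inter> fst d)" by blast
  qed
  moreover have "openin (top_of_set W) (W \<inter> transition d c -` V)"
  proof (rule continuous_openin_preimage[OF W(2) _ V(1)])
    show "transition d c \<in> W \<rightarrow> Model M"
      using tr chart_in_Model[OF M c] by (auto simp: W_def)
  qed
  ultimately show "openin (top_of_set (Model M)) (snd d ` (chart_inv c ` V \<inter> fst d))"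
    using W(1) openin_trans by metis
qed

lemma openin_chart_domain:
  assumes "smooth_atlas M" "c \<in> Atlas M"
  shows "openin (manifold_topology M) (fst c)"
proof -
  have "chart_inv c ` snd c ` fst c = fst c"
    by (simp add: image_image chart_inv_chart[OF assms])
  with openin_chart_inv_image[OF assms openin_chart_range[OF assms] order_refl]
  show ?thesis by (simp only:)
qed

lemma openin_chart_image:
  assumes "smooth_atlas M" "c \<in> Atlas M" "openin (manifold_topology M) S"
  shows "openin (top_of_set (Model M)) (snd c ` (fst c \<inter> S))"
  using assms by (simp add: openin_atlas_topology Int_commute)

section \<open>Smooth maps\<close>

lemma smooth_map_points:
  assumes "smooth_map M N f" "smooth_atlas M" "smooth_atlas N" "p \<in> points M"
  shows "f p \<in> points N"
proof -
  have "f \<in> topspace (manifold_topology M) \<rightarrow> topspace (manifold_topology N)"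
    using assms(1) by (auto simp: smooth_map_def continuous_map_def)
  then show ?thesis using assms by (auto simp: topspace_manifold_topology)
qed

lemma smooth_map_rep:
  assumes "smooth_map M N f" "smooth_atlas M" "smooth_atlas N" "c \<in> Atlas M" "d \<in> Atlas N"
  shows "openin (top_of_set (Model M)) (snd c ` (fst c \<inter> f -` fst d))"
    and "smooth_on (Model M) (snd c ` (fst c \<inter> f -` fst d)) (snd d \<circ> f \<circ> chart_inv c)"
proof -
  have "openin (manifold_topology M) {p \<in> points M. f p \<in> fst d}"
    using assms(1) openin_chart_domain[OF assms(3,5)]
    by (auto simp: smooth_map_def continuous_map_def topspace_manifold_topology[OF assms(2)])
  moreover have "fst c \<inter> {p \<in> points M. f p \<in> fst d} = fst c \<inter> f -` fst d"
    using assms(4) by (auto simp: points_def)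
  ultimately show "openin (top_of_set (Model M)) (snd c ` (fst c \<inter> f -` fst d))"
    using openin_chart_image[OF assms(2,4)] by metis
  show "smooth_on (Model M) (snd c ` (fst c \<inter> f -` fst d)) (snd d \<circ> f \<circ> chart_inv c)"
    using assms(1,4,5) by (simp add: smooth_map_def)
qed

definition smooth_rep_at :: "('a, 'e::real_normed_vector) manifold
    \<Rightarrow> ('b, 'f::real_normed_vector) manifold \<Rightarrow> ('a \<Rightarrow> 'b) \<Rightarrow> 'a
    \<Rightarrow> ('a, 'e) chart \<Rightarrow> ('b, 'f) chart \<Rightarrow> 'e set \<Rightarrow> bool" where
  "smooth_rep_at M N f p c d V \<longleftrightarrow>
     c \<in> charts_at M p \<and> d \<in> charts_at N (f p) \<and> snd c p \<in> V \<and> V \<subseteq> snd c ` fst c \<and>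
     openin (top_of_set (Model M)) V \<and> (\<forall>x\<in>V. f (chart_inv c x) \<in> fst d) \<and>
     smooth_on (Model M) V (snd d \<circ> f \<circ> chart_inv c)"

lemma smooth_rep_at_smooth_on:
  "smooth_rep_at M N f p c d V \<Longrightarrow> smooth_on (Model M) V (snd d \<circ> f \<circ> chart_inv c)"
  unfolding smooth_rep_at_def by (elim conjE)

lemma smooth_map_rep_at:
  assumes "smooth_map M N f" "smooth_atlas M" "smooth_atlas N"
    and c: "c \<in> charts_at M p" and d: "d \<in> charts_at N (f p)"
  shows "smooth_rep_at M N f p c d (snd c ` (fst c \<inter> f -` fst d))"
  unfolding smooth_rep_at_def
proof (intro conjI c d)
  note cd = charts_atD[OF c] charts_atD[OF d]
  show "snd c p \<in> snd c ` (fst c \<inter> f -` fst d)" using cd by auto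
  show "snd c ` (fst c \<inter> f -` fst d) \<subseteq> snd c ` fst c" by auto
  show "\<forall>x\<in>snd c ` (fst c \<inter> f -` fst d). f (chart_inv c x) \<in> fst d"
    using chart_inv_chart[OF assms(2) cd(1)] by auto
qed (rule smooth_map_rep[OF assms(1-3) charts_atD(1)[OF c] charts_atD(1)[OF d]])+

lemma smooth_rep_at_preimage:
  assumes r: "smooth_rep_at M N f p c d V" and S: "openin (top_of_set (Model N)) S"
    and N: "smooth_atlas N"
  shows "openin (top_of_set (Model M)) (V \<inter> (snd d \<circ> f \<circ> chart_inv c) -` S)"
proof -
  from smooth_on_imp_continuous_on[OF smooth_rep_at_smooth_on[OF r]]
  have r': "openin (top_of_set (Model M)) V" "continuous_on V (snd d \<circ> f \<circ> chart_inv c)"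
    "d \<in> Atlas N" "\<And>x. x \<in> V \<Longrightarrow> f (chart_inv c x) \<in> fst d"
    using r by (auto simp: smooth_rep_at_def charts_at_def)
  have "snd d \<circ> f \<circ> chart_inv c \<in> V \<rightarrow> Model N"
    using r'(4) chart_in_Model[OF N r'(3)] by auto
  then show ?thesis
    using continuous_openin_preimage[OF r'(2) _ S] r'(1) openin_trans by blast
qed

lemma smooth_map_continuous:
  assumes M: "smooth_atlas M" and N: "smooth_atlas N"
    and loc: "\<And>p. p \<in> points M \<Longrightarrow> \<exists>c d V. smooth_rep_at M N f p c d V"
  shows "continuous_map (manifold_topology M) (manifold_topology N) f"
  unfolding continuous_map_def topspace_manifold_topology[OF M] topspace_manifold_topology[OF N]
proof (intro conjI allI impI)
  show "f \<in> points M \<rightarrow> points N"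
  proof
    fix p assume "p \<in> points M"
    then obtain c d V where "smooth_rep_at M N f p c d V" using loc by blast
    then have "d \<in> charts_at N (f p)" by (simp add: smooth_rep_at_def)
    then show "f p \<in> points N" by (rule charts_at_points)
  qed
  fix S assume S: "openin (manifold_topology N) S"
  show "openin (manifold_topology M) {p \<in> points M. f p \<in> S}"
  proof (subst openin_subopen, intro ballI)
    fix p assume p: "p \<in> {p \<in> points M. f p \<in> S}"
    then obtain c d V where r: "smooth_rep_at M N f p c d V" using loc by blast
    then have c: "c \<in> Atlas M" "p \<in> fst c" and d: "d \<in> Atlas N" "f p \<in> fst d"
      and V: "snd c p \<in> V" "V \<subseteq> snd c ` fst c" "\<forall>x\<in>V. f (chart_inv c x) \<in> fst d"
      by (auto simp: smooth_rep_at_def charts_at_def)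
    define W where "W = V \<inter> (snd d \<circ> f \<circ> chart_inv c) -` (snd d ` (fst d \<inter> S))"
    have "openin (top_of_set (Model M)) W"
      unfolding W_def by (rule smooth_rep_at_preimage[OF r openin_chart_image[OF N d(1) S] N])
    then have "openin (manifold_topology M) (chart_inv c ` W)"
      by (rule openin_chart_inv_image[OF M c(1)]) (use V in \<open>auto simp: W_def\<close>)
    moreover have "snd c p \<in> W" "chart_inv c (snd c p) = p"
      using p c d V chart_inv_chart[OF M c] by (auto simp: W_def)
    then have "p \<in> chart_inv c ` W" by (metis image_eqI)
    moreover have "chart_inv c ` W \<subseteq> {p \<in> points M. f p \<in> S}"
    proof clarsimp
      fix x assume x: "x \<in> W"
      then have "x \<in> V" by (simp add: W_def)
      then have "chart_inv c x \<in> fst c" by (rule chart_inv_mem[OF subsetD[OF V(2)]])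
      moreover have "f (chart_inv c x) \<in> S"
      proof -
        obtain q where q: "q \<in> fst d" "q \<in> S" "snd d (f (chart_inv c x)) = snd d q"
          using x by (auto simp: W_def)
        moreover have "f (chart_inv c x) \<in> fst d" using x V(3) by (auto simp: W_def)
        ultimately show ?thesis using chart_inj_on[OF N d(1)] by (metis inj_onD)
      qed
      ultimately show "chart_inv c x \<in> points M \<and> f (chart_inv c x) \<in> S"
        using c by (auto simp: points_def)
    qed
    ultimately show "\<exists>T. openin (manifold_topology M) T \<and> p \<in> T \<and> T \<subseteq> {p \<in> points M. f p \<in> S}"
      by blast
  qed
qed

lemma Model_span:
  assumes "smooth_atlas M"
  obtains B where "finite B" "Model M = span B"
  using assms by (auto simp: smooth_atlas_def)

lemma smooth_on_compose_Model:
  assumes "smooth_atlas M" "smooth_atlas N" "openin (top_of_set (Model M)) U"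
    and "V \<subseteq> Model N" "\<And>x. x \<in> U \<Longrightarrow> f x \<in> V"
    and "smooth_on (Model M) U f" "smooth_on (Model N) V g"
  shows "smooth_on (Model M) U (\<lambda>x. g (f x))"
proof -
  obtain B where B: "finite B" "Model N = span B" by (rule Model_span[OF assms(2)])
  show ?thesis
    by (rule smooth_on_compose[OF subspace_Model[OF assms(1)] assms(3) B(1), of V])
       (use assms B in auto)
qed

text \<open>
  Smoothness in one pair of charts around each point is enough: every other representation arises
  from it by composing with two transitions, and both continuity and smoothness are local.
\<close>

lemma smooth_mapI:
  assumes M: "smooth_atlas M" and N: "smooth_atlas N"
    and loc: "\<And>p. p \<in> points M \<Longrightarrow> \<exists>c d V. smooth_rep_at M N f p c d V"
  shows "smooth_map M N f"
  unfolding smooth_map_def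
proof (intro conjI ballI)
  show cont: "continuous_map (manifold_topology M) (manifold_topology N) f"
    by (rule smooth_map_continuous[OF assms])
  fix c' d' assume c': "c' \<in> Atlas M" and d': "d' \<in> Atlas N"
  define U where "U = snd c' ` (fst c' \<inter> f -` fst d')"
  show "smooth_on (Model M) (snd c' ` (fst c' \<inter> f -` fst d')) (snd d' \<circ> f \<circ> chart_inv c')"
    unfolding U_def[symmetric]
  proof (rule smooth_on_local[OF subspace_Model[OF M]])
    show "U \<subseteq> Model M" using chart_in_Model[OF M c'] by (auto simp: U_def)
    fix x assume "x \<in> U"
    then obtain p where p: "p \<in> fst c'" "f p \<in> fst d'" "x = snd c' p" by (auto simp: U_def)
    then have "p \<in> points M" using c' by (auto simp: points_def)
    then obtain c d V where r: "smooth_rep_at M N f p c d V" using loc by blast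
    then have c: "c \<in> Atlas M" "p \<in> fst c" and d: "d \<in> Atlas N" "f p \<in> fst d"
      and V: "snd c p \<in> V" "V \<subseteq> snd c ` fst c" "\<forall>x\<in>V. f (chart_inv c x) \<in> fst d"
        "openin (top_of_set (Model M)) V" "smooth_on (Model M) V (snd d \<circ> f \<circ> chart_inv c)"
      unfolding smooth_rep_at_def charts_at_def by simp_all
    define O' where "O' = chart_inv c ` V \<inter> {q \<in> points M. f q \<in> fst d'}"
    have "openin (manifold_topology M) {q \<in> points M. f q \<in> fst d'}"
      using cont openin_chart_domain[OF N d'] 
      by (auto simp: continuous_map_def topspace_manifold_topology[OF M])
    then have O': "openin (manifold_topology M) O'"
      unfolding O'_def using openin_chart_inv_image[OF M c(1) V(4,2)] by blast
    define W where "W = snd c' ` (fst c' \<inter> O')"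
    have W: "openin (top_of_set (Model M)) W"
      unfolding W_def by (rule openin_chart_image[OF M c' O'])
    have "p \<in> O'"
      using V(1) chart_inv_chart[OF M c] p \<open>p \<in> points M\<close> unfolding O'_def by force
    then have "x \<in> W" using p by (auto simp: W_def)
    have Wq: "\<exists>q. q \<in> fst c' \<and> q \<in> fst c \<and> f q \<in> fst d \<and> f q \<in> fst d' \<and> y = snd c' q \<and> snd c q \<in> V"
      if y: "y \<in> W" for y
    proof -
      obtain z where z: "z \<in> V" "chart_inv c z \<in> fst c'" "f (chart_inv c z) \<in> fst d'"
        "y = snd c' (chart_inv c z)" using y by (auto simp: W_def O'_def)
      moreover have "chart_inv c z \<in> fst c" "snd c (chart_inv c z) = z"
        using chart_inv_mem[OF subsetD[OF V(2) z(1)]] chart_chart_inv[OF subsetD[OF V(2) z(1)]] .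
      ultimately show ?thesis using V(3) by metis
    qed
    have 1: "smooth_on (Model M) W (transition c' c)"
      by (rule smooth_on_subset[OF smooth_on_transition[OF M c' c(1)]]) (use Wq in blast)
    have 2: "transition c' c y \<in> V" if "y \<in> W" for y
      using Wq[OF that] chart_inv_chart[OF M c'] by (auto simp: transition_def)
    have VM: "V \<subseteq> Model M" using V(4) openin_imp_subset by blast
    have 3: "smooth_on (Model M) W (\<lambda>y. (snd d \<circ> f \<circ> chart_inv c) (transition c' c y))"
      by (rule smooth_on_compose_Model[OF M M W VM 2 1 V(5)])
    have 4: "(snd d \<circ> f \<circ> chart_inv c) (transition c' c y) \<in> snd d ` (fst d \<inter> fst d')" if "y \<in> W" for y
      using Wq[OF that] chart_inv_chart[OF M c'] chart_inv_chart[OF M c(1)]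
      by (auto simp: transition_def)
    have 5: "smooth_on (Model M) W (\<lambda>y. transition d d' ((snd d \<circ> f \<circ> chart_inv c) (transition c' c y)))"
      by (rule smooth_on_compose_Model[OF M N W _ 4 3 smooth_on_transition[OF N d(1) d']])
         (use chart_in_Model[OF N d(1)] in auto)
    have "smooth_on (Model M) W (snd d' \<circ> f \<circ> chart_inv c')"
    proof (rule smooth_on_cong[OF W _ 5])
      fix y assume "y \<in> W"
      from Wq[OF this] obtain q where "q \<in> fst c'" "q \<in> fst c" "f q \<in> fst d" "y = snd c' q" by blast
      then show "transition d d' ((snd d \<circ> f \<circ> chart_inv c) (transition c' c y))
        = (snd d' \<circ> f \<circ> chart_inv c') y"
        using chart_inv_chart[OF M c'] chart_inv_chart[OF M c(1)] chart_inv_chart[OF N d(1)]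
        by (simp add: transition_def)
    qed
    with W \<open>x \<in> W\<close> show "\<exists>V. x \<in> V \<and> openin (top_of_set (Model M)) V \<and>
        smooth_on (Model M) V (snd d' \<circ> f \<circ> chart_inv c')" by blast
  qed
qed

text \<open>
  The domain of the composite representation is cut down to the points that \<open>f\<close> sends into the
  chart \<open>d\<close> and \<open>g\<close> on into the chart \<open>e\<close>, where it is the composite of two smooth functions.
\<close>

lemma smooth_map_compose:
  assumes M: "smooth_atlas M" and N: "smooth_atlas N" and P: "smooth_atlas P"
    and f: "smooth_map M N f" and g: "smooth_map N P g"
  shows "smooth_map M P (\<lambda>p. g (f p))"
proof (rule smooth_mapI[OF M P])
  fix p assume p: "p \<in> points M"
  obtain c where c: "c \<in> charts_at M p" using ex_chart_at[OF p] .
  have fp: "f p \<in> points N" using smooth_map_points[OF f M N p] .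
  obtain d where d: "d \<in> charts_at N (f p)" using ex_chart_at[OF fp] .
  obtain e where e: "e \<in> charts_at P (g (f p))" using ex_chart_at[OF smooth_map_points[OF g N P fp]] .
  note cD = charts_atD[OF c] and dD = charts_atD[OF d]
  define V where "V = snd c ` (fst c \<inter> f -` fst d)"
  define W where "W = snd d ` (fst d \<inter> g -` fst e)"
  have rf: "smooth_rep_at M N f p c d V" unfolding V_def by (rule smooth_map_rep_at[OF f M N c d])
  have rg: "smooth_rep_at N P g (f p) d e W" unfolding W_def by (rule smooth_map_rep_at[OF g N P d e])
  define U where "U = V \<inter> (snd d \<circ> f \<circ> chart_inv c) -` W"
  have U: "openin (top_of_set (Model M)) U"
    unfolding U_def by (rule smooth_rep_at_preimage[OF rf _ N]) (use rg in \<open>simp add: smooth_rep_at_def\<close>)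
  have WN: "W \<subseteq> Model N" using chart_in_Model[OF N dD(1)] by (auto simp: W_def)
  have gfU: "smooth_on (Model M) U (\<lambda>x. (snd e \<circ> g \<circ> chart_inv d) ((snd d \<circ> f \<circ> chart_inv c) x))"
  proof (rule smooth_on_compose_Model[OF M N U WN _ _ smooth_rep_at_smooth_on[OF rg]])
    show "smooth_on (Model M) U (snd d \<circ> f \<circ> chart_inv c)"
      by (rule smooth_on_subset[OF smooth_rep_at_smooth_on[OF rf]]) (simp add: U_def)
  qed (simp add: U_def)
  have smooth: "smooth_on (Model M) U (snd e \<circ> (\<lambda>p. g (f p)) \<circ> chart_inv c)"
  proof (rule smooth_on_cong[OF U _ gfU])
    fix x assume "x \<in> U"
    then have "f (chart_inv c x) \<in> fst d" using rf by (simp add: smooth_rep_at_def U_def)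
    then show "(snd e \<circ> g \<circ> chart_inv d) ((snd d \<circ> f \<circ> chart_inv c) x)
      = (snd e \<circ> (\<lambda>p. g (f p)) \<circ> chart_inv c) x"
      by (simp add: chart_inv_chart[OF N dD(1)])
  qed
  have gf: "g (f (chart_inv c x)) \<in> fst e" if x: "x \<in> U" for x
  proof -
    have "f (chart_inv c x) \<in> fst d" using x rf by (auto simp: smooth_rep_at_def U_def)
    moreover from x obtain q where "q \<in> fst d" "g q \<in> fst e" "snd d (f (chart_inv c x)) = snd d q"
      by (auto simp: U_def W_def)
    ultimately show ?thesis using inj_onD[OF chart_inj_on[OF N dD(1)]] by metis
  qed
  have "snd c p \<in> U"
    using rf rg chart_inv_chart[OF M cD] by (auto simp: U_def smooth_rep_at_def)
  then have "smooth_rep_at M P (\<lambda>p. g (f p)) p c e U"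
    using c e U smooth gf rf by (auto simp: smooth_rep_at_def U_def)
  then show "\<exists>c d V. smooth_rep_at M P (\<lambda>p. g (f p)) p c d V" by blast
qed

section \<open>Tangent vectors and tangent maps\<close>

lemma frechet_derivative_eq_on_subspace:
  assumes "subspace E" "x \<in> E" "v \<in> E" "(f has_derivative D) (at x within E)"
  shows "frechet_derivative f (at x within E) v = D v"
proof -
  have "f differentiable (at x within E)" using assms(4) by (rule differentiableI)
  then have "(f has_derivative frechet_derivative f (at x within E)) (at x within E)"
    by (simp add: frechet_derivative_works)
  from has_derivative_unique_on_subspace[OF assms(1-3) this assms(4)] show ?thesis .
qed

lemma smooth_rep_at_has_derivative:
  assumes "smooth_rep_at M N f p c d V"
  obtains D where "(snd d \<circ> f \<circ> chart_inv c has_derivative D) (at (snd c p) within Model M)"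
proof -
  have "snd c p \<in> V" using assms by (simp add: smooth_rep_at_def)
  from smooth_on_has_derivative[OF smooth_rep_at_smooth_on[OF assms] this] that show ?thesis .
qed

lemma rep_derivative_in_Model:
  assumes r: "smooth_rep_at M N f p c d V" and M: "smooth_atlas M" and N: "smooth_atlas N"
    and D: "(snd d \<circ> f \<circ> chart_inv c has_derivative D) (at (snd c p) within Model M)"
    and v: "v \<in> Model M"
  shows "D v \<in> Model N"
proof -
  obtain B where B: "finite B" "Model N = span B" by (rule Model_span[OF N])
  have r': "snd c p \<in> V" "openin (top_of_set (Model M)) V" "d \<in> Atlas N"
    "\<And>x. x \<in> V \<Longrightarrow> f (chart_inv c x) \<in> fst d"
    using r by (simp_all add: smooth_rep_at_def charts_at_def)
  have "(snd d \<circ> f \<circ> chart_inv c) x \<in> span B" if "x \<in> V" for x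
    using chart_in_Model[OF N r'(3) r'(4)[OF that]] B by simp
  from derivative_in_model[OF subspace_Model[OF M] r'(2,1) v B(1) this D] B show ?thesis by simp
qed

text \<open>
  The chain rule for local representations. The outer function \<open>h\<close> is arbitrary, so that the rule
  covers transitions as well as maps between manifolds.
\<close>

lemma rep_has_derivative_compose:
  assumes N: "smooth_atlas N" and M: "smooth_atlas M"
    and rf: "smooth_rep_at M N f p c d V"
    and f: "(snd d \<circ> f \<circ> chart_inv c has_derivative D) (at (snd c p) within Model M)"
    and g: "(h \<circ> g \<circ> chart_inv d has_derivative D') (at (snd d (f p)) within Model N)"
  shows "(h \<circ> (\<lambda>p. g (f p)) \<circ> chart_inv c has_derivative (\<lambda>v. D' (D v))) (at (snd c p) within Model M)"
proof -
  have r: "snd c p \<in> V" "openin (top_of_set (Model M)) V" "c \<in> Atlas M" "p \<in> fst c" "d \<in> Atlas N"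
    "\<And>x. x \<in> V \<Longrightarrow> f (chart_inv c x) \<in> fst d"
    using rf by (simp_all add: smooth_rep_at_def charts_at_def)
  have g': "(h \<circ> g \<circ> chart_inv d has_derivative D')
      (at ((snd d \<circ> f \<circ> chart_inv c) (snd c p)) within Model N)"
    using g by (simp add: chart_inv_chart[OF M r(3,4)])
  have "(snd d \<circ> f \<circ> chart_inv c) ` V \<subseteq> Model N"
    using chart_in_Model[OF N r(5) r(6)] by auto
  from has_derivative_compose_openin[OF r(2,1) order_refl this f g']
  show ?thesis
    by (rule has_derivative_cong_openin[OF r(2,1), rotated])
       (simp add: chart_inv_chart[OF N r(5) r(6)])
qed

abbreviation dtrans :: "('a, 'e::real_normed_vector) manifold \<Rightarrow> 'a \<Rightarrow> ('a, 'e) chart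
    \<Rightarrow> ('a, 'e) chart \<Rightarrow> 'e \<Rightarrow> 'e" where
  "dtrans M p c d \<equiv> frechet_derivative (transition c d) (at (snd c p) within Model M)"

lemma smooth_rep_at_id:
  assumes M: "smooth_atlas M" and c: "c \<in> charts_at M p" and d: "d \<in> charts_at M p"
  shows "smooth_rep_at M M (\<lambda>p. p) p c d (snd c ` (fst c \<inter> fst d))"
proof -
  have "snd d \<circ> (\<lambda>p. p) \<circ> chart_inv c = transition c d" by (auto simp: transition_def)
  then show ?thesis
    using c d openin_chart_overlap[OF M charts_atD(1)[OF c] charts_atD(1)[OF d]]
      smooth_on_transition[OF M charts_atD(1)[OF c] charts_atD(1)[OF d]]
      chart_inv_chart[OF M charts_atD(1)[OF c]]
    unfolding smooth_rep_at_def by (auto simp: charts_at_def)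
qed

lemma smooth_map_id: "smooth_atlas M \<Longrightarrow> smooth_map M M (\<lambda>p. p)"
  by (rule smooth_mapI) (use ex_chart_at smooth_rep_at_id in metis)+

lemma dtrans_has_derivative:
  assumes "smooth_atlas M" "c \<in> charts_at M p" "d \<in> charts_at M p"
  shows "(snd d \<circ> (\<lambda>p. p) \<circ> chart_inv c has_derivative dtrans M p c d) (at (snd c p) within Model M)"
proof -
  have "snd d \<circ> (\<lambda>p. p) \<circ> chart_inv c = transition c d" by (auto simp: transition_def)
  moreover obtain D where
    "(snd d \<circ> (\<lambda>p. p) \<circ> chart_inv c has_derivative D) (at (snd c p) within Model M)"
    by (rule smooth_rep_at_has_derivative[OF smooth_rep_at_id[OF assms]])
  ultimately show ?thesis
    using differentiableI[of "transition c d"] by (simp add: frechet_derivative_works)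
qed

lemma snd_in_Model: "smooth_atlas M \<Longrightarrow> c \<in> charts_at M p \<Longrightarrow> snd c p \<in> Model M"
  using chart_in_Model charts_atD by metis

lemma dtrans_in_Model:
  assumes "smooth_atlas M" "c \<in> charts_at M p" "d \<in> charts_at M p" "v \<in> Model M"
  shows "dtrans M p c d v \<in> Model M"
  by (rule rep_derivative_in_Model[OF smooth_rep_at_id[OF assms(1-3)] assms(1,1)
        dtrans_has_derivative[OF assms(1-3)] assms(4)])

text \<open>
  The chain rule for composed transitions, in the form that makes \<open>coord_vec\<close> satisfy the
  transformation law of tangent vectors.
\<close>

lemma dtrans_dtrans:
  assumes M: "smooth_atlas M" and c: "c \<in> charts_at M p" and d: "d \<in> charts_at M p"
    and e: "e \<in> charts_at M p" and v: "v \<in> Model M"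
  shows "dtrans M p d e (dtrans M p c d v) = dtrans M p c e v"
  by (rule has_derivative_unique_on_subspace[OF subspace_Model[OF M] snd_in_Model[OF M c] v
        rep_has_derivative_compose[OF M M smooth_rep_at_id[OF M c d] dtrans_has_derivative[OF M c d]
          dtrans_has_derivative[OF M d e]] dtrans_has_derivative[OF M c e]])

lemma dtrans_self:
  assumes M: "smooth_atlas M" and c: "c \<in> charts_at M p" and v: "v \<in> Model M"
  shows "dtrans M p c c v = v"
proof -
  have "((\<lambda>x. x) has_derivative (\<lambda>v. v)) (at (snd c p) within Model M)" by (rule has_derivative_ident)
  then have "(snd c \<circ> (\<lambda>p. p) \<circ> chart_inv c has_derivative (\<lambda>v. v)) (at (snd c p) within Model M)"
    by (rule has_derivative_cong_openin[OF openin_chart_range[OF M charts_atD(1)[OF c]], rotated 2])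
       (use charts_atD(2)[OF c] in \<open>simp_all add: chart_chart_inv\<close>)
  from has_derivative_unique_on_subspace[OF subspace_Model[OF M] snd_in_Model[OF M c] v
      dtrans_has_derivative[OF M c c] this]
  show ?thesis .
qed

lemma linear_dtrans:
  assumes "smooth_atlas M" "c \<in> charts_at M p" "d \<in> charts_at M p"
  shows "bounded_linear (dtrans M p c d)"
  using dtrans_has_derivative[OF assms] by (rule has_derivative_bounded_linear)

lemma coord_vec_tangent:
  assumes M: "smooth_atlas M" and c: "c \<in> charts_at M p" and e: "e \<in> Model M"
  shows "coord_vec M p c e \<in> tangent_space M p"
  unfolding tangent_space_def coord_vec_def
  by (simp add: dtrans_in_Model[OF M c _ e] dtrans_dtrans[OF M c _ _ e])

lemma coord_vec_chart:
  assumes M: "smooth_atlas M" and c: "c \<in> charts_at M p" and e: "e \<in> Model M"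
  shows "coord_vec M p c e c = e"
  using c dtrans_self[OF assms] by (simp add: coord_vec_def)

lemma tangent_in_Model: "v \<in> tangent_space M p \<Longrightarrow> c \<in> charts_at M p \<Longrightarrow> v c \<in> Model M"
  unfolding tangent_space_def by blast

lemma tangent_dtrans:
  "v \<in> tangent_space M p \<Longrightarrow> c \<in> charts_at M p \<Longrightarrow> d \<in> charts_at M p \<Longrightarrow> v d = dtrans M p c d (v c)"
  unfolding tangent_space_def by blast

lemma tangent_outside: "v \<in> tangent_space M p \<Longrightarrow> c \<notin> charts_at M p \<Longrightarrow> v c = 0"
  unfolding tangent_space_def by blast

lemma tangent_eqI:
  assumes "v \<in> tangent_space M p" "w \<in> tangent_space M p" "c \<in> charts_at M p" "v c = w c"
  shows "v = w"
proof
  fix d show "v d = w d"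
    using tangent_dtrans[OF assms(1,3), of d] tangent_dtrans[OF assms(2,3), of d]
      tangent_outside[OF assms(1), of d] tangent_outside[OF assms(2), of d] assms(4)
    by (cases "d \<in> charts_at M p") simp_all
qed

lemma tangent_add:
  assumes M: "smooth_atlas M" and v: "v \<in> tangent_space M p" and w: "w \<in> tangent_space M p"
  shows "(\<lambda>c. v c + w c) \<in> tangent_space M p"
  unfolding tangent_space_def
proof (intro CollectI conjI ballI allI impI)
  fix c assume c: "c \<in> charts_at M p"
  show "v c + w c \<in> Model M"
    by (intro subspace_add subspace_Model M tangent_in_Model[OF _ c] v w)
  fix d assume d: "d \<in> charts_at M p"
  interpret bounded_linear "dtrans M p c d" by (rule linear_dtrans[OF M c d])
  show "v d + w d = dtrans M p c d (v c + w c)"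
    by (simp add: add tangent_dtrans[OF v c d] tangent_dtrans[OF w c d])
qed (simp add: tangent_outside[OF v] tangent_outside[OF w])

lemma tangent_scale:
  assumes M: "smooth_atlas M" and v: "v \<in> tangent_space M p"
  shows "(\<lambda>c. r *\<^sub>R v c) \<in> tangent_space M p"
  unfolding tangent_space_def
proof (intro CollectI conjI ballI allI impI)
  fix c assume c: "c \<in> charts_at M p"
  show "r *\<^sub>R v c \<in> Model M"
    by (intro subspace_scale subspace_Model M tangent_in_Model[OF _ c] v)
  fix d assume d: "d \<in> charts_at M p"
  interpret bounded_linear "dtrans M p c d" by (rule linear_dtrans[OF M c d])
  show "r *\<^sub>R v d = dtrans M p c d (r *\<^sub>R v c)"
    by (simp add: scaleR tangent_dtrans[OF v c d])
qed (simp add: tangent_outside[OF v])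

lemma tangent_zero: "smooth_atlas M \<Longrightarrow> (\<lambda>_. 0) \<in> tangent_space M p"
  using subspace_0[OF subspace_Model] linear_0[OF bounded_linear.linear[OF linear_dtrans]]
  by (auto simp: tangent_space_def)

text \<open>
  \<open>tangent_map\<close> is defined by way of a chart that \<open>SOME\<close> selects. By the chain rule and the
  transformation law of tangent vectors any other chart gives the same value.
\<close>

lemma tangent_map_rep:
  assumes f: "smooth_map M N f" and M: "smooth_atlas M" and N: "smooth_atlas N"
    and c: "c \<in> charts_at M p" and d: "d \<in> charts_at N (f p)" and v: "v \<in> tangent_space M p"
    and D: "(snd d \<circ> f \<circ> chart_inv c has_derivative D) (at (snd c p) within Model M)"
  shows "tangent_map M N f p v d = D (v c)"
proof -
  define c0 where "c0 = (SOME c. c \<in> charts_at M p)"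
  have c0: "c0 \<in> charts_at M p" unfolding c0_def by (rule someI[of _ c]) (rule c)
  have "(snd d \<circ> (\<lambda>p. f p) \<circ> chart_inv c0 has_derivative (\<lambda>v. D (dtrans M p c0 c v)))
      (at (snd c0 p) within Model M)"
    by (rule rep_has_derivative_compose[OF M M smooth_rep_at_id[OF M c0 c]
          dtrans_has_derivative[OF M c0 c] D])
  from frechet_derivative_eq_on_subspace[OF subspace_Model[OF M] snd_in_Model[OF M c0]
      tangent_in_Model[OF v c0] this]
  show ?thesis
    using d tangent_dtrans[OF v c0 c]
    by (simp add: tangent_map_def tderiv_def Let_def c0_def[symmetric])
qed

lemma ex_rep_derivative:
  assumes "smooth_map M N f" "smooth_atlas M" "smooth_atlas N"
    and "c \<in> charts_at M p" "d \<in> charts_at N (f p)"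
  obtains D where "(snd d \<circ> f \<circ> chart_inv c has_derivative D) (at (snd c p) within Model M)"
  using smooth_rep_at_has_derivative[OF smooth_map_rep_at[OF assms]] .

lemma tangent_map_tangent:
  assumes f: "smooth_map M N f" and M: "smooth_atlas M" and N: "smooth_atlas N"
    and p: "p \<in> points M" and v: "v \<in> tangent_space M p"
  shows "tangent_map M N f p v \<in> tangent_space N (f p)"
  unfolding tangent_space_def
proof (intro CollectI conjI ballI allI impI)
  obtain c where c: "c \<in> charts_at M p" using ex_chart_at[OF p] .
  fix d assume d: "d \<in> charts_at N (f p)"
  obtain D where D: "(snd d \<circ> f \<circ> chart_inv c has_derivative D) (at (snd c p) within Model M)"
    by (rule ex_rep_derivative[OF f M N c d])
  note r = smooth_map_rep_at[OF f M N c d]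
  have eq: "tangent_map M N f p v d = D (v c)" by (rule tangent_map_rep[OF f M N c d v D])
  show "tangent_map M N f p v d \<in> Model N"
    unfolding eq by (rule rep_derivative_in_Model[OF r M N D tangent_in_Model[OF v c]])
  fix e assume e: "e \<in> charts_at N (f p)"
  have "(snd e \<circ> (\<lambda>p. f p) \<circ> chart_inv c has_derivative (\<lambda>v. dtrans N (f p) d e (D v)))
      (at (snd c p) within Model M)"
    by (rule rep_has_derivative_compose[OF N M r D dtrans_has_derivative[OF N d e]])
  from tangent_map_rep[OF f M N c e v this]
  show "tangent_map M N f p v e = dtrans N (f p) d e (tangent_map M N f p v d)"
    by (simp add: eq)
qed (simp add: tangent_map_def)

lemma tangent_map_compose:
  assumes M: "smooth_atlas M" and N: "smooth_atlas N" and P: "smooth_atlas P"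
    and f: "smooth_map M N f" and g: "smooth_map N P g"
    and p: "p \<in> points M" and v: "v \<in> tangent_space M p"
  shows "tangent_map M P (\<lambda>p. g (f p)) p v = tangent_map N P g (f p) (tangent_map M N f p v)"
proof (rule tangent_eqI)
  have fp: "f p \<in> points N" by (rule smooth_map_points[OF f M N p])
  have gf: "smooth_map M P (\<lambda>p. g (f p))" by (rule smooth_map_compose[OF M N P f g])
  have fv: "tangent_map M N f p v \<in> tangent_space N (f p)" by (rule tangent_map_tangent[OF f M N p v])
  show "tangent_map M P (\<lambda>p. g (f p)) p v \<in> tangent_space P (g (f p))"
    by (rule tangent_map_tangent[OF gf M P p v])
  show "tangent_map N P g (f p) (tangent_map M N f p v) \<in> tangent_space P (g (f p))"
    by (rule tangent_map_tangent[OF g N P fp fv])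
  obtain c where c: "c \<in> charts_at M p" using ex_chart_at[OF p] .
  obtain d where d: "d \<in> charts_at N (f p)" using ex_chart_at[OF fp] .
  define e where "e = (SOME e. e \<in> charts_at P (g (f p)))"
  show e: "e \<in> charts_at P (g (f p))"
    unfolding e_def by (rule someI_ex) (use ex_chart_at[OF smooth_map_points[OF g N P fp]] in blast)
  obtain D where D: "(snd d \<circ> f \<circ> chart_inv c has_derivative D) (at (snd c p) within Model M)"
    by (rule ex_rep_derivative[OF f M N c d])
  obtain D' where D': "(snd e \<circ> g \<circ> chart_inv d has_derivative D') (at (snd d (f p)) within Model N)"
    by (rule ex_rep_derivative[OF g N P d e])
  have "(snd e \<circ> (\<lambda>p. g (f p)) \<circ> chart_inv c has_derivative (\<lambda>v. D' (D v))) (at (snd c p) within Model M)"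
    by (rule rep_has_derivative_compose[OF N M smooth_map_rep_at[OF f M N c d] D D'])
  from tangent_map_rep[OF gf M P c e v this] tangent_map_rep[OF f M N c d v D]
    tangent_map_rep[OF g N P d e fv D']
  show "tangent_map M P (\<lambda>p. g (f p)) p v e = tangent_map N P g (f p) (tangent_map M N f p v) e"
    by simp
qed

lemma tangent_map_add:
  assumes f: "smooth_map M N f" and M: "smooth_atlas M" and N: "smooth_atlas N"
    and p: "p \<in> points M" and v: "v \<in> tangent_space M p" and w: "w \<in> tangent_space M p"
  shows "tangent_map M N f p (\<lambda>c. v c + w c) = (\<lambda>c. tangent_map M N f p v c + tangent_map M N f p w c)"
proof
  obtain c where c: "c \<in> charts_at M p" using ex_chart_at[OF p] .
  fix d
  show "tangent_map M N f p (\<lambda>c. v c + w c) d = tangent_map M N f p v d + tangent_map M N f p w d"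
  proof (cases "d \<in> charts_at N (f p)")
    case True
    obtain D where D: "(snd d \<circ> f \<circ> chart_inv c has_derivative D) (at (snd c p) within Model M)"
      by (rule ex_rep_derivative[OF f M N c True])
    interpret D: bounded_linear D by (rule has_derivative_bounded_linear[OF D])
    show ?thesis
      using tangent_map_rep[OF f M N c True _ D] v w tangent_add[OF M v w] by (simp add: D.add)
  qed (simp add: tangent_map_def)
qed

lemma tangent_map_scale:
  assumes f: "smooth_map M N f" and M: "smooth_atlas M" and N: "smooth_atlas N"
    and p: "p \<in> points M" and v: "v \<in> tangent_space M p"
  shows "tangent_map M N f p (\<lambda>c. r *\<^sub>R v c) = (\<lambda>c. r *\<^sub>R tangent_map M N f p v c)"
proof
  obtain c where c: "c \<in> charts_at M p" using ex_chart_at[OF p] .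
  fix d
  show "tangent_map M N f p (\<lambda>c. r *\<^sub>R v c) d = r *\<^sub>R tangent_map M N f p v d"
  proof (cases "d \<in> charts_at N (f p)")
    case True
    obtain D where D: "(snd d \<circ> f \<circ> chart_inv c has_derivative D) (at (snd c p) within Model M)"
      by (rule ex_rep_derivative[OF f M N c True])
    interpret D: bounded_linear D by (rule has_derivative_bounded_linear[OF D])
    show ?thesis
      using tangent_map_rep[OF f M N c True _ D] v tangent_scale[OF M v, of r] by (simp add: D.scaleR)
  qed (simp add: tangent_map_def)
qed

lemma tangent_map_cong:
  assumes f: "smooth_map M N f" and g: "smooth_map M N g"
    and M: "smooth_atlas M" and N: "smooth_atlas N"
    and eq: "\<And>p. p \<in> points M \<Longrightarrow> f p = g p"
    and p: "p \<in> points M" and v: "v \<in> tangent_space M p"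
  shows "tangent_map M N f p v = tangent_map M N g p v"
proof
  obtain c where c: "c \<in> charts_at M p" using ex_chart_at[OF p] .
  note cD = charts_atD[OF c]
  fix d
  show "tangent_map M N f p v d = tangent_map M N g p v d"
  proof (cases "d \<in> charts_at N (f p)")
    case True
    obtain D where D: "(snd d \<circ> f \<circ> chart_inv c has_derivative D) (at (snd c p) within Model M)"
      by (rule ex_rep_derivative[OF f M N c True])
    have eq': "f (chart_inv c x) = g (chart_inv c x)" if "x \<in> snd c ` fst c" for x
      using chart_inv_mem[OF that] cD(1) by (intro eq) (auto simp: points_def)
    from D have D': "(snd d \<circ> g \<circ> chart_inv c has_derivative D) (at (snd c p) within Model M)"
      by (rule has_derivative_cong_openin[OF openin_chart_range[OF M cD(1)], rotated 2])
         (use cD(2) in \<open>simp_all add: eq'\<close>)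
    have "d \<in> charts_at N (g p)" using True eq[OF p] by simp
    from tangent_map_rep[OF f M N c True v D] tangent_map_rep[OF g M N c this v D']
    show ?thesis by simp
  qed (use eq[OF p] in \<open>simp add: tangent_map_def\<close>)
qed

lemma tangent_map_id:
  assumes M: "smooth_atlas M" and p: "p \<in> points M" and v: "v \<in> tangent_space M p"
  shows "tangent_map M M (\<lambda>p. p) p v = v"
proof -
  obtain c where c: "c \<in> charts_at M p" using ex_chart_at[OF p] .
  show ?thesis
    by (rule tangent_eqI[OF tangent_map_tangent[OF smooth_map_id[OF M] M M p v] v c])
       (use tangent_map_rep[OF smooth_map_id[OF M] M M c c v dtrans_has_derivative[OF M c c]]
          dtrans_self[OF M c tangent_in_Model[OF v c]] in simp)
qed

lemma smooth_map_const:
  assumes M: "smooth_atlas M" and N: "smooth_atlas N" and q: "q \<in> points N"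
  shows "smooth_map M N (\<lambda>p. q)"
proof (rule smooth_mapI[OF M N])
  fix p assume p: "p \<in> points M"
  obtain c where c: "c \<in> charts_at M p" using ex_chart_at[OF p] .
  obtain d where d: "d \<in> charts_at N q" using ex_chart_at[OF q] .
  have "smooth_rep_at M N (\<lambda>p. q) p c d (snd c ` fst c)"
    using c d openin_chart_range[OF M charts_atD(1)[OF c]]
    by (auto simp: smooth_rep_at_def o_def charts_at_def intro: smooth_on_const)
  then show "\<exists>c d V. smooth_rep_at M N (\<lambda>p. q) p c d V" by blast
qed

lemma tangent_map_const:
  assumes M: "smooth_atlas M" and N: "smooth_atlas N" and q: "q \<in> points N"
    and p: "p \<in> points M" and v: "v \<in> tangent_space M p"
  shows "tangent_map M N (\<lambda>p. q) p v = (\<lambda>_. 0)"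
proof
  obtain c where c: "c \<in> charts_at M p" using ex_chart_at[OF p] .
  fix d
  show "tangent_map M N (\<lambda>p. q) p v d = 0"
  proof (cases "d \<in> charts_at N q")
    case True
    have "(snd d \<circ> (\<lambda>p. q) \<circ> chart_inv c has_derivative (\<lambda>v. 0)) (at (snd c p) within Model M)"
      by (simp add: o_def)
    from tangent_map_rep[OF smooth_map_const[OF M N q] M N c True v this] show ?thesis .
  qed (simp add: tangent_map_def)
qed

section \<open>Product manifolds\<close>

lemma span_product:
  fixes A :: "'e::real_normed_vector set" and B :: "'f::real_normed_vector set"
  assumes "finite A" "finite B"
  shows "\<exists>C. finite C \<and> span A \<times> span B = span C"
proof (intro exI conjI)
  let ?C = "(\<lambda>a. (a, 0)) ` A \<union> (\<lambda>b. (0, b)) ` B"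
  show "finite ?C" using assms by simp
  show "span A \<times> span B = span ?C"
  proof
    show "span ?C \<subseteq> span A \<times> span B"
      by (rule span_minimal) (auto intro: span_base span_zero subspace_Times)
    have 1: "(\<lambda>a. (a, 0)) ` span A \<subseteq> span ?C"
    proof -
      have "linear (\<lambda>a::'e. (a, 0::'f))" by (rule linearI) simp_all
      from linear_span_image[OF this, of A] show ?thesis by (metis Un_upper1 span_mono)
    qed
    have 2: "(\<lambda>b. (0, b)) ` span B \<subseteq> span ?C"
    proof -
      have "linear (\<lambda>b::'f. (0::'e, b))" by (rule linearI) simp_all
      from linear_span_image[OF this, of B] show ?thesis by (metis Un_upper2 span_mono)
    qed
    show "span A \<times> span B \<subseteq> span ?C"
    proof clarify
      fix a b assume "a \<in> span A" "b \<in> span B"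
      then have "(a, 0) \<in> span ?C" "(0, b) \<in> span ?C" using 1 2 by auto
      from span_add[OF this] show "(a, b) \<in> span ?C" by simp
    qed
  qed
qed

definition prod_chart :: "('a, 'e) chart \<Rightarrow> ('b, 'f) chart \<Rightarrow> ('a \<times> 'b, 'e \<times> 'f) chart" where
  "prod_chart c d = (fst c \<times> fst d, map_prod (snd c) (snd d))"

lemma prod_chart_simps:
  "fst (prod_chart c d) = fst c \<times> fst d" "snd (prod_chart c d) = map_prod (snd c) (snd d)"
  by (simp_all add: prod_chart_def)

lemma Model_prod: "Model (prod_manifold M N) = Model M \<times> Model N"
  by (simp add: prod_manifold_def)

lemma Atlas_prod: "Atlas (prod_manifold M N) = {prod_chart c d | c d. c \<in> Atlas M \<and> d \<in> Atlas N}"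
  by (simp add: prod_manifold_def prod_chart_def)

lemma prod_chart_Atlas:
  "c \<in> Atlas M \<Longrightarrow> d \<in> Atlas N \<Longrightarrow> prod_chart c d \<in> Atlas (prod_manifold M N)"
  unfolding Atlas_prod by blast

lemma points_prod: "points (prod_manifold M N) = points M \<times> points N"
proof -
  have "Atlas (prod_manifold M N) = (\<lambda>(c, d). prod_chart c d) ` (Atlas M \<times> Atlas N)"
    unfolding Atlas_prod by auto
  then have "points (prod_manifold M N) = (\<Union>(c, d)\<in>Atlas M \<times> Atlas N. fst c \<times> fst d)"
    by (simp add: points_def image_image prod_chart_simps case_prod_unfold)
  then show ?thesis by (auto simp: points_def)
qed

lemma prod_chart_in_charts_at:
  "c \<in> charts_at M p \<Longrightarrow> d \<in> charts_at N q \<Longrightarrow> prod_chart c d \<in> charts_at (prod_manifold M N) (p, q)"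
  using prod_chart_Atlas[of c M d N] by (simp add: charts_at_def prod_chart_simps)

lemma chart_inv_prod_chart:
  assumes "smooth_atlas M" "smooth_atlas N" "c \<in> Atlas M" "d \<in> Atlas N"
    and "x \<in> snd c ` fst c" "y \<in> snd d ` fst d"
  shows "chart_inv (prod_chart c d) (x, y) = (chart_inv c x, chart_inv d y)"
proof -
  have "inj_on (map_prod (snd c) (snd d)) (fst c \<times> fst d)"
    by (intro map_prod_inj_on chart_inj_on[of M] chart_inj_on[of N] assms)
  then show ?thesis
    unfolding chart_inv_def[of "prod_chart c d"] prod_chart_simps
    by (rule inv_into_f_eq)
       (simp_all add: chart_inv_mem chart_chart_inv assms(5,6))
qed

lemma smooth_on_map_prod:
  assumes M: "smooth_atlas M" and N: "smooth_atlas N"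
    and U: "openin (top_of_set (Model M)) U" "openin (top_of_set (Model N)) U'"
    and f: "smooth_on (Model M) U f" and g: "smooth_on (Model N) U' g"
  shows "smooth_on (Model M \<times> Model N) (U \<times> U') (map_prod f g)"
proof -
  obtain B where B: "finite B" "Model M = span B" by (rule Model_span[OF M])
  obtain B' where B': "finite B'" "Model N = span B'" by (rule Model_span[OF N])
  have E: "subspace (Model M \<times> Model N)" by (intro subspace_Times subspace_Model M N)
  have O1: "openin (top_of_set (Model M \<times> Model N)) (U \<times> U')" by (rule openin_Times[OF U])
  have UM: "U \<subseteq> span B" "U' \<subseteq> span B'" using U openin_imp_subset B B' by auto
  have "smooth_on (Model M \<times> Model N) (U \<times> U') (\<lambda>z. f (fst z))"
    by (rule smooth_on_compose[OF E O1 B(1) UM(1)])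
       (use f B in \<open>auto intro: smooth_on_bounded_linear bounded_linear_fst\<close>)
  moreover have "smooth_on (Model M \<times> Model N) (U \<times> U') (\<lambda>z. g (snd z))"
    by (rule smooth_on_compose[OF E O1 B'(1) UM(2)])
       (use g B' in \<open>auto intro: smooth_on_bounded_linear bounded_linear_snd\<close>)
  ultimately have "smooth_on (Model M \<times> Model N) (U \<times> U') (\<lambda>z. (f (fst z), g (snd z)))"
    by (rule smooth_on_Pair)
  moreover have "(\<lambda>z. (f (fst z), g (snd z))) = map_prod f g" by auto
  ultimately show ?thesis by simp
qed

text \<open>
  Transitions of product charts are products of transitions.
\<close>

lemma smooth_atlas_prod:
  assumes M: "smooth_atlas M" and N: "smooth_atlas N"
  shows "smooth_atlas (prod_manifold M N)"
  unfolding smooth_atlas_def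
proof (intro conjI ballI)
  obtain B where B: "finite B" "Model M = span B" by (rule Model_span[OF M])
  obtain B' where B': "finite B'" "Model N = span B'" by (rule Model_span[OF N])
  show "\<exists>B. finite B \<and> Model (prod_manifold M N) = span B"
    using span_product[OF B(1) B'(1)] by (simp add: Model_prod B B')
  fix C assume "C \<in> Atlas (prod_manifold M N)"
  then obtain c d where C: "C = prod_chart c d" and c: "c \<in> Atlas M" and d: "d \<in> Atlas N"
    unfolding Atlas_prod by blast
  have trans: "openin (top_of_set (Model M \<times> Model N)) (snd C ` (fst C \<inter> fst D)) \<and>
      smooth_on (Model M \<times> Model N) (snd C ` (fst C \<inter> fst D)) (transition C D)"
    if CC: "C = prod_chart c d" "c \<in> Atlas M" "d \<in> Atlas N" "D = prod_chart c' d'" "c' \<in> Atlas M" "d' \<in> Atlas N"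
    for C D c d c' d'
  proof -
    have eq: "snd C ` (fst C \<inter> fst D) = snd c ` (fst c \<inter> fst c') \<times> snd d ` (fst d \<inter> fst d')"
      unfolding CC prod_chart_simps Times_Int_Times by (rule map_prod_image)
    have O1: "openin (top_of_set (Model M \<times> Model N)) (snd C ` (fst C \<inter> fst D))"
      unfolding eq by (intro openin_Times openin_chart_overlap M N CC)
    have "smooth_on (Model M \<times> Model N) (snd C ` (fst C \<inter> fst D))
        (map_prod (transition c c') (transition d d'))"
      unfolding eq
      by (intro smooth_on_map_prod M N openin_chart_overlap smooth_on_transition CC)
    then have "smooth_on (Model M \<times> Model N) (snd C ` (fst C \<inter> fst D)) (transition C D)"
    proof (rule smooth_on_cong[OF O1, rotated])
      fix z assume "z \<in> snd C ` (fst C \<inter> fst D)"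
      then obtain x y where z: "z = (x, y)" "x \<in> snd c ` fst c" "y \<in> snd d ` fst d" unfolding eq by auto
      then show "map_prod (transition c c') (transition d d') z = transition C D z"
        by (simp add: transition_def CC chart_inv_prod_chart[OF M N CC(2,3)] prod_chart_simps)
    qed
    with O1 show ?thesis by simp
  qed
  have "fst C \<subseteq> points (prod_manifold M N)"
    using prod_chart_Atlas[OF c d] unfolding C points_def by blast
  moreover have "inj_on (snd C) (fst C)"
    unfolding C prod_chart_simps by (intro map_prod_inj_on chart_inj_on[OF M c] chart_inj_on[OF N d])
  moreover have "openin (top_of_set (Model M \<times> Model N)) (snd C ` fst C)"
    using trans[OF C c d C c d] by simp
  moreover have "openin (top_of_set (Model M \<times> Model N)) (snd C ` (fst C \<inter> fst D)) \<and>
      openin (top_of_set (Model M \<times> Model N)) (snd D ` (fst C \<inter> fst D)) \<and>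
      smooth_on (Model M \<times> Model N) (snd C ` (fst C \<inter> fst D)) (transition C D) \<and>
      smooth_on (Model M \<times> Model N) (snd D ` (fst C \<inter> fst D)) (transition D C)"
    if DA: "D \<in> Atlas (prod_manifold M N)" for D
  proof -
    obtain c' d' where D: "D = prod_chart c' d'" "c' \<in> Atlas M" "d' \<in> Atlas N"
      using DA unfolding Atlas_prod by blast
    show ?thesis
      using trans[OF C c d D] trans[OF D C c d] by (simp only: Int_commute[of "fst D"] simp_thms)
  qed
  ultimately show "smooth_chart (prod_manifold M N) C"
    unfolding smooth_chart_def Model_prod by blast
qed

lemma smooth_map_fst:
  assumes M: "smooth_atlas M" and N: "smooth_atlas N"
  shows "smooth_map (prod_manifold M N) M fst"
    and "c \<in> charts_at M p \<Longrightarrow> d \<in> charts_at N q \<Longrightarrow>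
      (snd c \<circ> fst \<circ> chart_inv (prod_chart c d) has_derivative fst)
        (at (snd (prod_chart c d) (p, q)) within Model (prod_manifold M N))"
proof -
  note MN = smooth_atlas_prod[OF M N]
  have eq: "fst z = (snd c \<circ> fst \<circ> chart_inv (prod_chart c d)) z"
    if z: "z \<in> snd (prod_chart c d) ` fst (prod_chart c d)"
      and c: "c \<in> charts_at M p" and d: "d \<in> charts_at N q" for z c d p q
  proof -
    obtain x y where "z = (x, y)" "x \<in> snd c ` fst c" "y \<in> snd d ` fst d"
      using z by (auto simp: prod_chart_simps)
    then show ?thesis
      using chart_inv_prod_chart[OF M N charts_atD(1)[OF c] charts_atD(1)[OF d]]
      by (simp add: chart_chart_inv)
  qed
  show "(snd c \<circ> fst \<circ> chart_inv (prod_chart c d) has_derivative fst)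
        (at (snd (prod_chart c d) (p, q)) within Model (prod_manifold M N))"
    if c: "c \<in> charts_at M p" and d: "d \<in> charts_at N q" for c d p q
    by (rule has_derivative_cong_openin[OF openin_chart_range[OF MN
          charts_atD(1)[OF prod_chart_in_charts_at[OF c d]]] _ eq[OF _ c d]])
       (use charts_atD(2)[OF c] charts_atD(2)[OF d] in
         \<open>auto simp: prod_chart_simps intro: bounded_linear_imp_has_derivative bounded_linear_fst\<close>)
  show "smooth_map (prod_manifold M N) M fst"
  proof (rule smooth_mapI[OF MN M])
    fix z assume z: "z \<in> points (prod_manifold M N)"
    obtain p q where pq: "z = (p, q)" by (cases z)
    obtain c d where c: "c \<in> charts_at M p" and d: "d \<in> charts_at N q"
      using z ex_chart_at by (metis points_prod pq mem_Sigma_iff)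
    note C = prod_chart_in_charts_at[OF c d]
    have O1: "openin (top_of_set (Model (prod_manifold M N))) (snd (prod_chart c d) ` fst (prod_chart c d))"
      by (rule openin_chart_range[OF MN charts_atD(1)[OF C]])
    have "smooth_on (Model (prod_manifold M N)) (snd (prod_chart c d) ` fst (prod_chart c d))
       (snd c \<circ> fst \<circ> chart_inv (prod_chart c d))"
      by (rule smooth_on_cong[OF O1 eq[OF _ c d] smooth_on_bounded_linear[OF bounded_linear_fst]])
    moreover have "fst (chart_inv (prod_chart c d) x) \<in> fst c"
      if "x \<in> snd (prod_chart c d) ` fst (prod_chart c d)" for x
      using chart_inv_mem[OF that] by (auto simp: prod_chart_simps)
    ultimately have "smooth_rep_at (prod_manifold M N) M fst z (prod_chart c d) c
        (snd (prod_chart c d) ` fst (prod_chart c d))"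
      unfolding smooth_rep_at_def pq using C c O1 charts_atD(2)[OF C] by simp
    then show "\<exists>c d V. smooth_rep_at (prod_manifold M N) M fst z c d V" by blast
  qed
qed

lemma smooth_map_snd:
  assumes M: "smooth_atlas M" and N: "smooth_atlas N"
  shows "smooth_map (prod_manifold M N) N snd"
    and "c \<in> charts_at M p \<Longrightarrow> d \<in> charts_at N q \<Longrightarrow>
      (snd d \<circ> snd \<circ> chart_inv (prod_chart c d) has_derivative snd)
        (at (snd (prod_chart c d) (p, q)) within Model (prod_manifold M N))"
proof -
  note MN = smooth_atlas_prod[OF M N]
  have eq: "snd z = (snd d \<circ> snd \<circ> chart_inv (prod_chart c d)) z"
    if z: "z \<in> snd (prod_chart c d) ` fst (prod_chart c d)"
      and c: "c \<in> charts_at M p" and d: "d \<in> charts_at N q" for z c d p q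
  proof -
    obtain x y where "z = (x, y)" "x \<in> snd c ` fst c" "y \<in> snd d ` fst d"
      using z by (auto simp: prod_chart_simps)
    then show ?thesis
      using chart_inv_prod_chart[OF M N charts_atD(1)[OF c] charts_atD(1)[OF d]]
      by (simp add: chart_chart_inv)
  qed
  show "(snd d \<circ> snd \<circ> chart_inv (prod_chart c d) has_derivative snd)
        (at (snd (prod_chart c d) (p, q)) within Model (prod_manifold M N))"
    if c: "c \<in> charts_at M p" and d: "d \<in> charts_at N q" for c d p q
    by (rule has_derivative_cong_openin[OF openin_chart_range[OF MN
          charts_atD(1)[OF prod_chart_in_charts_at[OF c d]]] _ eq[OF _ c d]])
       (use charts_atD(2)[OF c] charts_atD(2)[OF d] in
         \<open>auto simp: prod_chart_simps intro: bounded_linear_imp_has_derivative bounded_linear_snd\<close>)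
  show "smooth_map (prod_manifold M N) N snd"
  proof (rule smooth_mapI[OF MN N])
    fix z assume z: "z \<in> points (prod_manifold M N)"
    obtain p q where pq: "z = (p, q)" by (cases z)
    obtain c d where c: "c \<in> charts_at M p" and d: "d \<in> charts_at N q"
      using z ex_chart_at by (metis points_prod pq mem_Sigma_iff)
    note C = prod_chart_in_charts_at[OF c d]
    have O1: "openin (top_of_set (Model (prod_manifold M N))) (snd (prod_chart c d) ` fst (prod_chart c d))"
      by (rule openin_chart_range[OF MN charts_atD(1)[OF C]])
    have "smooth_on (Model (prod_manifold M N)) (snd (prod_chart c d) ` fst (prod_chart c d))
       (snd d \<circ> snd \<circ> chart_inv (prod_chart c d))"
      by (rule smooth_on_cong[OF O1 eq[OF _ c d] smooth_on_bounded_linear[OF bounded_linear_snd]])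
    moreover have "snd (chart_inv (prod_chart c d) x) \<in> fst d"
      if "x \<in> snd (prod_chart c d) ` fst (prod_chart c d)" for x
      using chart_inv_mem[OF that] by (auto simp: prod_chart_simps)
    ultimately have "smooth_rep_at (prod_manifold M N) N snd z (prod_chart c d) d
        (snd (prod_chart c d) ` fst (prod_chart c d))"
      unfolding smooth_rep_at_def pq using C d O1 charts_atD(2)[OF C] by simp
    then show "\<exists>c d V. smooth_rep_at (prod_manifold M N) N snd z c d V" by blast
  qed
qed

lemma smooth_map_Pair:
  assumes M: "smooth_atlas M" and N: "smooth_atlas N" and P: "smooth_atlas P"
    and f: "smooth_map M N f" and g: "smooth_map M P g"
  shows "smooth_map M (prod_manifold N P) (\<lambda>p. (f p, g p))"
proof (rule smooth_mapI[OF M smooth_atlas_prod[OF N P]])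
  fix p assume p: "p \<in> points M"
  obtain c where c: "c \<in> charts_at M p" using ex_chart_at[OF p] .
  obtain d where d: "d \<in> charts_at N (f p)" using ex_chart_at[OF smooth_map_points[OF f M N p]] .
  obtain e where e: "e \<in> charts_at P (g p)" using ex_chart_at[OF smooth_map_points[OF g M P p]] .
  define V where "V = snd c ` (fst c \<inter> f -` fst d)"
  define W where "W = snd c ` (fst c \<inter> g -` fst e)"
  have rf: "smooth_rep_at M N f p c d V" unfolding V_def by (rule smooth_map_rep_at[OF f M N c d])
  have rg: "smooth_rep_at M P g p c e W" unfolding W_def by (rule smooth_map_rep_at[OF g M P c e])
  have "smooth_on (Model M) (V \<inter> W) (\<lambda>x. ((snd d \<circ> f \<circ> chart_inv c) x, (snd e \<circ> g \<circ> chart_inv c) x))"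
    by (intro smooth_on_Pair smooth_on_subset[OF smooth_rep_at_smooth_on[OF rf]]
          smooth_on_subset[OF smooth_rep_at_smooth_on[OF rg]]) auto
  moreover have "(\<lambda>x. ((snd d \<circ> f \<circ> chart_inv c) x, (snd e \<circ> g \<circ> chart_inv c) x))
      = snd (prod_chart d e) \<circ> (\<lambda>p. (f p, g p)) \<circ> chart_inv c"
    by (auto simp: prod_chart_simps)
  ultimately have "smooth_rep_at M (prod_manifold N P) (\<lambda>p. (f p, g p)) p c (prod_chart d e) (V \<inter> W)"
    using rf rg c prod_chart_in_charts_at[OF d e]
    unfolding smooth_rep_at_def by (auto simp: prod_chart_simps)
  then show "\<exists>c d V. smooth_rep_at M (prod_manifold N P) (\<lambda>p. (f p, g p)) p c d V" by blast
qed

text \<open>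
  In a product chart the projections are the coordinate projections, so a tangent vector of the
  product is the pair of its two images.
\<close>

lemma tangent_prod_components:
  assumes M: "smooth_atlas M" and N: "smooth_atlas N"
    and c: "c \<in> charts_at M p" and d: "d \<in> charts_at N q"
    and v: "v \<in> tangent_space (prod_manifold M N) (p, q)"
  shows "v (prod_chart c d) = (tangent_map (prod_manifold M N) M fst (p, q) v c,
    tangent_map (prod_manifold M N) N snd (p, q) v d)"
proof -
  note MN = smooth_atlas_prod[OF M N] and C = prod_chart_in_charts_at[OF c d]
  show ?thesis
    using tangent_map_rep[OF smooth_map_fst(1)[OF M N] MN M C _ v smooth_map_fst(2)[OF M N c d]]
      tangent_map_rep[OF smooth_map_snd(1)[OF M N] MN N C _ v smooth_map_snd(2)[OF M N c d]]
      c d by (simp add: prod_eq_iff)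
qed

lemma tangent_prod_eqI:
  assumes M: "smooth_atlas M" and N: "smooth_atlas N" and p: "p \<in> points (prod_manifold M N)"
    and v: "v \<in> tangent_space (prod_manifold M N) p" and w: "w \<in> tangent_space (prod_manifold M N) p"
    and eq: "tangent_map (prod_manifold M N) M fst p v = tangent_map (prod_manifold M N) M fst p w"
      "tangent_map (prod_manifold M N) N snd p v = tangent_map (prod_manifold M N) N snd p w"
  shows "v = w"
proof -
  obtain q r where pq: "p = (q, r)" by (cases p)
  obtain c d where c: "c \<in> charts_at M q" and d: "d \<in> charts_at N r"
    using p ex_chart_at by (metis points_prod pq mem_Sigma_iff)
  have "v (prod_chart c d) = w (prod_chart c d)"
    using tangent_prod_components[OF M N c d v[unfolded pq]]
      tangent_prod_components[OF M N c d w[unfolded pq]] eq by (simp add: pq)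
  from tangent_eqI[OF v[unfolded pq] w[unfolded pq] prod_chart_in_charts_at[OF c d] this] show ?thesis .
qed

section \<open>The tangent space as a manifold\<close>

definition tangent_chart :: "('a, 'e::real_normed_vector) manifold \<Rightarrow> 'a \<Rightarrow> ('a, 'e) chart
    \<Rightarrow> (('a, 'e) tvec, 'e) chart" where
  "tangent_chart M p c = (tangent_space M p, \<lambda>v. v c)"

lemma tangent_chart_simps:
  "fst (tangent_chart M p c) = tangent_space M p" "snd (tangent_chart M p c) v = v c"
  by (simp_all add: tangent_chart_def)

lemma Model_tangent: "Model (tangent_space_manifold M p) = Model M"
  by (simp add: tangent_space_manifold_def)

lemma Atlas_tangent: "Atlas (tangent_space_manifold M p) = tangent_chart M p ` charts_at M p"
  by (auto simp: tangent_space_manifold_def tangent_chart_def)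

lemma tangent_chart_Atlas:
  "c \<in> charts_at M p \<Longrightarrow> tangent_chart M p c \<in> Atlas (tangent_space_manifold M p)"
  by (simp add: Atlas_tangent)

lemma points_tangent: "p \<in> points M \<Longrightarrow> points (tangent_space_manifold M p) = tangent_space M p"
  using ex_chart_at[of p M] unfolding points_def[of "tangent_space_manifold M p"] Atlas_tangent
  by (auto simp: tangent_chart_simps)

lemma tangent_chart_in_charts_at:
  "c \<in> charts_at M p \<Longrightarrow> v \<in> tangent_space M p
    \<Longrightarrow> tangent_chart M p c \<in> charts_at (tangent_space_manifold M p) v"
  using tangent_chart_Atlas[of c M p] by (simp add: charts_at_def tangent_chart_simps)

lemma range_tangent_chart:
  assumes "smooth_atlas M" "c \<in> charts_at M p"
  shows "snd (tangent_chart M p c) ` tangent_space M p = Model M"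
proof (intro equalityI subsetI)
  fix x assume "x \<in> snd (tangent_chart M p c) ` tangent_space M p"
  then show "x \<in> Model M" using tangent_in_Model[OF _ assms(2)] by (auto simp: tangent_chart_simps)
next
  fix x assume "x \<in> Model M"
  then show "x \<in> snd (tangent_chart M p c) ` tangent_space M p"
    using coord_vec_tangent[OF assms] coord_vec_chart[OF assms]
    by (intro image_eqI[of _ _ "coord_vec M p c x"]) (simp_all add: tangent_chart_simps)
qed

lemma inj_on_tangent_chart:
  "c \<in> charts_at M p \<Longrightarrow> inj_on (snd (tangent_chart M p c)) (tangent_space M p)"
  by (rule inj_onI) (simp add: tangent_chart_simps tangent_eqI)

lemma chart_inv_tangent_chart:
  assumes "smooth_atlas M" "c \<in> charts_at M p" "x \<in> Model M"
  shows "chart_inv (tangent_chart M p c) x = coord_vec M p c x"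
  unfolding chart_inv_def tangent_chart_simps(1)
  by (rule inv_into_f_eq[OF inj_on_tangent_chart[OF assms(2)] coord_vec_tangent[OF assms]])
     (simp add: tangent_chart_simps coord_vec_chart[OF assms])

text \<open>
  The charts \<open>\<lambda>v. v c\<close> are linear isomorphisms onto the model, and their transitions are the
  restrictions of the bounded linear maps \<open>dtrans M p c d\<close>.
\<close>

lemma smooth_atlas_tangent:
  assumes M: "smooth_atlas M"
  shows "smooth_atlas (tangent_space_manifold M p)"
  unfolding smooth_atlas_def Model_tangent
proof (intro conjI ballI)
  show "\<exists>B. finite B \<and> Model M = span B" using M by (simp add: smooth_atlas_def)
  fix C assume "C \<in> Atlas (tangent_space_manifold M p)"
  then obtain c where C: "C = tangent_chart M p c" and c: "c \<in> charts_at M p"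
    unfolding Atlas_tangent by blast
  have trans: "smooth_on (Model M) (Model M) (transition (tangent_chart M p c) (tangent_chart M p d))"
    if c: "c \<in> charts_at M p" and d: "d \<in> charts_at M p" for c d
    by (rule smooth_on_cong[OF _ _ smooth_on_bounded_linear[OF linear_dtrans[OF M c d]]])
       (use d in \<open>simp_all add: transition_def tangent_chart_simps chart_inv_tangent_chart[OF M c] coord_vec_def\<close>)
  have "smooth_on (Model M) (Model M) (transition C D) \<and> smooth_on (Model M) (Model M) (transition D C)
      \<and> fst D = tangent_space M p \<and> snd D ` tangent_space M p = Model M"
    if DA: "D \<in> Atlas (tangent_space_manifold M p)" for D
  proof -
    obtain d where D: "D = tangent_chart M p d" and d: "d \<in> charts_at M p"
      using DA unfolding Atlas_tangent by blast
    show ?thesis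
      unfolding C D using trans[OF c d] trans[OF d c] range_tangent_chart[OF M d]
      by (simp only: tangent_chart_simps(1) simp_thms)
  qed
  moreover have "fst C = tangent_space M p" "snd C ` tangent_space M p = Model M"
    using range_tangent_chart[OF M c] by (simp_all add: C tangent_chart_simps(1))
  moreover have "inj_on (snd C) (fst C)"
    using inj_on_tangent_chart[OF c] by (simp add: C tangent_chart_simps(1))
  moreover have "fst C \<subseteq> points (tangent_space_manifold M p)"
    using tangent_chart_Atlas[OF c] unfolding C points_def by blast
  ultimately show "smooth_chart (tangent_space_manifold M p) C"
    unfolding smooth_chart_def Model_tangent by simp
qed

text \<open>
  A tangent map at one point is linear, and in the charts \<open>\<lambda>v. v c\<close> it is the restriction of a
  bounded linear map.
\<close>

lemma smooth_map_tangent_map: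
  assumes f: "smooth_map M N f" and M: "smooth_atlas M" and N: "smooth_atlas N"
    and p: "p \<in> points M"
  shows "smooth_map (tangent_space_manifold M p) (tangent_space_manifold N (f p)) (tangent_map M N f p)"
proof (rule smooth_mapI[OF smooth_atlas_tangent[OF M] smooth_atlas_tangent[OF N]])
  fix v assume "v \<in> points (tangent_space_manifold M p)"
  then have v: "v \<in> tangent_space M p" by (simp add: points_tangent[OF p])
  obtain c where c: "c \<in> charts_at M p" using ex_chart_at[OF p] .
  obtain d where d: "d \<in> charts_at N (f p)" using ex_chart_at[OF smooth_map_points[OF f M N p]] .
  obtain D where D: "(snd d \<circ> f \<circ> chart_inv c has_derivative D) (at (snd c p) within Model M)"
    by (rule ex_rep_derivative[OF f M N c d])
  have fv: "tangent_map M N f p v \<in> tangent_space N (f p)" if "v \<in> tangent_space M p" for v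
    by (rule tangent_map_tangent[OF f M N p that])
  have "smooth_on (Model M) (Model M)
      (snd (tangent_chart N (f p) d) \<circ> tangent_map M N f p \<circ> chart_inv (tangent_chart M p c))"
    by (rule smooth_on_cong[OF _ _ smooth_on_bounded_linear[OF has_derivative_bounded_linear[OF D]]])
       (simp_all add: tangent_chart_simps chart_inv_tangent_chart[OF M c]
         tangent_map_rep[OF f M N c d coord_vec_tangent[OF M c] D] coord_vec_chart[OF M c])
  then have "smooth_rep_at (tangent_space_manifold M p) (tangent_space_manifold N (f p))
      (tangent_map M N f p) v (tangent_chart M p c) (tangent_chart N (f p) d) (Model M)"
    unfolding smooth_rep_at_def Model_tangent
    using tangent_chart_in_charts_at[OF c v] tangent_chart_in_charts_at[OF d fv[OF v]]
      tangent_in_Model[OF v c] range_tangent_chart[OF M c] fv[OF coord_vec_tangent[OF M c]]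
    by (simp add: tangent_chart_simps chart_inv_tangent_chart[OF M c])
  then show "\<exists>c d V. smooth_rep_at (tangent_space_manifold M p) (tangent_space_manifold N (f p))
      (tangent_map M N f p) v c d V" by blast
qed

section \<open>Maps with vanishing derivative\<close>

lemma has_derivative_cong_on_subspace:
  assumes "subspace E" "x \<in> E" "(f has_derivative D) (at x within E)" "bounded_linear D'"
    and "\<And>v. v \<in> E \<Longrightarrow> D v = D' v"
  shows "(f has_derivative D') (at x within E)"
proof -
  have "\<forall>\<^sub>F y in at x within E. (1 / norm (y - x)) *\<^sub>R (f y - (f x + D (y - x)))
      = (1 / norm (y - x)) *\<^sub>R (f y - (f x + D' (y - x)))"
    unfolding eventually_at_filter
    by (rule always_eventually) (auto simp: assms(5) subspace_diff[OF assms(1) _ assms(2)])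
  from tendsto_cong[OF this] show ?thesis
    using assms(3,4) by (simp add: has_derivative_within)
qed

text \<open>
  In charts \<open>h\<close> has derivative \<open>0\<close>, so it is constant on small balls of the model space and hence
  locally constant; the model space is connected.
\<close>

lemma zero_tangent_map_imp_constant:
  assumes h: "smooth_map (tangent_space_manifold M p) N h" and M: "smooth_atlas M" and N: "smooth_atlas N"
    and p: "p \<in> points M"
    and zero: "\<And>a v. a \<in> tangent_space M p \<Longrightarrow> v \<in> tangent_space (tangent_space_manifold M p) a
      \<Longrightarrow> tangent_map (tangent_space_manifold M p) N h a v = (\<lambda>_. 0)"
    and a: "a \<in> tangent_space M p" and b: "b \<in> tangent_space M p"
  shows "h a = h b"
proof -
  let ?T = "tangent_space_manifold M p"
  obtain c where c: "c \<in> charts_at M p" using ex_chart_at[OF p] .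
  define C where "C = tangent_chart M p c"
  define k where "k x = h (coord_vec M p c x)" for x
  have T: "smooth_atlas ?T" by (rule smooth_atlas_tangent[OF M])
  have E: "subspace (Model M)" by (rule subspace_Model[OF M])
  have "\<forall>\<^sub>F y in at x within Model M. k x = k y" if x: "x \<in> Model M" for x
  proof -
    define q where "q = coord_vec M p c x"
    have q: "q \<in> tangent_space M p" unfolding q_def by (rule coord_vec_tangent[OF M c x])
    have C: "C \<in> charts_at ?T q" unfolding C_def by (rule tangent_chart_in_charts_at[OF c q])
    have "h q \<in> points N" using smooth_map_points[OF h T N] q by (simp add: points_tangent[OF p])
    then obtain d where d: "d \<in> charts_at N (h q)" using ex_chart_at by metis
    define V where "V = snd C ` (fst C \<inter> h -` fst d)"
    have r: "smooth_rep_at ?T N h q C d V"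
      unfolding V_def by (rule smooth_map_rep_at[where f = h and p = q, OF h T N C d])
    have V: "openin (top_of_set (Model M)) V" "snd C q \<in> V" "\<And>y. y \<in> V \<Longrightarrow> h (chart_inv C y) \<in> fst d"
      using r by (simp_all add: smooth_rep_at_def Model_tangent)
    have xV: "x \<in> V" using V(2) by (simp add: C_def tangent_chart_simps q_def coord_vec_chart[OF M c x])
    obtain T' where T': "open T'" "V = Model M \<inter> T'" using V(1) by (auto simp: openin_open)
    then obtain r where r: "r > 0" "ball x r \<subseteq> T'" using xV open_contains_ball by blast
    define S where "S = ball x r \<inter> Model M"
    have SV: "S \<subseteq> V" using r T' by (auto simp: S_def)
    have inv: "chart_inv C y = coord_vec M p c y" if "y \<in> Model M" for y
      unfolding C_def by (rule chart_inv_tangent_chart[OF M c that])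
    have D0: "(snd d \<circ> h \<circ> chart_inv C has_derivative (\<lambda>v. 0)) (at y within S)" if y: "y \<in> S" for y
    proof -
      have yM: "y \<in> Model M" using y by (simp add: S_def)
      define q' where "q' = coord_vec M p c y"
      have q': "q' \<in> tangent_space M p" unfolding q'_def by (rule coord_vec_tangent[OF M c yM])
      have Cq': "snd C q' = y" by (simp add: C_def tangent_chart_simps q'_def coord_vec_chart[OF M c yM])
      have C': "C \<in> charts_at ?T q'" unfolding C_def by (rule tangent_chart_in_charts_at[OF c q'])
      have "h q' \<in> fst d"
        unfolding q'_def inv[OF yM, symmetric] by (rule V(3)[OF subsetD[OF SV y]])
      then have d': "d \<in> charts_at N (h q')" using charts_atI[OF charts_atD(1)[OF d]] by blast
      obtain D where D: "(snd d \<circ> h \<circ> chart_inv C has_derivative D) (at (snd C q') within Model ?T)"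
        by (rule ex_rep_derivative[where f = h and p = q', OF h T N C' d'])
      have "D e = 0" if e: "e \<in> Model M" for e
      proof -
        have e': "e \<in> Model ?T" using e by (simp add: Model_tangent)
        have "D (coord_vec ?T q' C e C) = tangent_map ?T N h q' (coord_vec ?T q' C e) d"
          using tangent_map_rep[where f = h and p = q', OF h T N C' d' coord_vec_tangent[OF T C' e'] D] by simp
        also have "\<dots> = 0" using zero[OF q' coord_vec_tangent[OF T C' e']] by simp
        finally show ?thesis by (simp add: coord_vec_chart[OF T C' e'])
      qed
      then have "(snd d \<circ> h \<circ> chart_inv C has_derivative (\<lambda>v. 0)) (at y within Model M)"
        using has_derivative_cong_on_subspace[OF E yM D[unfolded Cq' Model_tangent] bounded_linear_zero]
        by blast
      then show ?thesis by (rule has_derivative_subset) (simp add: S_def)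
    qed
    have "convex S" unfolding S_def by (intro convex_Int convex_ball subspace_imp_convex E)
    then obtain u where u: "\<And>y. y \<in> S \<Longrightarrow> (snd d \<circ> h \<circ> chart_inv C) y = u"
      using has_derivative_zero_constant[OF _ D0] by metis
    have "k x = k y" if y: "y \<in> S" for y
    proof -
      have xS: "x \<in> S" using r x by (simp add: S_def)
      have "snd d (h (chart_inv C x)) = snd d (h (chart_inv C y))" using u[OF xS] u[OF y] by simp
      moreover have "h (chart_inv C x) \<in> fst d" "h (chart_inv C y) \<in> fst d" using V(3) SV xS y by auto
      ultimately have "h (chart_inv C x) = h (chart_inv C y)"
        using chart_inj_on[OF N charts_atD(1)[OF d]] by (simp add: inj_on_eq_iff)
      then show ?thesis using x y by (simp add: k_def inv S_def)
    qed
    then show ?thesis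
      unfolding eventually_at using r by (intro exI[of _ r]) (auto simp: S_def dist_commute)
  qed
  then have "k (a c) = k (b c)"
    by (intro connected_local_const[of "Model M"] convex_connected subspace_imp_convex E ballI)
       (use tangent_in_Model[OF a c] tangent_in_Model[OF b c] in auto)
  moreover have "coord_vec M p c (v c) = v" if v: "v \<in> tangent_space M p" for v
    by (rule tangent_eqI[OF coord_vec_tangent[OF M c] v c])
       (simp_all add: tangent_in_Model[OF v c] coord_vec_chart[OF M c])
  ultimately show ?thesis using a b by (simp add: k_def)
qed

section \<open>Holomorphic maps\<close>

lemma almost_complex_structureD:
  assumes "almost_complex_structure M J" "p \<in> points M" "v \<in> tangent_space M p"
  shows "J p v \<in> tangent_space M p"
    and "J p (J p v) = (\<lambda>c. - v c)"
    and "J p (\<lambda>c. r *\<^sub>R v c) = (\<lambda>c. r *\<^sub>R J p v c)"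
    and "w \<in> tangent_space M p \<Longrightarrow> J p (\<lambda>c. v c + w c) = (\<lambda>c. J p v c + J p w c)"
  using assms unfolding almost_complex_structure_def by blast+

lemma almost_complex_structure_zero:
  assumes "almost_complex_structure M J" "smooth_atlas M" "p \<in> points M"
  shows "J p (\<lambda>_. 0) = (\<lambda>_. 0)"
  using almost_complex_structureD(3)[OF assms(1,3) tangent_zero[OF assms(2)], of 0] by simp

lemma holomorphic_map_smooth: "holomorphic_map M J N K f \<Longrightarrow> smooth_map M N f"
  by (simp add: holomorphic_map_def)

lemma holomorphic_mapD:
  "holomorphic_map M J N K f \<Longrightarrow> p \<in> points M \<Longrightarrow> v \<in> tangent_space M p
    \<Longrightarrow> tangent_map M N f p (J p v) = K (f p) (tangent_map M N f p v)"
  by (simp add: holomorphic_map_def)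

lemma holomorphic_map_compose:
  assumes M: "smooth_atlas M" and N: "smooth_atlas N" and P: "smooth_atlas P"
    and J: "almost_complex_structure M J"
    and f: "holomorphic_map M J N K f" and g: "holomorphic_map N K P L g"
  shows "holomorphic_map M J P L (\<lambda>p. g (f p))"
  unfolding holomorphic_map_def
proof (intro conjI ballI)
  note sf = holomorphic_map_smooth[OF f] and sg = holomorphic_map_smooth[OF g]
  show "smooth_map M P (\<lambda>p. g (f p))" by (rule smooth_map_compose[OF M N P sf sg])
  fix p v assume p: "p \<in> points M" and v: "v \<in> tangent_space M p"
  note comp = tangent_map_compose[where f = f and g = g, OF M N P sf sg p]
  have "tangent_map M P (\<lambda>p. g (f p)) p (J p v) = tangent_map N P g (f p) (K (f p) (tangent_map M N f p v))"
    by (simp add: comp[OF almost_complex_structureD(1)[OF J p v]] holomorphic_mapD[OF f p v])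
  also have "\<dots> = L (g (f p)) (tangent_map N P g (f p) (tangent_map M N f p v))"
    by (rule holomorphic_mapD[OF g smooth_map_points[OF sf M N p] tangent_map_tangent[OF sf M N p v]])
  finally show "tangent_map M P (\<lambda>p. g (f p)) p (J p v) = L (g (f p)) (tangent_map M P (\<lambda>p. g (f p)) p v)"
    by (simp add: comp[OF v])
qed

lemma holomorphic_map_const:
  assumes M: "smooth_atlas M" and N: "smooth_atlas N"
    and J: "almost_complex_structure M J" and K: "almost_complex_structure N K" and q: "q \<in> points N"
  shows "holomorphic_map M J N K (\<lambda>p. q)"
  unfolding holomorphic_map_def
  using smooth_map_const[OF M N q] tangent_map_const[OF M N q]
    almost_complex_structureD(1)[OF J] almost_complex_structure_zero[OF K N q]
  by simp

lemma prod_structure_eqI: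
  assumes M: "smooth_atlas M" and N: "smooth_atlas N" and p: "p \<in> points (prod_manifold M N)"
    and w: "w \<in> tangent_space (prod_manifold M N) p"
    and eq1: "tangent_map (prod_manifold M N) M fst p w = J (fst p) (tangent_map (prod_manifold M N) M fst p v)"
    and eq2: "tangent_map (prod_manifold M N) N snd p w = K (snd p) (tangent_map (prod_manifold M N) N snd p v)"
  shows "prod_structure M J N K p v = w"
  unfolding prod_structure_def
proof (rule the_equality)
  fix u assume u: "u \<in> tangent_space (prod_manifold M N) p \<and>
     tangent_map (prod_manifold M N) M fst p u = J (fst p) (tangent_map (prod_manifold M N) M fst p v) \<and>
     tangent_map (prod_manifold M N) N snd p u = K (snd p) (tangent_map (prod_manifold M N) N snd p v)"
  show "u = w" by (rule tangent_prod_eqI[OF M N p _ w]) (use u eq1 eq2 in auto)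
qed (use w eq1 eq2 in auto)

text \<open>
  The images of \<open>J v\<close> under both projections are the prescribed ones, and this determines the
  value of \<open>prod_structure\<close>.
\<close>

lemma holomorphic_map_Pair:
  assumes M: "smooth_atlas M" and N: "smooth_atlas N" and P: "smooth_atlas P"
    and J: "almost_complex_structure M J"
    and f: "holomorphic_map M J N K f" and g: "holomorphic_map M J P L g"
  shows "holomorphic_map M J (prod_manifold N P) (prod_structure N K P L) (\<lambda>p. (f p, g p))"
  unfolding holomorphic_map_def
proof (intro conjI ballI)
  note sf = holomorphic_map_smooth[OF f] and sg = holomorphic_map_smooth[OF g]
  note NP = smooth_atlas_prod[OF N P]
  show fg: "smooth_map M (prod_manifold N P) (\<lambda>p. (f p, g p))" by (rule smooth_map_Pair[OF M N P sf sg])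
  fix p v assume p: "p \<in> points M" and v: "v \<in> tangent_space M p"
  let ?t = "tangent_map M (prod_manifold N P) (\<lambda>p. (f p, g p)) p"
  have fst: "tangent_map (prod_manifold N P) N fst (f p, g p) (?t u) = tangent_map M N f p u"
    if u: "u \<in> tangent_space M p" for u
    using tangent_map_compose[where f = "\<lambda>p. (f p, g p)" and g = fst, OF M NP N fg smooth_map_fst(1)[OF N P] p u]
    by simp
  have snd: "tangent_map (prod_manifold N P) P snd (f p, g p) (?t u) = tangent_map M P g p u"
    if u: "u \<in> tangent_space M p" for u
    using tangent_map_compose[where f = "\<lambda>p. (f p, g p)" and g = snd, OF M NP P fg smooth_map_snd(1)[OF N P] p u]
    by simp
  note Jv = almost_complex_structureD(1)[OF J p v]
  have "prod_structure N K P L (f p, g p) (?t v) = ?t (J p v)"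
    by (rule prod_structure_eqI[OF N P])
       (use smooth_map_points[OF fg M NP p] tangent_map_tangent[OF fg M NP p Jv]
          holomorphic_mapD[OF f p v] holomorphic_mapD[OF g p v] in \<open>simp_all add: fst snd v Jv\<close>)
  then show "?t (J p v) = prod_structure N K P L (f p, g p) (?t v)" by simp
qed

section \<open>Lie groups\<close>

lemma smooth_map_mult:
  assumes G: "lie_group G" and M: "smooth_atlas M"
    and f: "smooth_map M (manif G) f" and g: "smooth_map M (manif G) g"
  shows "smooth_map M (manif G) (\<lambda>p. f p \<otimes>\<^bsub>G\<^esub> g p)"
proof -
  have N: "smooth_atlas (manif G)"
    using G by (simp add: lie_group_def smooth_manifold_imp_smooth_atlas)
  have "smooth_map (prod_manifold (manif G) (manif G)) (manif G) (\<lambda>(x, y). x \<otimes>\<^bsub>G\<^esub> y)"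
    using G by (simp add: lie_group_def)
  from smooth_map_compose[OF M smooth_atlas_prod[OF N N] N smooth_map_Pair[OF M N N f g] this]
  show ?thesis by simp
qed

lemma smooth_map_inverse:
  assumes G: "lie_group G" and M: "smooth_atlas M" and f: "smooth_map M (manif G) f"
  shows "smooth_map M (manif G) (\<lambda>p. inv\<^bsub>G\<^esub> (f p))"
proof -
  have N: "smooth_atlas (manif G)"
    using G by (simp add: lie_group_def smooth_manifold_imp_smooth_atlas)
  have "smooth_map (manif G) (manif G) (\<lambda>x. inv\<^bsub>G\<^esub> x)"
    using G by (simp add: lie_group_def)
  from smooth_map_compose[OF M N N f this] show ?thesis .
qed

lemma holomorphic_map_mult:
  assumes G: "complex_lie_group G" and M: "smooth_atlas M" and J: "almost_complex_structure M J"
    and f: "holomorphic_map M J (manif G) (cstr G) f" and g: "holomorphic_map M J (manif G) (cstr G) g"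
  shows "holomorphic_map M J (manif G) (cstr G) (\<lambda>p. f p \<otimes>\<^bsub>G\<^esub> g p)"
proof -
  have N: "smooth_atlas (manif G)"
    using G by (simp add: complex_lie_group_def lie_group_def smooth_manifold_imp_smooth_atlas)
  have "holomorphic_map (prod_manifold (manif G) (manif G))
       (prod_structure (manif G) (cstr G) (manif G) (cstr G)) (manif G) (cstr G)
       (\<lambda>(x, y). x \<otimes>\<^bsub>G\<^esub> y)"
    using G by (simp add: complex_lie_group_def)
  from holomorphic_map_compose[OF M smooth_atlas_prod[OF N N] N J holomorphic_map_Pair[OF M N N J f g] this]
  show ?thesis by simp
qed

lemma holomorphic_map_inverse:
  assumes G: "complex_lie_group G" and M: "smooth_atlas M" and J: "almost_complex_structure M J"
    and f: "holomorphic_map M J (manif G) (cstr G) f"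
  shows "holomorphic_map M J (manif G) (cstr G) (\<lambda>p. inv\<^bsub>G\<^esub> (f p))"
proof -
  have N: "smooth_atlas (manif G)"
    using G by (simp add: complex_lie_group_def lie_group_def smooth_manifold_imp_smooth_atlas)
  have "holomorphic_map (manif G) (cstr G) (manif G) (cstr G) (\<lambda>x. inv\<^bsub>G\<^esub> x)"
    using G by (simp add: complex_lie_group_def)
  from holomorphic_map_compose[OF M N N J f this] show ?thesis .
qed

lemma smooth_map_conjugation:
  assumes G: "lie_group G" and x: "x \<in> carrier G"
  shows "smooth_map (manif G) (manif G) (\<lambda>y. x \<otimes>\<^bsub>G\<^esub> y \<otimes>\<^bsub>G\<^esub> inv\<^bsub>G\<^esub> x)"
proof -
  have N: "smooth_atlas (manif G)" and gr: "group G" and pts: "points (manif G) = carrier G"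
    using G by (simp_all add: lie_group_def smooth_manifold_imp_smooth_atlas)
  have "inv\<^bsub>G\<^esub> x \<in> carrier G" using gr x by (rule group.inv_closed)
  then show ?thesis
    using x by (intro smooth_map_mult[OF G N] smooth_map_const[OF N N] smooth_map_id N) (simp_all add: pts)
qed

lemma smooth_map_Ad:
  assumes G: "lie_group G" and x: "x \<in> carrier G"
  shows "smooth_map (affine_lie_algebra G) (affine_lie_algebra G) (Ad G x)"
proof -
  have N: "smooth_atlas (manif G)" and gr: "group G" and pts: "points (manif G) = carrier G"
    using G by (simp_all add: lie_group_def smooth_manifold_imp_smooth_atlas)
  interpret group G by (rule gr)
  have "\<one>\<^bsub>G\<^esub> \<in> points (manif G)" by (simp add: pts)
  from smooth_map_tangent_map[OF smooth_map_conjugation[OF G x] N N this]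
  show ?thesis using x by (simp add: Ad_def[abs_def])
qed

lemma Ad_zero:
  assumes G: "lie_group G" and x: "x \<in> carrier G"
  shows "Ad G x (\<lambda>_. 0) = (\<lambda>_. 0)"
proof -
  have N: "smooth_atlas (manif G)" and gr: "group G" and pts: "points (manif G) = carrier G"
    using G by (simp_all add: lie_group_def smooth_manifold_imp_smooth_atlas)
  interpret group G by (rule gr)
  have "\<one>\<^bsub>G\<^esub> \<in> points (manif G)" by (simp add: pts)
  from tangent_map_scale[OF smooth_map_conjugation[OF G x] N N this tangent_zero[OF N], of 0]
  show ?thesis by (simp add: Ad_def)
qed

section \<open>Totally real slices\<close>

text \<open>
  \<open>q\<close> is linear on \<open>span B\<close> only. It is replaced by a linear map \<open>q'\<close> of the whole space that
  agrees with it on a basis; the image of the basis is independent and of the right size.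
\<close>

lemma injective_endomorphism_span_surjective:
  fixes q :: "'e::real_normed_vector \<Rightarrow> 'e"
  assumes B: "finite B"
    and range: "\<And>x. x \<in> span B \<Longrightarrow> q x \<in> span B"
    and add: "\<And>x y. x \<in> span B \<Longrightarrow> y \<in> span B \<Longrightarrow> q (x + y) = q x + q y"
    and scale: "\<And>r x. x \<in> span B \<Longrightarrow> q (r *\<^sub>R x) = r *\<^sub>R q x"
    and inj: "\<And>x. x \<in> span B \<Longrightarrow> q x = 0 \<Longrightarrow> x = 0"
    and y: "y \<in> span B"
  obtains x where "x \<in> span B" "q x = y"
proof -
  obtain B0 where B0: "B0 \<subseteq> span B" "independent B0" "span B \<subseteq> span B0"
    using maximal_independent_subset by blast
  have span: "span B0 = span B" using B0 span_minimal[OF B0(1) subspace_span] by blast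
  have fin: "finite B0" using independent_span_bound[OF B B0(2,1)] by simp
  obtain q' where q': "linear q'" "\<And>x. x \<in> B0 \<Longrightarrow> q' x = q x"
    using linear_independent_extend[OF B0(2), of q] by blast
  have q0: "q 0 = 0" using scale[of 0 0] span_zero by force
  have eq: "q' x = q x" if x: "x \<in> span B0" for x
  proof -
    have "subspace {x. x \<in> span B \<and> q' x = q x}"
      using q0 linear_0[OF q'(1)]
      by (auto simp: subspace_def add scale linear_add[OF q'(1)] linear_scale[OF q'(1)]
        intro: span_zero span_add span_scale)
    moreover have "B0 \<subseteq> {x. x \<in> span B \<and> q' x = q x}" using B0(1) q'(2) by blast
    ultimately show ?thesis using span_minimal[of B0] x by blast
  qed
  have "inj_on q' (span B0)"
    unfolding linear_inj_on_iff_eq_0[OF q'(1) subspace_span] using eq inj by (simp add: span)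
  then have ind: "independent (q' ` B0)" and card: "card (q' ` B0) = card B0"
    using linear_independent_injective_image[OF q'(1) B0(2)]
      card_image[of q' B0] inj_on_subset[OF _ span_superset] by blast+
  have "y \<in> span (q' ` B0)"
  proof (rule ccontr)
    assume ny: "y \<notin> span (q' ` B0)"
    then have "independent (insert y (q' ` B0))" using ind by (simp add: independent_insertI)
    moreover have "insert y (q' ` B0) \<subseteq> span B0"
      using y range B0(1) q'(2) by (auto simp: span)
    ultimately have "card (insert y (q' ` B0)) \<le> card B0"
      using independent_span_bound[OF fin] by blast
    moreover have "y \<notin> q' ` B0" using ny span_base[of y "q' ` B0"] by blast
    ultimately show False using card fin by simp
  qed
  then obtain x where "x \<in> span B0" "y = q' x" unfolding linear_span_image[OF q'(1)] by blast
  with eq[of x] span show thesis by (intro that[of x]) simp_all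
qed

lemma slice_tangent_component:
  assumes M: "smooth_atlas M" and N: "smooth_atlas N"
    and c: "c \<in> charts_at M p" and d: "d \<in> charts_at N q" and u: "u \<in> tangent_space M p"
  shows "tangent_map M (prod_manifold M N) (\<lambda>y. (y, q)) p u (prod_chart c d) = (u c, 0)"
proof -
  note MN = smooth_atlas_prod[OF M N]
  note p = charts_at_points[OF c] and q = charts_at_points[OF d]
  have i: "smooth_map M (prod_manifold M N) (\<lambda>y. (y, q))"
    by (rule smooth_map_Pair[OF M M N smooth_map_id[OF M] smooth_map_const[OF M N q]])
  let ?w = "tangent_map M (prod_manifold M N) (\<lambda>y. (y, q)) p u"
  have "tangent_map (prod_manifold M N) M fst (p, q) ?w = u"
    using tangent_map_compose[where f = "\<lambda>y. (y, q)" and g = fst, OF M MN M i smooth_map_fst(1)[OF M N] p u]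
      tangent_map_id[OF M p u] by simp
  moreover have "tangent_map (prod_manifold M N) N snd (p, q) ?w = (\<lambda>_. 0)"
    using tangent_map_compose[where f = "\<lambda>y. (y, q)" and g = snd, OF M MN N i smooth_map_snd(1)[OF M N] p u]
      tangent_map_const[OF M N q p u] by simp
  ultimately show ?thesis
    using tangent_prod_components[OF M N c d tangent_map_tangent[where f = "\<lambda>y. (y, q)", OF i M MN p u]] by simp
qed

text \<open>
  In a product chart \<open>W\<close> consists of the vectors \<open>(e, 0)\<close>. Let \<open>r e\<close> be the second component of
  \<open>J (e, 0)\<close>. If \<open>r e = 0\<close>, then \<open>J (e, 0)\<close> lies in \<open>W\<close> and in \<open>J W\<close>, so it vanishes and \<open>e = 0\<close>. Thus
  \<open>r\<close> is an injective endomorphism of the common model space, hence surjective, and subtracting a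
  suitable \<open>J (e, 0)\<close> from a given vector leaves a vector with second component \<open>0\<close>.
\<close>

lemma totally_real_slice_spans:
  fixes M :: "('a, 'e::real_normed_vector) manifold" and N :: "('b, 'e) manifold"
  assumes M: "smooth_atlas M" and N: "smooth_atlas N" and Model: "Model N = Model M"
    and J: "almost_complex_structure (prod_manifold M N) J"
    and p: "p \<in> points M" and q: "q \<in> points N"
    and W: "W = tangent_map M (prod_manifold M N) (\<lambda>y. (y, q)) p ` tangent_space M p"
    and real: "W \<inter> J (p, q) ` W = {\<lambda>_. 0}"
    and v: "v \<in> tangent_space (prod_manifold M N) (p, q)"
  obtains w1 w2 where "w1 \<in> W" "w2 \<in> W" "v = (\<lambda>c. w1 c + J (p, q) w2 c)"
proof -
  let ?X = "prod_manifold M N" and ?J = "J (p, q)"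
  note X = smooth_atlas_prod[OF M N]
  obtain c where c: "c \<in> charts_at M p" using ex_chart_at[OF p] .
  obtain d where d: "d \<in> charts_at N q" using ex_chart_at[OF q] .
  define C where "C = prod_chart c d"
  have C: "C \<in> charts_at ?X (p, q)" unfolding C_def by (rule prod_chart_in_charts_at[OF c d])
  have pq: "(p, q) \<in> points ?X" by (rule charts_at_points[OF C])
  note JD = almost_complex_structureD[OF J pq]
  note J0 = almost_complex_structure_zero[OF J X pq]
  define i where "i = tangent_map M ?X (\<lambda>y. (y, q)) p"
  have si: "smooth_map M ?X (\<lambda>y. (y, q))"
    by (rule smooth_map_Pair[OF M M N smooth_map_id[OF M] smooth_map_const[OF M N q]])
  define w where "w e = i (coord_vec M p c e)" for e
  have wW: "w e \<in> W" if "e \<in> Model M" for e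
    using coord_vec_tangent[OF M c that] by (simp add: W w_def i_def)
  have wT: "w e \<in> tangent_space ?X (p, q)" if "e \<in> Model M" for e
    unfolding w_def i_def
    by (rule tangent_map_tangent[where f = "\<lambda>y. (y, q)", OF si M X p coord_vec_tangent[OF M c that]])
  have wC: "w e C = (e, 0)" if "e \<in> Model M" for e
    using slice_tangent_component[OF M N c d coord_vec_tangent[OF M c that]] coord_vec_chart[OF M c that]
    by (simp add: w_def i_def C_def)
  have in_Model: "fst (u C) \<in> Model M" "snd (u C) \<in> Model M" if "u \<in> tangent_space ?X (p, q)" for u
    using tangent_in_Model[OF that C] by (auto simp: Model_prod Model)
  have eqI: "u = u'" if "u \<in> tangent_space ?X (p, q)" "u' \<in> tangent_space ?X (p, q)" "u C = u' C" for u u'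
    by (rule tangent_eqI[OF that(1,2) C that(3)])
  obtain B where B: "finite B" "Model M = span B" by (rule Model_span[OF M])
  define r where "r e = snd (?J (w e) C)" for e
  have w_add: "w (e + e') = (\<lambda>c. w e c + w e' c)" if "e \<in> Model M" "e' \<in> Model M" for e e'
    by (rule eqI[OF wT tangent_add[OF X wT wT]])
       (use that subspace_Model[OF M] in \<open>simp_all add: subspace_add wC\<close>)
  have w_scale: "w (t *\<^sub>R e) = (\<lambda>c. t *\<^sub>R w e c)" if "e \<in> Model M" for t e
    by (rule eqI[OF wT tangent_scale[OF X wT]])
       (use that subspace_Model[OF M] in \<open>simp_all add: subspace_scale wC\<close>)
  have zero: "e = 0" if e: "e \<in> Model M" and r0: "r e = 0" for e
  proof -
    have JT: "?J (w e) \<in> tangent_space ?X (p, q)" by (rule JD(1)[OF wT[OF e]])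
    have "?J (w e) = w (fst (?J (w e) C))"
      by (rule eqI[OF JT wT[OF in_Model(1)[OF JT]]])
         (use r0 in \<open>simp add: wC[OF in_Model(1)[OF JT]] r_def prod_eq_iff\<close>)
    then have "?J (w e) \<in> W" using wW[OF in_Model(1)[OF JT]] by simp
    then have "?J (w e) \<in> W \<inter> ?J ` W" using wW[OF e] by blast
    then have "?J (w e) = (\<lambda>_. 0)" using real by simp
    then have "(\<lambda>c. - w e c) = (\<lambda>_. 0)" using JD(2)[OF wT[OF e]] J0 by simp
    from fun_cong[OF this, of C] show ?thesis by (simp add: wC[OF e] zero_prod_def)
  qed
  obtain e where e: "e \<in> Model M" "r e = snd (v C)"
  proof (rule injective_endomorphism_span_surjective[OF B(1), of r "snd (v C)"])
    show "r x \<in> span B" if "x \<in> span B" for x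
      using in_Model(2)[OF JD(1)[OF wT]] that by (simp add: r_def B)
    show "r (x + y) = r x + r y" if "x \<in> span B" "y \<in> span B" for x y
      using that by (simp add: r_def w_add JD(4) wT B)
    show "r (t *\<^sub>R x) = t *\<^sub>R r x" if "x \<in> span B" for t x
      using that by (simp add: r_def w_scale JD(3) wT B)
    show "x = 0" if "x \<in> span B" "r x = 0" for x using zero that by (simp add: B)
    show "snd (v C) \<in> span B" using in_Model(2)[OF v] by (simp add: B)
  qed (simp add: B that)
  define f where "f = fst (v C) - fst (?J (w e) C)"
  have JT: "?J (w e) \<in> tangent_space ?X (p, q)" by (rule JD(1)[OF wT[OF e(1)]])
  have f: "f \<in> Model M"
    unfolding f_def by (intro subspace_diff subspace_Model M in_Model v JT)
  have "v = (\<lambda>c. w f c + ?J (w e) c)"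
    by (rule eqI[OF v tangent_add[OF X wT[OF f] JT]])
       (use e(2) in \<open>simp add: wC[OF f] r_def prod_eq_iff, simp add: f_def\<close>)
  then show thesis by (rule that[OF wW[OF f] wW[OF e(1)]])
qed

section \<open>Biinvariance and quasi-equivariance\<close>

text \<open>
  The condition on the right says that the polar map \<open>P\<close> turns \<open>R = right_act G z\<close> into a right
  translation of the complexification. If it does, holomorphy of that translation is pulled back
  through the injective differential of \<open>P\<close>. For the converse, \<open>F = P\<^sup>-\<^sup>1 (P \<circ> R)\<close> is holomorphic and
  constant on the left orbits, so its differential vanishes along them and, by complex linearity,
  altogether.
\<close>

lemma invariant_under_right_act_iff:
  fixes G :: "('a, 'e::real_normed_vector) lie_structure"
    and GC :: "('b, 'f::real_normed_vector) complex_lie_structure"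
  assumes G: "lie_group G" and GC: "complex_lie_group GC" and hom: "\<iota> \<in> hom G GC"
    and J: "almost_complex_structure (GxA G) J"
    and slice: "\<And>p. p \<in> points (GxA G) \<Longrightarrow>
      orbit_tangent_space G p \<inter> J p ` orbit_tangent_space G p = {\<lambda>_. 0}"
    and \<gamma>: "smooth_map (affine_lie_algebra G) (manif GC) \<gamma>"
    and hol: "holomorphic_map (GxA G) J (manif GC) (cstr GC) (polar_map GC \<iota> \<gamma>)"
    and imm: "\<And>p. p \<in> points (GxA G) \<Longrightarrow>
      inj_on (tangent_map (GxA G) (manif GC) (polar_map GC \<iota> \<gamma>) p) (tangent_space (GxA G) p)"
    and z: "z \<in> carrier G"
  shows "invariant_under (GxA G) J (right_act G z) \<longleftrightarrow>
    (\<exists>g\<in>carrier GC. \<forall>a\<in>lie_algebra G.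
       inv\<^bsub>GC\<^esub> (\<gamma> a) \<otimes>\<^bsub>GC\<^esub> \<iota> z \<otimes>\<^bsub>GC\<^esub> \<gamma> (Ad G (inv\<^bsub>G\<^esub> z) a) \<otimes>\<^bsub>GC\<^esub> inv\<^bsub>GC\<^esub> (\<iota> z) = g)"
proof -
  let ?M = "manif G" and ?A = "affine_lie_algebra G" and ?X = "GxA G" and ?C = "manif GC"
  define P where "P = polar_map GC \<iota> \<gamma>"
  define R where "R = right_act G z"
  have grG: "group G" and ptsG: "points ?M = carrier G" and M: "smooth_atlas ?M"
    using G by (simp_all add: lie_group_def smooth_manifold_imp_smooth_atlas)
  have LC: "lie_group GC" using GC by (simp add: complex_lie_group_def)
  have grC: "group GC" and ptsC: "points ?C = carrier GC" and C: "smooth_atlas ?C"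
    using LC by (simp_all add: lie_group_def smooth_manifold_imp_smooth_atlas)
  have K: "almost_complex_structure ?C (cstr GC)"
    using GC by (simp add: complex_lie_group_def complex_structure_def)
  interpret G: group G by (rule grG)
  interpret GC: group GC by (rule grC)
  have one: "\<one>\<^bsub>G\<^esub> \<in> points ?M" by (simp add: ptsG)
  have A: "smooth_atlas ?A" by (rule smooth_atlas_tangent[OF M])
  have ptsA: "points ?A = lie_algebra G" by (simp add: points_tangent[OF one] lie_algebra_def)
  have X: "smooth_atlas ?X" unfolding GxA_def by (rule smooth_atlas_prod[OF M A])
  have ptsX: "points ?X = carrier G \<times> lie_algebra G"
    by (simp add: GxA_def points_prod ptsG ptsA)
  have \<iota>: "\<iota> x \<in> carrier GC" if "x \<in> carrier G" for x using hom that by (rule hom_in_carrier)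
  have \<gamma>C: "\<gamma> a \<in> carrier GC" if "a \<in> lie_algebra G" for a
    using smooth_map_points[OF \<gamma> A C, of a] that by (simp add: ptsA ptsC)
  have iz: "inv\<^bsub>G\<^esub> z \<in> carrier G" using z by simp
  have sAd: "smooth_map ?A ?A (Ad G (inv\<^bsub>G\<^esub> z))" by (rule smooth_map_Ad[OF G iz])
  have Ad: "Ad G (inv\<^bsub>G\<^esub> z) a \<in> lie_algebra G" if "a \<in> lie_algebra G" for a
    using smooth_map_points[OF sAd A A, of a] that by (simp add: ptsA)
  have fstX: "smooth_map ?X ?M fst" and sndX: "smooth_map ?X ?A snd"
    unfolding GxA_def by (rule smooth_map_fst(1)[OF M A], rule smooth_map_snd(1)[OF M A])
  have R_eq: "R = (\<lambda>p. (fst p \<otimes>\<^bsub>G\<^esub> z, Ad G (inv\<^bsub>G\<^esub> z) (snd p)))"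
    by (auto simp: R_def right_act_def)
  have sR: "smooth_map ?X ?X R"
    unfolding R_eq GxA_def[of G]
    by (intro smooth_map_Pair smooth_map_mult smooth_map_const
          smooth_map_compose[OF _ _ _ sndX[unfolded GxA_def] sAd] fstX[unfolded GxA_def]
          G M A X[unfolded GxA_def]) (simp add: ptsG z)
  have sP: "smooth_map ?X ?C P" unfolding P_def by (rule holomorphic_map_smooth[OF hol])
  have sPR: "smooth_map ?X ?C (\<lambda>p. P (R p))" by (rule smooth_map_compose[OF X X C sR sP])
  have P_eq: "P (x, a) = \<iota> x \<otimes>\<^bsub>GC\<^esub> \<gamma> a" for x a by (simp add: P_def polar_map_def)
  have PR_eq: "P (R (x, a)) = \<iota> x \<otimes>\<^bsub>GC\<^esub> (\<iota> z \<otimes>\<^bsub>GC\<^esub> \<gamma> (Ad G (inv\<^bsub>G\<^esub> z) a))"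
    if "x \<in> carrier G" "a \<in> lie_algebra G" for x a
    using that z \<iota> \<gamma>C Ad hom by (simp add: R_eq P_eq hom_mult GC.m_assoc)
  have cancel: "u \<otimes>\<^bsub>GC\<^esub> (inv\<^bsub>GC\<^esub> u \<otimes>\<^bsub>GC\<^esub> v) = v" "inv\<^bsub>GC\<^esub> u \<otimes>\<^bsub>GC\<^esub> (u \<otimes>\<^bsub>GC\<^esub> v) = v"
    if "u \<in> carrier GC" "v \<in> carrier GC" for u v
    using that by (simp_all add: GC.m_assoc[symmetric])
  show ?thesis
  proof
    assume "\<exists>g\<in>carrier GC. \<forall>a\<in>lie_algebra G.
      inv\<^bsub>GC\<^esub> (\<gamma> a) \<otimes>\<^bsub>GC\<^esub> \<iota> z \<otimes>\<^bsub>GC\<^esub> \<gamma> (Ad G (inv\<^bsub>G\<^esub> z) a) \<otimes>\<^bsub>GC\<^esub> inv\<^bsub>GC\<^esub> (\<iota> z) = g"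
    then obtain g where g: "g \<in> carrier GC" and eq: "\<And>a. a \<in> lie_algebra G \<Longrightarrow>
      inv\<^bsub>GC\<^esub> (\<gamma> a) \<otimes>\<^bsub>GC\<^esub> \<iota> z \<otimes>\<^bsub>GC\<^esub> \<gamma> (Ad G (inv\<^bsub>G\<^esub> z) a) \<otimes>\<^bsub>GC\<^esub> inv\<^bsub>GC\<^esub> (\<iota> z) = g" by blast
    define k where "k = g \<otimes>\<^bsub>GC\<^esub> \<iota> z"
    have k: "k \<in> carrier GC" using g \<iota>[OF z] by (simp add: k_def)
    have trans: "P (R p) = P p \<otimes>\<^bsub>GC\<^esub> k" if pX: "p \<in> points ?X" for p
    proof -
      obtain x a where p: "p = (x, a)" and x: "x \<in> carrier G" and a: "a \<in> lie_algebra G"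
        using pX by (auto simp: ptsX)
      have "\<gamma> a \<otimes>\<^bsub>GC\<^esub> k = \<iota> z \<otimes>\<^bsub>GC\<^esub> \<gamma> (Ad G (inv\<^bsub>G\<^esub> z) a)"
        using \<iota>[OF z] \<gamma>C[OF a] \<gamma>C[OF Ad[OF a]]
        by (simp add: k_def eq[OF a, symmetric] GC.m_assoc cancel)
      then show ?thesis using x a k \<iota>[OF x] \<gamma>C[OF a] by (simp add: p PR_eq) (simp add: P_eq GC.m_assoc)
    qed
    have hk: "holomorphic_map ?X J ?C (cstr GC) (\<lambda>p. P p \<otimes>\<^bsub>GC\<^esub> k)"
      by (intro holomorphic_map_mult GC X J hol[folded P_def] holomorphic_map_const C K)
         (simp add: ptsC k)
    show "invariant_under ?X J (right_act G z)"
      unfolding invariant_under_def R_def[symmetric]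
    proof (intro ballI)
      fix p v assume p: "p \<in> points ?X" and v: "v \<in> tangent_space ?X p"
      have Rp: "R p \<in> points ?X" by (rule smooth_map_points[OF sR X X p])
      note Jv = almost_complex_structureD(1)[OF J p v]
      note Rv = tangent_map_tangent[OF sR X X p v]
      have comp: "tangent_map ?X ?C (\<lambda>p. P p \<otimes>\<^bsub>GC\<^esub> k) p u = tangent_map ?X ?C P (R p) (tangent_map ?X ?X R p u)"
        if u: "u \<in> tangent_space ?X p" for u
        using tangent_map_cong[OF sPR holomorphic_map_smooth[OF hk] X C trans p u]
          tangent_map_compose[where f = R and g = P, OF X X C sR sP p u] by simp
      have "tangent_map ?X ?C P (R p) (tangent_map ?X ?X R p (J p v))
          = cstr GC (P (R p)) (tangent_map ?X ?C P (R p) (tangent_map ?X ?X R p v))"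
        using holomorphic_mapD[OF hk p v] by (simp add: comp v Jv trans[OF p])
      also have "\<dots> = tangent_map ?X ?C P (R p) (J (R p) (tangent_map ?X ?X R p v))"
        using holomorphic_mapD[OF hol[folded P_def] Rp Rv] by simp
      finally show "tangent_map ?X ?X R p (J p v) = J (R p) (tangent_map ?X ?X R p v)"
        using inj_onD[OF imm[OF Rp, folded P_def] _ tangent_map_tangent[OF sR X X p Jv]
            almost_complex_structureD(1)[OF J Rp Rv]] by blast
    qed
  next
    assume inv: "invariant_under ?X J (right_act G z)"
    have hR: "holomorphic_map ?X J ?X J R"
      using inv sR by (simp add: holomorphic_map_def invariant_under_def R_def)
    define F where "F p = inv\<^bsub>GC\<^esub> (P p) \<otimes>\<^bsub>GC\<^esub> P (R p)" for p
    define h where "h a = F (\<one>\<^bsub>G\<^esub>, a)" for a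
    have hF: "holomorphic_map ?X J ?C (cstr GC) F"
      unfolding F_def
      by (intro holomorphic_map_mult holomorphic_map_inverse holomorphic_map_compose[OF X X C J hR]
            GC X J hol[folded P_def])
    note sF = holomorphic_map_smooth[OF hF]
    have F_eq: "F (x, a) = inv\<^bsub>GC\<^esub> (\<gamma> a) \<otimes>\<^bsub>GC\<^esub> \<iota> z \<otimes>\<^bsub>GC\<^esub> \<gamma> (Ad G (inv\<^bsub>G\<^esub> z) a)"
      if x: "x \<in> carrier G" and a: "a \<in> lie_algebra G" for x a
    proof -
      have "F (x, a) = inv\<^bsub>GC\<^esub> (\<gamma> a) \<otimes>\<^bsub>GC\<^esub> (inv\<^bsub>GC\<^esub> (\<iota> x) \<otimes>\<^bsub>GC\<^esub>
          (\<iota> x \<otimes>\<^bsub>GC\<^esub> (\<iota> z \<otimes>\<^bsub>GC\<^esub> \<gamma> (Ad G (inv\<^bsub>G\<^esub> z) a))))"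
        using \<iota>[OF x] \<iota>[OF z] \<gamma>C[OF a] \<gamma>C[OF Ad[OF a]]
        by (simp add: F_def PR_eq[OF x a] P_eq GC.inv_mult_group GC.m_assoc)
      then show ?thesis
        using \<iota>[OF x] \<iota>[OF z] \<gamma>C[OF a] \<gamma>C[OF Ad[OF a]] by (simp add: GC.m_assoc cancel)
    qed
    have dF: "tangent_map ?X ?C F p v = (\<lambda>_. 0)"
      if p: "p \<in> points ?X" and v: "v \<in> tangent_space ?X p" for p v
    proof -
      obtain x a where pxa: "p = (x, a)" and x: "x \<in> points ?M" and a: "a \<in> points ?A"
        using p by (auto simp: ptsX ptsG ptsA)
      define W where "W = tangent_map ?M (prod_manifold ?M ?A) (\<lambda>y. (y, a)) x ` tangent_space ?M x"
      have orbit: "orbit_tangent_space G (x, a) = W" by (simp add: orbit_tangent_space_def W_def GxA_def)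
      have si: "smooth_map ?M ?X (\<lambda>y. (y, a))"
        unfolding GxA_def by (rule smooth_map_Pair[OF M M A smooth_map_id[OF M] smooth_map_const[OF M A a]])
      have W0: "tangent_map ?X ?C F p w = (\<lambda>_. 0)" and WT: "w \<in> tangent_space ?X p" if w: "w \<in> W" for w
      proof -
        obtain u where u: "u \<in> tangent_space ?M x" and wu: "w = tangent_map ?M ?X (\<lambda>y. (y, a)) x u"
          using w by (auto simp: W_def GxA_def)
        show "w \<in> tangent_space ?X p"
          unfolding wu pxa by (rule tangent_map_tangent[where f = "\<lambda>y. (y, a)", OF si M X x u])
        have "tangent_map ?X ?C F p w = tangent_map ?M ?C (\<lambda>y. F (y, a)) x u"
          using tangent_map_compose[where f = "\<lambda>y. (y, a)" and g = F, OF M X C si sF x u] by (simp add: wu pxa)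
        also have "\<dots> = tangent_map ?M ?C (\<lambda>y. h a) x u"
        proof (rule tangent_map_cong[OF _ _ M C _ x u])
          show "smooth_map ?M ?C (\<lambda>y. F (y, a))" by (rule smooth_map_compose[OF M X C si sF])
          show "smooth_map ?M ?C (\<lambda>y. h a)"
            unfolding h_def using smooth_map_points[OF sF X C, of "(\<one>\<^bsub>G\<^esub>, a)"] a
            by (intro smooth_map_const M C) (simp add: ptsX ptsA)
          show "F (y, a) = h a" if "y \<in> points ?M" for y
            using that a by (simp add: h_def F_eq ptsG ptsA)
        qed
        also have "\<dots> = (\<lambda>_. 0)"
          unfolding h_def using smooth_map_points[OF sF X C, of "(\<one>\<^bsub>G\<^esub>, a)"] a
          by (intro tangent_map_const[OF M C _ x u]) (simp add: ptsX ptsA)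
        finally show "tangent_map ?X ?C F p w = (\<lambda>_. 0)" .
      qed
      \<comment> \<open>\<open>dF\<close> vanishes on \<open>W\<close>, hence on \<open>J W\<close>, and these two span.\<close>
      have "W \<inter> J (x, a) ` W = {\<lambda>_. 0}" using slice[OF p] by (simp add: pxa orbit)
      then obtain w1 w2 where w: "w1 \<in> W" "w2 \<in> W" and vw: "v = (\<lambda>c. w1 c + J p w2 c)"
        using totally_real_slice_spans[OF M A Model_tangent J[unfolded GxA_def] x a W_def] v
        unfolding pxa GxA_def by blast
      have "tangent_map ?X ?C F p (J p w2) = cstr GC (F p) (\<lambda>_. 0)"
        using holomorphic_mapD[OF hF p WT[OF w(2)]] W0[OF w(2)] by simp
      also have "\<dots> = (\<lambda>_. 0)"
        by (rule almost_complex_structure_zero[OF K C smooth_map_points[OF sF X C p]])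
      finally show ?thesis
        unfolding vw using tangent_map_add[OF sF X C p WT[OF w(1)]
            almost_complex_structureD(1)[OF J p WT[OF w(2)]]]
          W0[OF w(1)] by simp
    qed
    have sj: "smooth_map ?A ?X (\<lambda>a. (\<one>\<^bsub>G\<^esub>, a))"
      unfolding GxA_def by (rule smooth_map_Pair[OF A M A smooth_map_const[OF A M one] smooth_map_id[OF A]])
    have sh: "smooth_map ?A ?C h" unfolding h_def by (rule smooth_map_compose[OF A X C sj sF])
    have const: "h a = h b" if a: "a \<in> lie_algebra G" and b: "b \<in> lie_algebra G" for a b
    proof (rule zero_tangent_map_imp_constant[OF sh M C one])
      fix a v assume "a \<in> tangent_space ?M \<one>\<^bsub>G\<^esub>" and v: "v \<in> tangent_space ?A a"
      then have a: "a \<in> points ?A" by (simp add: ptsA lie_algebra_def)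
      have "tangent_map ?A ?C h a v
          = tangent_map ?X ?C F (\<one>\<^bsub>G\<^esub>, a) (tangent_map ?A ?X (\<lambda>a. (\<one>\<^bsub>G\<^esub>, a)) a v)"
        unfolding h_def
        by (rule tangent_map_compose[where f = "\<lambda>a. (\<one>\<^bsub>G\<^esub>, a)" and g = F, OF A X C sj sF a v])
      also have "\<dots> = (\<lambda>_. 0)"
        by (rule dF) (use smooth_map_points[OF sj A X a]
          tangent_map_tangent[where f = "\<lambda>a. (\<one>\<^bsub>G\<^esub>, a)", OF sj A X a v] in auto)
      finally show "tangent_map ?A ?C h a v = (\<lambda>_. 0)" .
    qed (use a b in \<open>simp_all add: lie_algebra_def\<close>)
    have zero: "(\<lambda>_. 0) \<in> lie_algebra G" unfolding lie_algebra_def by (rule tangent_zero[OF M])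
    show "\<exists>g\<in>carrier GC. \<forall>a\<in>lie_algebra G.
      inv\<^bsub>GC\<^esub> (\<gamma> a) \<otimes>\<^bsub>GC\<^esub> \<iota> z \<otimes>\<^bsub>GC\<^esub> \<gamma> (Ad G (inv\<^bsub>G\<^esub> z) a) \<otimes>\<^bsub>GC\<^esub> inv\<^bsub>GC\<^esub> (\<iota> z) = g"
    proof (intro bexI ballI)
      show "h (\<lambda>_. 0) \<otimes>\<^bsub>GC\<^esub> inv\<^bsub>GC\<^esub> (\<iota> z) \<in> carrier GC"
        using smooth_map_points[OF sh A C, of "\<lambda>_. 0"] zero \<iota>[OF z] by (simp add: ptsA ptsC)
      fix a assume a: "a \<in> lie_algebra G"
      show "inv\<^bsub>GC\<^esub> (\<gamma> a) \<otimes>\<^bsub>GC\<^esub> \<iota> z \<otimes>\<^bsub>GC\<^esub> \<gamma> (Ad G (inv\<^bsub>G\<^esub> z) a) \<otimes>\<^bsub>GC\<^esub> inv\<^bsub>GC\<^esub> (\<iota> z)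
          = h (\<lambda>_. 0) \<otimes>\<^bsub>GC\<^esub> inv\<^bsub>GC\<^esub> (\<iota> z)"
        using const[OF a zero] F_eq[OF G.one_closed a] by (simp add: h_def)
    qed
  qed
qed

theorem theorem3p2:
  fixes G :: "('a, 'e::real_normed_vector) lie_structure"
    and GC :: "('b, 'f::real_normed_vector) complex_lie_structure"
    and \<iota> :: "'a \<Rightarrow> 'b"
    and J :: "('a \<times> ('a, 'e) tvec, 'e \<times> 'e) tensor"
    and \<gamma> :: "('a, 'e) tvec \<Rightarrow> 'b"
  assumes "lie_group G"
    and "connected_space (manifold_topology (manif G))"
    and "universal_complexification G GC \<iota>"
    and "standing_assumption G GC \<iota>"
    and "admissible G J"
    and "induces G GC \<iota> \<gamma> J"
  shows "biinvariant G J \<longleftrightarrow> quasi_equivariant G GC \<iota> \<gamma>"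
proof -
  let ?M = "manif G" and ?C = "manif GC"
  let ?q = "\<lambda>x a. inv\<^bsub>GC\<^esub> (\<gamma> a) \<otimes>\<^bsub>GC\<^esub> \<iota> x \<otimes>\<^bsub>GC\<^esub> \<gamma> (Ad G (inv\<^bsub>G\<^esub> x) a) \<otimes>\<^bsub>GC\<^esub> inv\<^bsub>GC\<^esub> (\<iota> x)"
  let ?o = "\<lambda>_::('a, 'e) chart. 0::'e"
  have GC: "complex_lie_group GC" and hom: "\<iota> \<in> hom G GC" and s\<iota>: "smooth_map ?M ?C \<iota>"
    using assms(3) by (simp_all add: universal_complexification_def lie_hom_def)
  have J: "almost_complex_structure (GxA G) J" and left: "left_invariant G J"
    and slice: "\<And>p. p \<in> points (GxA G) \<Longrightarrow>
      orbit_tangent_space G p \<inter> J p ` orbit_tangent_space G p = {\<lambda>_. 0}"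
    using assms(5) by (simp_all add: admissible_def complex_structure_def)
  have \<gamma>: "smooth_map (affine_lie_algebra G) ?C \<gamma>"
    and hol: "holomorphic_map (GxA G) J ?C (cstr GC) (polar_map GC \<iota> \<gamma>)"
    and imm: "\<And>p. p \<in> points (GxA G) \<Longrightarrow>
      inj_on (tangent_map (GxA G) ?C (polar_map GC \<iota> \<gamma>) p) (tangent_space (GxA G) p)"
    using assms(6) by (simp_all add: induces_def immersion_def)
  have gr: "group G" and pts: "points ?M = carrier G" and M: "smooth_atlas ?M"
    using assms(1) by (simp_all add: lie_group_def smooth_manifold_imp_smooth_atlas)
  have LC: "lie_group GC" using GC by (simp add: complex_lie_group_def)
  have C: "smooth_atlas ?C" and ptsC: "points ?C = carrier GC"
    using LC by (simp_all add: lie_group_def smooth_manifold_imp_smooth_atlas)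
  interpret G: group G by (rule gr)
  have zero: "?o \<in> lie_algebra G" unfolding lie_algebra_def by (rule tangent_zero[OF M])
  have \<gamma>0: "\<gamma> ?o \<in> points ?C"
    using smooth_map_points[OF \<gamma> smooth_atlas_tangent[OF M] C, of ?o] zero
    by (simp add: points_tangent pts lie_algebra_def)
  have \<gamma>0': "inv\<^bsub>GC\<^esub> (\<gamma> ?o) \<in> points ?C"
    using \<gamma>0 LC by (simp add: ptsC lie_group_def)
  have iff: "invariant_under (GxA G) J (right_act G x) \<longleftrightarrow>
      (\<exists>g\<in>carrier GC. \<forall>a\<in>lie_algebra G. ?q x a = g)" if "x \<in> carrier G" for x
    by (rule invariant_under_right_act_iff[OF assms(1) GC hom J slice \<gamma> hol imm that])
  show ?thesis
  proof
    assume "biinvariant G J"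
    then have "\<exists>g\<in>carrier GC. \<forall>a\<in>lie_algebra G. ?q x a = g" if "x \<in> carrier G" for x
      using iff[OF that] that by (simp add: biinvariant_def right_invariant_def)
    then have const: "?q x a = ?q x ?o" if "x \<in> carrier G" "a \<in> lie_algebra G" for x a
      using that zero by metis
    have q0: "?q x ?o = inv\<^bsub>GC\<^esub> (\<gamma> ?o) \<otimes>\<^bsub>GC\<^esub> \<iota> x \<otimes>\<^bsub>GC\<^esub> \<gamma> ?o \<otimes>\<^bsub>GC\<^esub> inv\<^bsub>GC\<^esub> (\<iota> x)"
      if "x \<in> carrier G" for x
      using Ad_zero[OF assms(1), of "inv\<^bsub>G\<^esub> x"] that by simp
    \<comment> \<open>The value at \<open>a = 0\<close>, where \<open>Ad\<close> drops out, is visibly smooth in \<open>x\<close>.\<close>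
    let ?c = "\<lambda>x. inv\<^bsub>GC\<^esub> (\<gamma> ?o) \<otimes>\<^bsub>GC\<^esub> \<iota> x \<otimes>\<^bsub>GC\<^esub> \<gamma> ?o \<otimes>\<^bsub>GC\<^esub> inv\<^bsub>GC\<^esub> (\<iota> x)"
    show "quasi_equivariant G GC \<iota> \<gamma>"
      unfolding quasi_equivariant_def
    proof (intro exI[of _ ?c] conjI ballI)
      show "smooth_map ?M ?C ?c"
        by (intro smooth_map_mult[OF LC M] smooth_map_inverse[OF LC M] smooth_map_const[OF M C] s\<iota> \<gamma>0 \<gamma>0')
      show "?q x a = ?c x" if "x \<in> carrier G" "a \<in> lie_algebra G" for x a
        by (rule trans[OF const[OF that] q0[OF that(1)]])
    qed
  next
    assume "quasi_equivariant G GC \<iota> \<gamma>"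
    then obtain c where c: "smooth_map ?M ?C c"
      and eq: "\<And>x a. x \<in> carrier G \<Longrightarrow> a \<in> lie_algebra G \<Longrightarrow> ?q x a = c x"
      unfolding quasi_equivariant_def by blast
    have "invariant_under (GxA G) J (right_act G x)" if x: "x \<in> carrier G" for x
      unfolding iff[OF x] using smooth_map_points[OF c M C, of x] eq[OF x] x
      by (intro bexI[of _ "c x"]) (simp_all add: pts ptsC)
    then show "biinvariant G J" using left by (simp add: biinvariant_def right_invariant_def)
  qed
qed

end
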